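(* Let $G$ be a finite subgroup of $\mathrm{PSU}_2(\mathbb{C})$ acting on $\mathbb{P}^1=\mathbb{P}^1(\mathbb{C})$ by homographies, $n\geq1$, $\underline{q}_n=(q_1,\dots,q_n)\in\mathrm{Cf}_G(n,\mathbb{P}^1_* )$, $r:\tilde C\to\mathrm{Cf}_G(n,\mathbb{P}^1_* )$ the universal covering, $\tilde{\underline{q}}_n\in r^{-1}(\underline{q}_n)$, and let $\rho_{\tilde{\underline{q}}_n}:\pi_1(\mathrm{Cf}_G(n,\mathbb{P}^1_* ),\underline{q}_n)\to\mathcal{G}(\widehat{\mathrm{U}}\mathfrak{p}_n(G)(\mathbb{C}))$ be the monodromy representation (an anti-morphism of groups) of the flat connection $\omega$. For $1\leq i<j\leq n$, $g\in G$, $k\in[1,n]$ and $p\in\mathbb{P}^1\setminus\mathbb{P}^1_*$ one has $$\rho_{\tilde{\underline{q}}_n}(x_{ij}^g)=1-2\mathrm{i}\pi X_{ij}(g)+R_{ij}(g),\qquad \rho_{\tilde{\underline{q}}_n}(x_k^p)=1-2\mathrm{i}\pi X_k(p)+R_k(p),$$ where $R_{ij}(g)$ and $R_k(p)$ contain only terms of degree at least two.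
   Context: Notation: $[1,n]=\{1,\dots,n\}$; $\mathbb{P}^1_*$ is the set of points of $\mathbb{P}^1$ with trivial stabilizer in $G$; $\mathcal{O}(p)$ and $\mathrm{stab}(p)$ are the $G$-orbit and stabilizer of $p$; $\mathrm{Cf}_G(n,\mathbb{P}^1_* )=\{(p_1,\dots,p_n)\in(\mathbb{P}^1_* )^n \mid p_i\neq g\cdot p_j \text{ for all } i\neq j,\ g\in G\}$. $\mathfrak{p}_n(G)(\mathbb{C})$ is the $\mathbb{C}$-Lie algebra with generators $X_{ij}(g)$ ($i\neq j\in[1,n]$, $g\in G$) and $X_i(q)$ ($i\in[1,n]$, $q\in\mathbb{P}^1\setminus\mathbb{P}^1_*$) and relations: (1) $X_{ij}(g)=X_{ji}(g^{-1})$ for $i\ne j$, $g\in G$; (2) $\sum_{q\in\mathbb{P}^1\setminus\mathbb{P}^1_*}X_i(q)+\sum_{m\neq i}\sum_{g\in G}X_{im}(g)=0$ for $i\in[1,n]$; (3) $[X_{ij}(g),X_{kl}(g')]=0$ for $i,j,k,l$ distinct, $g,g'\in G$; (4) $[X_{ij}(g),X_{kj}(g'g)+X_{ki}(g')]=0$ and $[X_i(p),X_{jk}(g')]=0$ for $i,j,k$ distinct, $p\in\mathbb{P}^1\setminus\mathbb{P}^1_*$, $g,g'\in G$; and, for $i\neq j$, $g\in G$, $p\in\mathbb{P}^1\setminus\mathbb{P}^1_*$, $q\in(\mathbb{P}^1\setminus\mathbb{P}^1_* )\setminus\mathcal{O}(p)$: (5) $[X_i(p),X_j(q)]=0$; (6)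 $[X_{ij}(g),X_j(p)+X_i(g\cdot p)+\sum_{h\in\mathrm{stab}(p)}X_{ij}(gh)]=0$; (7) $[X_j(p),X_i(g\cdot p)+\sum_{h\in\mathrm{stab}(p)}X_{ij}(gh)]=0$. It is graded with generators in degree $1$; $\widehat{\mathrm{U}}\mathfrak{p}_n(G)(\mathbb{C})$ is the degree completion of its enveloping algebra, a complete Hopf algebra; $\mathcal{G}$ denotes the group of group-like (diagonal) elements. Connection: $\omega$ is the unique holomorphic $1$-form on $\mathrm{Cf}_G(n,\mathbb{P}^1_* )$ with values in $\widehat{\mathrm{U}}\mathfrak{p}_n(G)(\mathbb{C})$ equal, where all coordinates $z_i$ are $\neq\infty$, to $\sum_{i}\sum_{p\in\mathbb{P}^1\setminus\mathbb{P}^1_*}d\log(z_i-p)\widehat\otimes X_i(p)+\sum_{i\neq j}\sum_{g\in G}\frac{dz_i}{z_i-g\cdot z_j}\widehat\otimes X_{ij}(g)$ (with $d\log(z-\infty)=0$); it satisfies $d\omega=\omega\wedge\omega=0$ and has values in primitive elements. Monodromy: let $F:\tilde C\to\widehat{\mathrm{U}}\mathfrak{p}_n(G)(\mathbb{C})$ be the unique solution of $dF=r^*(\omega)\wedge F$, $F(\tilde{\underline{q}}_n)=1$; then $\rho_{\tilde{\underline{q}}_n}(\gamma)=F(\gamma\cdot\tilde{\underline{q}}_n)$, where $\gamma\cdot\tilde{\underline{q}}_n$ is the endpoint of the lift of $\gamma$ starting at $\tilde{\underline{q}}_n$. Loops: for $i\neq j$ and $g\in G$ (resp. $p\in\mathbb{P}^1\setminus\mathbb{P}^1_*$),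 $\gamma_{ij}^g$ (resp. $\gamma_i^p$) is a simple loop in $\mathbb{P}^1$ based at $q_i$ separating the sphere into two open discs, the first containing $g\cdot q_j$ (resp. $p$), the second containing all the points of $(\bigcup_{l\in[1,n]}G\cdot q_l)\cup(\mathbb{P}^1\setminus\mathbb{P}^1_* )$ different from $q_i$ and $g\cdot q_j$ (resp. from $q_i$ and $p$); it is oriented so as to turn clockwise (negatively for the complex orientation of $\mathbb{P}^1$) around $g\cdot q_j$ (resp. $p$). $x_{ij}^g$ (resp. $x_i^p$) is the loop of $\mathrm{Cf}_G(n,\mathbb{P}^1_* )$ based at $\underline{q}_n$ which is the image of $\gamma_{ij}^g$ (resp. $\gamma_i^p$) under $x\mapsto(q_1,\dots,q_{i-1},x,q_{i+1},\dots,q_n)$. *)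

theory Defs
  imports
    "HOL-Complex_Analysis.Complex_Analysis"
    "HOL-Algebra.QuotRing"
    "HOL-Algebra.Group_Action"
    "HOL-Library.Poly_Mapping"
begin

section \<open>The projective line\<close>

datatype P1 = Aff complex | Infty

text \<open>The two standard charts: \<open>chart False\<close> is the coordinate \<open>z\<close>, \<open>chart True\<close> is the
  coordinate \<open>1/z\<close> near infinity. The topology is the one glued from the charts.\<close>

definition chart :: "bool \<Rightarrow> complex \<Rightarrow> P1" where
  "chart b t = (if b then (if t = 0 then Infty else Aff (1 / t)) else Aff t)"

instantiation P1 :: topological_space
begin

definition open_P1 :: "P1 set \<Rightarrow> bool" where
  "open_P1 U \<longleftrightarrow> (\<forall>b. open (chart b -` U))"

instance
  by standard (auto simp: open_P1_def vimage_Union)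

end


section \<open>Projective special unitary group\<close>

definition SU2 :: "(complex^2^2) monoid" where
  "SU2 = \<lparr>carrier = {A. A ** (\<chi> i j. cnj (A $ j $ i)) = mat 1 \<and> det A = 1},
          mult = (**), one = mat 1\<rparr>"

definition PSU2 :: "(complex^2^2) set monoid" where
  "PSU2 = SU2 Mod {mat 1, - mat 1}"

definition homography :: "complex^2^2 \<Rightarrow> P1 \<Rightarrow> P1" where
  "homography A x =
     (let (u, v) = (case x of Aff z \<Rightarrow> (A$1$1 * z + A$1$2, A$2$1 * z + A$2$2)
                            | Infty \<Rightarrow> (A$1$1, A$2$1))
      in if v = 0 then Infty else Aff (u / v))"

text \<open>Elements of \<^const>\<open>PSU2\<close> are pairs \<open>{A, -A}\<close>, and \<open>A\<close>, \<open>-A\<close> define the same homography.\<close>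

definition act :: "(complex^2^2) set \<Rightarrow> P1 \<Rightarrow> P1" where
  "act g = homography (SOME A. A \<in> g)"

abbreviation stab :: "(complex^2^2) set set \<Rightarrow> P1 \<Rightarrow> (complex^2^2) set set" where
  "stab G \<equiv> stabilizer (PSU2\<lparr>carrier := G\<rparr>) act"

abbreviation orb :: "(complex^2^2) set set \<Rightarrow> P1 \<Rightarrow> P1 set" where
  "orb G \<equiv> orbit (PSU2\<lparr>carrier := G\<rparr>) act"

definition P1_star :: "(complex^2^2) set set \<Rightarrow> P1 set" where
  "P1_star G = {p. stab G p = {\<one>\<^bsub>PSU2\<^esub>}}"

definition Cf :: "(complex^2^2) set set \<Rightarrow> (P1^'n) set" where
  "Cf G = {x. (\<forall>i. x $ i \<in> P1_star G) \<and>
              (\<forall>i j. \<forall>g\<in>G. i \<noteq> j \<longrightarrow> x $ i \<noteq> act g (x $ j))}"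


section \<open>Lie algebras given by generators and relations\<close>

datatype 'x magma = Leaf 'x | Node "'x magma" "'x magma"

primrec leaf_count :: "'x magma \<Rightarrow> nat" where
  "leaf_count (Leaf x) = 1"
| "leaf_count (Node s t) = leaf_count s + leaf_count t"

text \<open>The free non-associative algebra is the algebra of the free magma.\<close>

type_synonym 'x na = "'x magma \<Rightarrow>\<^sub>0 complex"

definition na_gen :: "'x \<Rightarrow> 'x na" where
  "na_gen x = Poly_Mapping.single (Leaf x) 1"

definition na_scale :: "complex \<Rightarrow> 'x na \<Rightarrow> 'x na" where
  "na_scale c a = Poly_Mapping.map ((*) c) a"

definition na_times :: "'x na \<Rightarrow> 'x na \<Rightarrow> 'x na" (infixl \<open>\<star>\<close> 70) where
  "a \<star> b = (\<Sum>s\<in>Poly_Mapping.keys a. \<Sum>t\<in>Poly_Mapping.keys b.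
     Poly_Mapping.single (Node s t) (Poly_Mapping.lookup a s * Poly_Mapping.lookup b t))"

definition free_na :: "'x set \<Rightarrow> 'x na set" where
  "free_na X = {a. \<forall>t\<in>Poly_Mapping.keys a. set_magma t \<subseteq> X}"

definition na_ideal :: "'x set \<Rightarrow> 'x na set \<Rightarrow> bool" where
  "na_ideal X I \<longleftrightarrow> I \<subseteq> free_na X \<and> 0 \<in> I \<and> (\<forall>a\<in>I. \<forall>b\<in>I. a + b \<in> I) \<and>
     (\<forall>c. \<forall>a\<in>I. na_scale c a \<in> I) \<and> (\<forall>a\<in>I. \<forall>b\<in>free_na X. a \<star> b \<in> I \<and> b \<star> a \<in> I)"

definition lie_axioms :: "'x set \<Rightarrow> 'x na set" where
  "lie_axioms X = {a \<star> a | a. a \<in> free_na X} \<union>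
     {a \<star> (b \<star> c) + b \<star> (c \<star> a) + c \<star> (a \<star> b) | a b c.
        a \<in> free_na X \<and> b \<in> free_na X \<and> c \<in> free_na X}"

definition lie_ideal :: "'x set \<Rightarrow> 'x na set \<Rightarrow> 'x na set" where
  "lie_ideal X R = \<Inter>{I. na_ideal X I \<and> lie_axioms X \<union> R \<subseteq> I}"

definition na_coset :: "'x na set \<Rightarrow> 'x na \<Rightarrow> 'x na set" where
  "na_coset I a = {b. b - a \<in> I}"

record 'a graded_lie = "'a partial_object" +
  lie_add :: "'a \<Rightarrow> 'a \<Rightarrow> 'a"
  lie_scale :: "complex \<Rightarrow> 'a \<Rightarrow> 'a"
  lie_bracket :: "'a \<Rightarrow> 'a \<Rightarrow> 'a"
  lie_grade :: "nat \<Rightarrow> 'a set"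

text \<open>The complex Lie algebra with generators \<open>X\<close> and relators \<open>R\<close>; \<open>lie_grade d\<close> is the image
  of the span of the monomials of degree \<open>d\<close>, all generators having degree 1.\<close>

definition presented_lie :: "'x set \<Rightarrow> 'x na set \<Rightarrow> 'x na set graded_lie" where
  "presented_lie X R = (let I = lie_ideal X R in
     \<lparr>carrier = na_coset I ` free_na X,
      lie_add = (\<lambda>u v. \<Union>a\<in>u. \<Union>b\<in>v. na_coset I (a + b)),
      lie_scale = (\<lambda>c u. \<Union>a\<in>u. na_coset I (na_scale c a)),
      lie_bracket = (\<lambda>u v. \<Union>a\<in>u. \<Union>b\<in>v. na_coset I (a \<star> b)),
      lie_grade = (\<lambda>d. na_coset I `
         {a \<in> free_na X. \<forall>t\<in>Poly_Mapping.keys a. leaf_count t = d})\<rparr>)"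


section \<open>Enveloping algebra and its degree completion\<close>

datatype 'a free_monoid = Word (letters: "'a list")

instantiation free_monoid :: (type) monoid_add
begin

definition zero_free_monoid :: "'a free_monoid" where
  "zero_free_monoid = Word []"

definition plus_free_monoid :: "'a free_monoid \<Rightarrow> 'a free_monoid \<Rightarrow> 'a free_monoid" where
  "plus_free_monoid v w = Word (letters v @ letters w)"

instance
  by standard (simp_all add: zero_free_monoid_def plus_free_monoid_def)

end

text \<open>The free associative unital algebra on \<open>X\<close> is the monoid algebra of the words over \<open>X\<close>;
  multiplication of the library type \<open>poly_mapping\<close> is convolution.\<close>

type_synonym 'a assoc = "'a free_monoid \<Rightarrow>\<^sub>0 complex"

definition free_assoc :: "'a set \<Rightarrow> 'a assoc ring" where
  "free_assoc X = \<lparr>carrier = {f. \<forall>w\<in>Poly_Mapping.keys f. set (letters w) \<subseteq> X},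
     mult = (*), one = 1, zero = 0, add = (+)\<rparr>"

definition letter :: "'a \<Rightarrow> 'a assoc" where
  "letter a = Poly_Mapping.single (Word [a]) 1"

definition scalar :: "complex \<Rightarrow> 'a assoc" where
  "scalar c = Poly_Mapping.single 0 c"

text \<open>The first two families make \<open>letter\<close> linear, so that the quotient by them is the tensor
  algebra of \<open>L\<close>.\<close>

definition env_relators :: "'a graded_lie \<Rightarrow> 'a assoc set" where
  "env_relators L =
     {letter (lie_add L a b) - letter a - letter b | a b. a \<in> carrier L \<and> b \<in> carrier L} \<union>
     {letter (lie_scale L c a) - scalar c * letter a | c a. a \<in> carrier L} \<union>
     {letter a * letter b - letter b * letter a - letter (lie_bracket L a b) | a b.
        a \<in> carrier L \<and> b \<in> carrier L}"

definition env_ideal :: "'a graded_lie \<Rightarrow> 'a assoc set" where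
  "env_ideal L = Idl\<^bsub>free_assoc (carrier L)\<^esub> (env_relators L)"

definition U :: "'a graded_lie \<Rightarrow> 'a assoc set ring" where
  "U L = free_assoc (carrier L) Quot env_ideal L"

definition U_class :: "'a graded_lie \<Rightarrow> 'a assoc \<Rightarrow> 'a assoc set" where
  "U_class L f = env_ideal L +>\<^bsub>free_assoc (carrier L)\<^esub> f"

definition U_scale :: "'a graded_lie \<Rightarrow> complex \<Rightarrow> 'a assoc set \<Rightarrow> 'a assoc set" where
  "U_scale L c u = U_class L (scalar c) \<otimes>\<^bsub>U L\<^esub> u"

definition U_grade :: "'a graded_lie \<Rightarrow> nat \<Rightarrow> 'a assoc set set" where
  "U_grade L d = U_class L `
     {f \<in> carrier (free_assoc (carrier L)). \<forall>w\<in>Poly_Mapping.keys f.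
        \<exists>ds. list_all2 (\<lambda>a e. a \<in> lie_grade L e) (letters w) ds \<and> sum_list ds = d}"

text \<open>The degree completion is the product of the graded pieces; \<open>u d\<close> is the component of
  degree \<open>d\<close> of \<open>u\<close>.\<close>

definition Uhat :: "'a graded_lie \<Rightarrow> (nat \<Rightarrow> 'a assoc set) ring" where
  "Uhat L = \<lparr>carrier = {u. \<forall>d. u d \<in> U_grade L d},
     mult = (\<lambda>u v d. \<Oplus>\<^bsub>U L\<^esub>k\<in>{..d}. u k \<otimes>\<^bsub>U L\<^esub> v (d - k)),
     one = (\<lambda>d. if d = 0 then \<one>\<^bsub>U L\<^esub> else \<zero>\<^bsub>U L\<^esub>),
     zero = (\<lambda>d. \<zero>\<^bsub>U L\<^esub>),
     add = (\<lambda>u v d. u d \<oplus>\<^bsub>U L\<^esub> v d)\<rparr>"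

definition Uhat_scale ::
  "'a graded_lie \<Rightarrow> complex \<Rightarrow> (nat \<Rightarrow> 'a assoc set) \<Rightarrow> nat \<Rightarrow> 'a assoc set" where
  "Uhat_scale L c u = (\<lambda>d. U_scale L c (u d))"

text \<open>Linear forms on the piece of degree \<open>d\<close>. When these pieces are finite-dimensional,
  convergence and differentiability can be tested on all linear forms; this is how derivatives of
  functions with values in \<^const>\<open>Uhat\<close> are expressed below.\<close>

definition U_dual :: "'a graded_lie \<Rightarrow> nat \<Rightarrow> ('a assoc set \<Rightarrow> complex) set" where
  "U_dual L d = {\<phi>. (\<forall>u\<in>U_grade L d. \<forall>v\<in>U_grade L d. \<phi> (u \<oplus>\<^bsub>U L\<^esub> v) = \<phi> u + \<phi> v) \<and>
                    (\<forall>c. \<forall>u\<in>U_grade L d. \<phi> (U_scale L c u) = c * \<phi> u)}"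


section \<open>The Lie algebra attached to a finite group\<close>

datatype 'n gen = XX 'n 'n "(complex^2^2) set" | XP 'n P1

definition pn_gens :: "(complex^2^2) set set \<Rightarrow> 'n gen set" where
  "pn_gens G = {XX i j g | i j g. i \<noteq> j \<and> g \<in> G} \<union> {XP i q | i q. q \<notin> P1_star G}"

abbreviation X2 :: "'n \<Rightarrow> 'n \<Rightarrow> (complex^2^2) set \<Rightarrow> 'n gen na" where
  "X2 i j g \<equiv> na_gen (XX i j g)"

abbreviation X1 :: "'n \<Rightarrow> P1 \<Rightarrow> 'n gen na" where
  "X1 i p \<equiv> na_gen (XP i p)"

inductive_set pn_relators :: "(complex^2^2) set set \<Rightarrow> 'n::finite gen na set"
  for G :: "(complex^2^2) set set"
where
  symmetry: "\<lbrakk>i \<noteq> j; g \<in> G\<rbrakk> \<Longrightarrow> X2 i j g - X2 j i (inv\<^bsub>PSU2\<^esub> g) \<in> pn_relators G"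
| sphere: "(\<Sum>q\<in>- P1_star G. X1 i q) + (\<Sum>m\<in>- {i}. \<Sum>g\<in>G. X2 i m g) \<in> pn_relators G"
| four_indices: "\<lbrakk>distinct [i, j, k, l]; g \<in> G; g' \<in> G\<rbrakk>
    \<Longrightarrow> X2 i j g \<star> X2 k l g' \<in> pn_relators G"
| three_indices: "\<lbrakk>distinct [i, j, k]; g \<in> G; g' \<in> G\<rbrakk>
    \<Longrightarrow> X2 i j g \<star> (X2 k j (g' \<otimes>\<^bsub>PSU2\<^esub> g) + X2 k i g') \<in> pn_relators G"
| three_indices_point: "\<lbrakk>distinct [i, j, k]; p \<notin> P1_star G; g' \<in> G\<rbrakk>
    \<Longrightarrow> X1 i p \<star> X2 j k g' \<in> pn_relators G"
| two_points: "\<lbrakk>i \<noteq> j; p \<notin> P1_star G; q \<notin> P1_star G; q \<notin> orb G p\<rbrakk>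
    \<Longrightarrow> X1 i p \<star> X1 j q \<in> pn_relators G"
| two_indices: "\<lbrakk>i \<noteq> j; g \<in> G; p \<notin> P1_star G\<rbrakk>
    \<Longrightarrow> X2 i j g \<star> (X1 j p + X1 i (act g p) + (\<Sum>h\<in>stab G p. X2 i j (g \<otimes>\<^bsub>PSU2\<^esub> h)))
        \<in> pn_relators G"
| two_indices_point: "\<lbrakk>i \<noteq> j; g \<in> G; p \<notin> P1_star G\<rbrakk>
    \<Longrightarrow> X1 j p \<star> (X1 i (act g p) + (\<Sum>h\<in>stab G p. X2 i j (g \<otimes>\<^bsub>PSU2\<^esub> h)))
        \<in> pn_relators G"

definition pn :: "(complex^2^2) set set \<Rightarrow> 'n::finite gen na set graded_lie" where
  "pn G = presented_lie (pn_gens G) (pn_relators G)"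

type_synonym 'n Upn_hat = "nat \<Rightarrow> 'n gen na set assoc set"

definition X_hat :: "(complex^2^2) set set \<Rightarrow> 'n::finite gen \<Rightarrow> 'n Upn_hat" where
  "X_hat G x = (\<lambda>d. if d = 1
     then U_class (pn G) (letter (na_coset (lie_ideal (pn_gens G) (pn_relators G)) (na_gen x)))
     else \<zero>\<^bsub>U (pn G)\<^esub>)"


section \<open>The connection\<close>

definition vchart :: "('n \<Rightarrow> bool) \<Rightarrow> complex^'n \<Rightarrow> P1^'n" where
  "vchart \<sigma> t = (\<chi> i. chart (\<sigma> i) (t $ i))"

text \<open>A 1-form on \<open>Cf G\<close> is given in each chart \<open>vchart \<sigma>\<close> by its coefficients \<open>\<omega> \<sigma> t i\<close>
  of \<open>dt\<^sub>i\<close>. The last clause is the change of chart rule: where the charts differ in the \<open>i\<close>-th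
  coordinate, the two coordinates are inverse to each other.\<close>

definition holomorphic_form ::
  "(complex^2^2) set set \<Rightarrow> (('n::finite \<Rightarrow> bool) \<Rightarrow> complex^'n \<Rightarrow> 'n \<Rightarrow> 'n Upn_hat) \<Rightarrow> bool" where
  "holomorphic_form G \<omega> \<longleftrightarrow>
     (\<forall>\<sigma> t i. vchart \<sigma> t \<in> Cf G \<longrightarrow> \<omega> \<sigma> t i \<in> carrier (Uhat (pn G))) \<and>
     (\<forall>\<sigma> t i d. \<forall>\<phi>\<in>U_dual (pn G) d. vchart \<sigma> t \<in> Cf G \<longrightarrow>
        (\<exists>c::complex^'n. ((\<lambda>u. \<phi> (\<omega> \<sigma> u i d)) has_derivative (\<lambda>v. \<Sum>k\<in>UNIV. c $ k * v $ k)) (at t))) \<and>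
     (\<forall>\<sigma> \<tau> s t i. vchart \<sigma> s \<in> Cf G \<and> vchart \<sigma> s = vchart \<tau> t \<longrightarrow>
        \<omega> \<sigma> s i = Uhat_scale (pn G) (if \<sigma> i = \<tau> i then 1 else - 1 / (s $ i)\<^sup>2) (\<omega> \<tau> t i))"

definition simple_pole :: "complex \<Rightarrow> P1 \<Rightarrow> complex" where
  "simple_pole z x = (case x of Aff w \<Rightarrow> 1 / (z - w) | Infty \<Rightarrow> 0)"

definition is_connection_form ::
  "(complex^2^2) set set \<Rightarrow> (('n::finite \<Rightarrow> bool) \<Rightarrow> complex^'n \<Rightarrow> 'n \<Rightarrow> 'n Upn_hat) \<Rightarrow> bool" where
  "is_connection_form G \<omega> \<longleftrightarrow> holomorphic_form G \<omega> \<and>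
     (\<forall>z i. vchart (\<lambda>_. False) z \<in> Cf G \<longrightarrow>
        \<omega> (\<lambda>_. False) z i =
          (\<Oplus>\<^bsub>Uhat (pn G)\<^esub>p\<in>- P1_star G.
             Uhat_scale (pn G) (simple_pole (z $ i) p) (X_hat G (XP i p)))
          \<oplus>\<^bsub>Uhat (pn G)\<^esub>
          (\<Oplus>\<^bsub>Uhat (pn G)\<^esub>j\<in>- {i}. \<Oplus>\<^bsub>Uhat (pn G)\<^esub>g\<in>G.
             Uhat_scale (pn G) (simple_pole (z $ i) (act g (Aff (z $ j)))) (X_hat G (XX i j g))))"

text \<open>The equation \<open>dF = r\<^sup>*\<omega> \<and> F\<close> on a covering \<open>r : C \<rightarrow> Cf G\<close>, written at each point \<open>y\<close>
  in the local coordinates obtained by composing a chart with a local inverse \<open>s\<close> of \<open>r\<close>.\<close>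

definition horizontal ::
  "(complex^2^2) set set \<Rightarrow> (('n::finite \<Rightarrow> bool) \<Rightarrow> complex^'n \<Rightarrow> 'n \<Rightarrow> 'n Upn_hat) \<Rightarrow>
   'c::topological_space set \<Rightarrow> ('c \<Rightarrow> P1^'n) \<Rightarrow> ('c \<Rightarrow> 'n Upn_hat) \<Rightarrow> bool" where
  "horizontal G \<omega> C r F \<longleftrightarrow>
     (\<forall>y\<in>C. F y \<in> carrier (Uhat (pn G))) \<and>
     (\<forall>W s. openin (top_of_set C) W \<and> openin (top_of_set (Cf G)) (r ` W) \<and>
            homeomorphism W (r ` W) r s \<longrightarrow>
       (\<forall>y\<in>W. \<forall>\<sigma> t. vchart \<sigma> t = r y \<longrightarrow>
         (\<forall>d. \<forall>\<phi>\<in>U_dual (pn G) d.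
            ((\<lambda>u. \<phi> (F (s (vchart \<sigma> u)) d)) has_derivative
             (\<lambda>v. \<Sum>i\<in>UNIV. v $ i * \<phi> ((\<omega> \<sigma> t i \<otimes>\<^bsub>Uhat (pn G)\<^esub> F y) d))) (at t))))"

definition lift_endpoint ::
  "'c::topological_space set \<Rightarrow> ('c \<Rightarrow> 'b) \<Rightarrow> 'c \<Rightarrow> (real \<Rightarrow> 'b) \<Rightarrow> 'c" where
  "lift_endpoint C r y \<gamma> = (THE z. \<exists>h. path h \<and> path_image h \<subseteq> C \<and>
     pathstart h = y \<and> pathfinish h = z \<and> (\<forall>s\<in>{0..1}. r (h s) = \<gamma> s))"

definition monodromy ::
  "'c::topological_space set \<Rightarrow> ('c \<Rightarrow> 'b) \<Rightarrow> ('c \<Rightarrow> 'v) \<Rightarrow> 'c \<Rightarrow> (real \<Rightarrow> 'b) \<Rightarrow> 'v" where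
  "monodromy C r F y \<gamma> = F (lift_endpoint C r y \<gamma>)"


section \<open>Loops\<close>

text \<open>\<open>coord_away b\<close> is an affine coordinate on the complement of \<open>b\<close>; its value at \<open>b\<close> is
  irrelevant.\<close>

definition coord_away :: "P1 \<Rightarrow> P1 \<Rightarrow> complex" where
  "coord_away b x = (case x of
       Aff z \<Rightarrow> (case b of Aff w \<Rightarrow> 1 / (z - w) | Infty \<Rightarrow> z)
     | Infty \<Rightarrow> 0)"

text \<open>A simple loop based at \<open>a\<close> bounding two open discs, the first containing \<open>p\<close>, the second
  containing \<open>Q\<close>, and turning clockwise around \<open>p\<close>. The direction is measured by the winding
  number in an affine coordinate in which the second disc is the outside of the loop.\<close>

definition clockwise_loop :: "P1 \<Rightarrow> P1 \<Rightarrow> P1 set \<Rightarrow> (real \<Rightarrow> P1) \<Rightarrow> bool" where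
  "clockwise_loop a p Q \<gamma> \<longleftrightarrow>
     simple_path \<gamma> \<and> pathstart \<gamma> = a \<and> pathfinish \<gamma> = a \<and>
     (\<exists>D1 D2. open D1 \<and> open D2 \<and> D1 \<inter> D2 = {} \<and> D1 \<union> D2 = - path_image \<gamma> \<and>
        D1 homeomorphic ball (0::complex) 1 \<and> D2 homeomorphic ball (0::complex) 1 \<and>
        p \<in> D1 \<and> Q \<subseteq> D2 \<and>
        (\<forall>b\<in>D2. winding_number (coord_away b \<circ> \<gamma>) (coord_away b p) = - 1))"

definition marked_points :: "(complex^2^2) set set \<Rightarrow> P1^'n \<Rightarrow> P1 set" where
  "marked_points G q = (\<Union>l. orb G (q $ l)) \<union> - P1_star G"

definition move_point :: "P1^'n \<Rightarrow> 'n \<Rightarrow> (real \<Rightarrow> P1) \<Rightarrow> real \<Rightarrow> P1^'n" where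
  "move_point q i \<gamma> s = (\<chi> k. if k = i then \<gamma> s else q $ k)"

end

(* Pairing with linear forms on the graded pieces turns a horizontal section F into complex functions.
   In degree 0 they are locally constant, so F stays equal to 1 there along a lifted path. In degree 1
   they are primitives of the linear forms applied to omega, hence along a loop of the i-th point the
   increment is the sum of the residues, weighted by the winding numbers of the loop around the
   singular points.

   The loop lives on a sphere and is only continuous, so everything is computed in the coordinate
   w = 1/(z - b) with b in the second disc: the relation (2) says that the residues add up to zero, which
   makes the form regular at b, and the point z = infinity, where the 1-form is not given by
   a formula, becomes the single exceptional point w = 0, removable by continuity. That the loop does not
   wind around a singular point s of the second disc follows by comparing the coordinates attached
   to b and to s. *)

theory Submission
  imports Defs
begin

text \<open>Why only two degrees enter: \<open>\<omega>\<close> starts in degree 1, so the product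
  of \<open>\<omega>\<close> and \<open>F\<close> has degree-0 component zero, and its degree-1
  component is that of \<open>\<omega>\<close> as soon as \<open>F\<close> is 1 in degree 0. The
  graded pieces are bare quotients, with no topology and no dimension bound at hand; equalities in
  them are therefore tested on all algebraic linear forms, which separate points because the ideal
  can be completed by a basis argument. A merely continuous loop admits no contour integral;
  continuous logarithms along it take over, and their increments are the winding numbers times 2 pi
  i. With winding number -1 for a clockwise loop this gives the constant -2 pi i. Infinity cannot
  serve as the centre b, since it may be marked or lie on the loop; a nonempty open set of the
  sphere is infinite, so b can be taken affine and away from the finitely many poles. Distinct
  points of a configuration have disjoint orbits, so this happens for at most one j, and a limit in
  one variable settles it.\<close>

no_notation fps_nth (infixl \<open>$\<close> 75)

section \<open>Path lifting for coverings of topological spaces\<close>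

text \<open>Evenly covered neighbourhoods are pulled back along a path to neighbourhoods of a time.
  The form with \<open>eventually\<close> matches \<open>connected_local_const\<close>, on which
  both uniqueness and existence of lifts rest.\<close>

lemma covering_space_eventually_sheet:
  fixes r :: "'c::topological_space \<Rightarrow> 'b::topological_space" and g :: "real \<Rightarrow> 'b"
  assumes cov: "covering_space C r S" and g: "continuous_on {0..1} g" "g ` {0..1} \<subseteq> S"
    and t: "t \<in> {0..1}"
  obtains T v where "eventually (\<lambda>s. g s \<in> T) (at t within {0..1})" "g t \<in> T"
    "\<Union>v = C \<inter> r -` T" "\<forall>u\<in>v. openin (top_of_set C) u" "pairwise disjnt v"
    "\<forall>u\<in>v. \<exists>q. homeomorphism u T r q"
proof -
  have "g t \<in> S" using g t by auto
  then obtain T v where T: "g t \<in> T" "openin (top_of_set S) T"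
    "\<Union>v = C \<inter> r -` T" "\<forall>u\<in>v. openin (top_of_set C) u" "pairwise disjnt v"
    "\<forall>u\<in>v. \<exists>q. homeomorphism u T r q"
    using cov unfolding covering_space_def by blast
  obtain O' where O: "open O'" "T = S \<inter> O'" using T(2) openin_open by metis
  have "(g \<longlongrightarrow> g t) (at t within {0..1})"
    using g(1) t continuous_on_def by blast
  then have "eventually (\<lambda>s. g s \<in> O') (at t within {0..1})"
    using O T(1) by (auto simp: tendsto_def)
  moreover have "eventually (\<lambda>s. s \<in> {0..1}) (at t within {0..1})"
    by (simp add: eventually_at_filter)
  ultimately have "eventually (\<lambda>s. g s \<in> T) (at t within {0..1})"
    by eventually_elim (use g O in auto)
  then show ?thesis using that T by blast
qed

text \<open>At a given time the two lifts lie either in one sheet, where \<open>r\<close> is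
  injective, or in two disjoint open sheets. Hence agreement and disagreement both persist nearby;
  disjointness of the sheets does the work of a separation axiom on \<open>C\<close>.\<close>

lemma covering_space_path_lift_unique:
  fixes r :: "'c::topological_space \<Rightarrow> 'b::topological_space"
  assumes cov: "covering_space C r S"
    and h1: "path h1" "path_image h1 \<subseteq> C" and h2: "path h2" "path_image h2 \<subseteq> C"
    and eq: "\<And>s. s \<in> {0..1} \<Longrightarrow> r (h1 s) = r (h2 s)" and start: "h1 0 = h2 0"
    and t: "t \<in> {0..1}"
  shows "h1 t = h2 t"
proof -
  have inC: "h1 s \<in> C" "h2 s \<in> C" if "s \<in> {0..1}" for s
    using h1(2) h2(2) that unfolding path_image_def by blast+
  have near: "eventually (\<lambda>s. s \<in> {0..1} \<and> h s \<in> u) (at t within {0..1})"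
    if h: "path h" "path_image h \<subseteq> C" "openin (top_of_set C) u" "h t \<in> u" "t \<in> {0..1}" for h u t
  proof -
    obtain O' where O: "open O'" "u = C \<inter> O'" using h(3) unfolding openin_open by blast
    have "(h \<longlongrightarrow> h t) (at t within {0..1})"
      using h(1,5) unfolding path_def continuous_on_def by blast
    then have "eventually (\<lambda>s. h s \<in> O') (at t within {0..1})"
      using O h(4) by (auto simp: tendsto_def)
    moreover have "eventually (\<lambda>s. s \<in> {0..1}) (at t within {0..1})"
      by (simp add: eventually_at_filter)
    ultimately show ?thesis
    proof eventually_elim
      case (elim s)
      then have "h s \<in> C" using h(2) by (force simp: path_image_def)
      with elim O show ?case by simp
    qed
  qed
  \<comment> \<open>The truth value of the equation is the locally constant function on the
    connected interval.\<close>
  have "(h1 0 = h2 0) = (h1 t = h2 t)"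
  proof (rule connected_local_const[of "{0..1}" 0 t])
    show "\<forall>a\<in>{0..1}. \<forall>\<^sub>F b in at a within {0..1}. (h1 a = h2 a) = (h1 b = h2 b)"
    proof
      fix a :: real assume a: "a \<in> {0..1}"
      have "continuous_on {0..1} (r \<circ> h1)"
        using h1 covering_space_imp_continuous[OF cov] unfolding path_def path_image_def
        by (intro continuous_on_compose) (blast intro: continuous_on_subset)+
      moreover have "(r \<circ> h1) ` {0..1} \<subseteq> S"
        using inC covering_space_imp_surjective[OF cov] by auto
      ultimately obtain T v where "\<forall>\<^sub>F s in at a within {0..1}. (r \<circ> h1) s \<in> T"
        and Tv: "(r \<circ> h1) a \<in> T"
        "\<Union>v = C \<inter> r -` T" "\<forall>u\<in>v. openin (top_of_set C) u" "pairwise disjnt v"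
        "\<forall>u\<in>v. \<exists>q. homeomorphism u T r q"
        by (rule covering_space_eventually_sheet[OF cov _ _ a])
      obtain u1 where u1: "u1 \<in> v" "h1 a \<in> u1" using Tv(1,2) inC[OF a] by fastforce
      obtain u2 where u2: "u2 \<in> v" "h2 a \<in> u2" using Tv(1,2) inC[OF a] eq[OF a] by fastforce
      have ev: "\<forall>\<^sub>F s in at a within {0..1}. s \<in> {0..1} \<and> h1 s \<in> u1 \<and> h2 s \<in> u2"
        using near[OF h1 Tv(3)[THEN bspec, OF u1(1)] u1(2) a] near[OF h2 Tv(3)[THEN bspec, OF u2(1)] u2(2) a]
        by eventually_elim simp
      show "\<forall>\<^sub>F b in at a within {0..1}. (h1 a = h2 a) = (h1 b = h2 b)"
      proof (cases "u1 = u2")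
        case True
        obtain k where k: "homeomorphism u1 T r k" using Tv(5) u1 by auto
        then have inj: "x = y" if "x \<in> u1" "y \<in> u1" "r x = r y" for x y
          using that by (metis homeomorphism_apply1)
        have "h1 a = h2 a" using inj[of "h1 a" "h2 a"] u1 u2 True eq a by auto
        from ev show ?thesis
        proof eventually_elim
          case (elim s)
          then have "h1 s = h2 s" using inj[of "h1 s" "h2 s"] True eq by auto
          with \<open>h1 a = h2 a\<close> show ?case by simp
        qed
      next
        case False
        then have disj: "u1 \<inter> u2 = {}" using Tv(4) u1 u2 by (auto simp: pairwise_def disjnt_def)
        from ev show ?thesis
        proof eventually_elim
          case (elim s)
          then show ?case using disj u1(2) u2(2) by auto
        qed
      qed
    qed
  qed (use t in auto)
  then show ?thesis using start by simp
qed

text \<open>Connectedness of the interval replaces a subdivision by a Lebesgue number: having a lift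
  up to time t, called \<open>P t\<close>, is locally constant in t, forwards by
  \<open>extend\<close> and backwards by \<open>restrict\<close>, and it holds at 0.\<close>

lemma covering_space_path_lift_exists:
  fixes r :: "'c::topological_space \<Rightarrow> 'b::topological_space"
  assumes cov: "covering_space C r S" and g: "path g" "path_image g \<subseteq> S"
    and y: "y \<in> C" "r y = g 0"
  obtains h where "path h" "path_image h \<subseteq> C" "h 0 = y" "\<And>s. s \<in> {0..1} \<Longrightarrow> r (h s) = g s"
proof -
  define P where "P t \<longleftrightarrow> (\<exists>h. continuous_on {0..t} h \<and> h ` {0..t} \<subseteq> C \<and> h 0 = y \<and>
                     (\<forall>s\<in>{0..t}. r (h s) = g s))" for t :: real
  \<comment> \<open>The lift is continued by \<open>k\<close> applied to the path, where
    \<open>k\<close> inverts \<open>r\<close> on the sheet through the current endpoint; for that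
    reason the two pieces agree at s.\<close>
  have extend: "P s'" if P: "P s" and s: "0 \<le> s" "s \<le> s'"
    and sub: "g ` {s..s'} \<subseteq> T" and T: "\<Union>v = C \<inter> r -` T" "\<forall>u\<in>v. \<exists>q. homeomorphism u T r q"
    and s': "s' \<le> 1" for s s' T v
  proof -
    obtain h where h: "continuous_on {0..s} h" "h ` {0..s} \<subseteq> C" "h 0 = y"
      "\<And>x. x \<in> {0..s} \<Longrightarrow> r (h x) = g x" using P unfolding P_def by blast
    have "h s \<in> C \<inter> r -` T" using h s sub by auto
    then obtain u where u: "u \<in> v" "h s \<in> u" using T by auto
    then obtain k where k: "homeomorphism u T r k" using T by auto
    have uC: "u \<subseteq> C" using T u by auto
    have khs: "k (g s) = h s" using k u h(4)[of s] s by (metis atLeastAtMost_iff homeomorphism_apply1 order_refl)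
    define h' where "h' x = (if x \<le> s then h x else k (g x))" for x
    have "continuous_on ({0..s} \<union> {s..s'}) h'" unfolding h'_def
    proof (rule continuous_on_cases)
      have "continuous_on {s..s'} g" using g s s' by (auto simp: path_def elim: continuous_on_subset)
      then show "continuous_on {s..s'} (\<lambda>x. k (g x))"
        by (rule continuous_on_compose2[OF homeomorphism_cont2[OF k] _ sub])
    qed (use h khs s in auto)
    moreover have "{0..s} \<union> {s..s'} = {0..s'}" using s by auto
    moreover have "h' ` {0..s'} \<subseteq> C"
    proof
      fix z assume "z \<in> h' ` {0..s'}"
      then obtain x where x: "x \<in> {0..s'}" "z = h' x" by auto
      show "z \<in> C"
      proof (cases "x \<le> s")
        case False
        then have "g x \<in> T" using sub x by auto
        then have "k (g x) \<in> u" using homeomorphism_image2[OF k] by blast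
        then show ?thesis using False uC x by (auto simp: h'_def)
      qed (use x h(2) in \<open>auto simp: h'_def\<close>)
    qed
    moreover have "r (h' x) = g x" if "x \<in> {0..s'}" for x
    proof (cases "x \<le> s")
      case False
      then have "g x \<in> T" using sub that by auto
      then show ?thesis using False homeomorphism_apply2[OF k] by (simp add: h'_def)
    qed (use that h(4) in \<open>auto simp: h'_def\<close>)
    ultimately show ?thesis unfolding P_def
      by (intro exI[of _ h']) (use h s in \<open>auto simp: h'_def\<close>)
  qed
  have restrict: "P s" if P: "P s'" and s: "s \<le> s'" for s s'
  proof -
    have sub: "{0..s} \<subseteq> {0..s'}" using s by auto
    obtain h where h: "continuous_on {0..s'} h" "h ` {0..s'} \<subseteq> C" "h 0 = y"
      "\<forall>x\<in>{0..s'}. r (h x) = g x" using P unfolding P_def by blast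
    show ?thesis unfolding P_def
      using sub h continuous_on_subset[OF h(1) sub] by (intro exI[of _ h]) auto
  qed
  have "P 0 = P 1"
  proof (rule connected_local_const[of "{0..1}" 0 1])
    show "\<forall>a\<in>{0..1}. \<forall>\<^sub>F b in at a within {0..1}. P a = P b"
    proof
      fix a :: real assume a: "a \<in> {0..1}"
      obtain T v where Tv: "\<forall>\<^sub>F s in at a within {0..1}. g s \<in> T" "g a \<in> T"
        "\<Union>v = C \<inter> r -` T" "\<forall>u\<in>v. openin (top_of_set C) u" "pairwise disjnt v"
        "\<forall>u\<in>v. \<exists>q. homeomorphism u T r q"
        using g unfolding path_def path_image_def
        by (rule covering_space_eventually_sheet[OF cov _ _ a])
      then obtain d where d0: "d > 0" and "\<forall>s\<in>{0..1}. s \<noteq> a \<and> dist s a < d \<longrightarrow> g s \<in> T"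
        unfolding eventually_at by blast
      then have d: "g s \<in> T" if "s \<in> {0..1}" "dist s a < d" for s
        using that Tv(2) by (cases "s = a"; blast)
      have "P a = P b" if b: "b \<in> {0..1}" "dist b a < d" for b
      proof -
        have near: "s \<in> {0..1} \<and> dist s a < d" if "s \<in> {min a b..max a b}" for s
          using that b a by (auto simp: dist_real_def min_def max_def split: if_splits)
        have "g ` {min a b..max a b} \<subseteq> T"
          using near d by force
        then have "P (min a b) \<Longrightarrow> P (max a b)"
          using a b by (intro extend[of "min a b" "max a b" T v] Tv) auto
        moreover have "P (max a b) \<Longrightarrow> P (min a b)"
          by (rule restrict) auto
        ultimately show ?thesis by (cases "a \<le> b") (auto simp: min_def max_def)
      qed
      then show "\<forall>\<^sub>F b in at a within {0..1}. P a = P b"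
        unfolding eventually_at using d0 by blast
    qed
  qed auto
  moreover have "P 0" unfolding P_def using y by (intro exI[of _ "\<lambda>_. y"]) auto
  ultimately have "P 1" by simp
  then obtain h where h: "continuous_on {0..1} h" "h ` {0..1} \<subseteq> C" "h 0 = y"
      "\<forall>x\<in>{0..1}. r (h x) = g x" unfolding P_def by blast
  then show ?thesis using that[of h] by (simp add: path_def path_image_def)
qed

text \<open>Uniqueness of lifts gives the definite description its value, so any lift may be used to
  compute it.\<close>

lemma lift_endpoint_eqI:
  fixes r :: "'c::topological_space \<Rightarrow> 'b::topological_space"
  assumes "covering_space C r S" "path h" "path_image h \<subseteq> C" "h 0 = y"
    "\<And>s. s \<in> {0..1} \<Longrightarrow> r (h s) = \<gamma> s"
  shows "lift_endpoint C r y \<gamma> = h 1"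
  unfolding lift_endpoint_def
proof (rule the_equality)
  show "\<exists>h'. path h' \<and> path_image h' \<subseteq> C \<and> pathstart h' = y \<and> pathfinish h' = h 1 \<and>
     (\<forall>s\<in>{0..1}. r (h' s) = \<gamma> s)"
    using assms by (auto simp: pathstart_def pathfinish_def)
  fix z assume "\<exists>h. path h \<and> path_image h \<subseteq> C \<and> pathstart h = y \<and> pathfinish h = z \<and>
     (\<forall>s\<in>{0..1}. r (h s) = \<gamma> s)"
  then obtain h' where "path h'" "path_image h' \<subseteq> C" "h' 0 = y" "h' 1 = z"
     "\<And>s. s \<in> {0..1} \<Longrightarrow> r (h' s) = \<gamma> s" by (auto simp: pathstart_def pathfinish_def)
  then show "z = h 1"
    using covering_space_path_lift_unique[OF assms(1), of h' h 1] assms by auto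
qed

lemma covering_space_sheet:
  fixes r :: "'c::topological_space \<Rightarrow> 'b::topological_space"
  assumes "covering_space C r S" "y \<in> C"
  obtains W s where "y \<in> W" "openin (top_of_set C) W" "openin (top_of_set S) (r ` W)"
    "homeomorphism W (r ` W) r s"
proof -
  obtain W T s where W: "y \<in> W" "openin (top_of_set C) W" "r y \<in> T" "openin (top_of_set S) T"
    "homeomorphism W T r s"
    by (rule covering_space_local_homeomorphism[OF assms])
  then show ?thesis using that homeomorphism_image1[OF W(5)] by simp
qed


section \<open>The action on the projective line\<close>

abbreviation adjoint_mat :: "complex^2^2 \<Rightarrow> complex^2^2" where
  "adjoint_mat A \<equiv> (\<chi> i j. cnj (A $ j $ i))"

lemma adjoint_mat_mult: "adjoint_mat (A ** B) = adjoint_mat B ** adjoint_mat A"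
  by (simp add: vec_eq_iff matrix_matrix_mult_def mult.commute)

lemma adjoint_mat_one: "adjoint_mat (mat 1) = mat 1"
  by (auto simp: vec_eq_iff mat_def)

lemma det_adjoint_mat: "det (adjoint_mat A) = cnj (det A)"
  by (simp add: det_2 mult.commute)

lemma group_SU2: "group SU2"
proof (rule groupI)
  fix A assume A: "A \<in> carrier SU2"
  then have "adjoint_mat A ** A = mat 1" "A ** adjoint_mat A = mat 1"
    using matrix_left_right_inverse by (auto simp: SU2_def)
  moreover have "adjoint_mat (adjoint_mat A) = A" by (simp add: vec_eq_iff)
  moreover have "det (adjoint_mat A) = 1" 
    using A det_adjoint_mat[of A] by (simp add: SU2_def)
  ultimately show "\<exists>B\<in>carrier SU2. B \<otimes>\<^bsub>SU2\<^esub> A = \<one>\<^bsub>SU2\<^esub>"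
    by (intro bexI[of _ "adjoint_mat A"]) (auto simp: SU2_def)
next
  fix A B assume "A \<in> carrier SU2" "B \<in> carrier SU2"
  then have A: "A ** adjoint_mat A = mat 1" and B: "B ** adjoint_mat B = mat 1" 
    and d: "det A = 1" "det B = 1" by (auto simp: SU2_def)
  have "(A ** B) ** adjoint_mat (A ** B) = A ** (B ** adjoint_mat B) ** adjoint_mat A"
    by (simp add: adjoint_mat_mult matrix_mul_assoc)
  also have "\<dots> = mat 1" using A B by simp
  finally show "A \<otimes>\<^bsub>SU2\<^esub> B \<in> carrier SU2"
    using d by (simp add: SU2_def det_mul)
qed (auto simp: SU2_def matrix_mul_assoc adjoint_mat_one)

lemma uminus_matrix_mult: "(- A) ** B = - (A ** B)" "A ** (- B) = - (A ** B)"
  for A B :: "complex^2^2"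
  by (simp_all add: vec_eq_iff matrix_matrix_mult_def sum_negf)

lemma uminus_SU2: "A \<in> carrier SU2 \<Longrightarrow> - A \<in> carrier SU2"
proof -
  assume A: "A \<in> carrier SU2"
  have "adjoint_mat (- A) = - adjoint_mat A" by (simp add: vec_eq_iff)
  then show ?thesis using A by (simp add: SU2_def uminus_matrix_mult det_2)
qed

lemma normal_SU2: "{mat 1, - mat 1} \<lhd> SU2"
proof -
  interpret group SU2 by (rule group_SU2)
  have one: "mat 1 \<in> carrier SU2" "\<one>\<^bsub>SU2\<^esub> = mat 1" using one_closed by (auto simp: SU2_def)
  have mult: "A \<otimes>\<^bsub>SU2\<^esub> B = A ** B" for A B by (simp add: SU2_def)
  have "inv\<^bsub>SU2\<^esub> (- mat 1) = - mat 1" 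
    using uminus_SU2[OF one(1)] one
    by (intro inv_equality) (auto simp: mult uminus_matrix_mult)
  moreover have "inv\<^bsub>SU2\<^esub> (mat 1) = mat 1" using one inv_one by simp
  ultimately have "subgroup {mat 1, - mat 1} SU2"
    using uminus_SU2[OF one(1)] one
    by (intro subgroupI) (auto simp: mult uminus_matrix_mult)
  then show ?thesis
    by (rule normalI) (auto simp: r_coset_def l_coset_def mult uminus_matrix_mult)
qed

lemma group_PSU2: "group PSU2"
  unfolding PSU2_def using normal_SU2 by (rule normal.factorgroup_is_group)

lemma PSU2_carrierE:
  assumes "g \<in> carrier PSU2"
  obtains A where "A \<in> carrier SU2" "g = {A, - A}"
  using assms by (auto simp: PSU2_def FactGroup_def RCOSETS_def r_coset_def)
    (auto simp: SU2_def uminus_matrix_mult)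

lemma PSU2_one: "\<one>\<^bsub>PSU2\<^esub> = {mat 1, - mat 1}"
  by (simp add: PSU2_def FactGroup_def)

lemma PSU2_mult: 
  assumes "A \<in> g" "B \<in> h"
  shows "A ** B \<in> g \<otimes>\<^bsub>PSU2\<^esub> h"
  using assms by (auto simp: PSU2_def FactGroup_def set_mult_def SU2_def)

text \<open>The point with homogeneous coordinates [u : v]. In them a homography is the linear
  action of its matrix, without a case split at infinity. The pair (0, 0) gets a meaningless value
  and has to be excluded each time.\<close>

definition point :: "complex \<Rightarrow> complex \<Rightarrow> P1" where
  "point u v = (if v = 0 then Infty else Aff (u / v))"

lemma homography_point:
  assumes "u \<noteq> 0 \<or> v \<noteq> 0"
  shows "homography A (point u v) = point (A$1$1 * u + A$1$2 * v) (A$2$1 * u + A$2$2 * v)"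
proof (cases "v = 0")
  case True
  then show ?thesis using assms by (auto simp: homography_def point_def)
next
  case False
  have "A$2$1 * (u / v) + A$2$2 = (A$2$1 * u + A$2$2 * v) / v"
    and "A$1$1 * (u / v) + A$1$2 = (A$1$1 * u + A$1$2 * v) / v"
    using False by (auto simp: field_simps)
  then show ?thesis using False by (simp add: homography_def point_def)
qed

lemma point_cases: obtains u v where "x = point u v" "u \<noteq> 0 \<or> v \<noteq> 0"
proof (cases x)
  case (Aff z)
  then show ?thesis using that[of z 1] by (simp add: point_def)
next
  case Infty
  then show ?thesis using that[of 1 0] by (simp add: point_def)
qed

lemma homography_mult:
  assumes "det B \<noteq> 0"
  shows "homography (A ** B) x = homography A (homography B x)"
proof -
  obtain u v where x: "x = point u v" and uv: "u \<noteq> 0 \<or> v \<noteq> 0" by (rule point_cases)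
  have "\<not> (B$1$1 * u + B$1$2 * v = 0 \<and> B$2$1 * u + B$2$2 * v = 0)"
  proof
    assume *: "B$1$1 * u + B$1$2 * v = 0 \<and> B$2$1 * u + B$2$2 * v = 0"
    \<comment> \<open>Cramer's rule: a matrix with nonzero determinant never produces the
      meaningless pair (0, 0).\<close>
    have "det B * u = B$2$2 * (B$1$1 * u + B$1$2 * v) - B$1$2 * (B$2$1 * u + B$2$2 * v)"
      by (simp add: det_2 algebra_simps)
    moreover have "det B * v = B$1$1 * (B$2$1 * u + B$2$2 * v) - B$2$1 * (B$1$1 * u + B$1$2 * v)"
      by (simp add: det_2 algebra_simps)
    ultimately show False using * assms uv by simp
  qed
  then show ?thesis using uv
    by (simp add: x homography_point matrix_matrix_mult_def sum_2 algebra_simps)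
qed

lemma homography_uminus: "homography (- A) = homography A"
proof
  fix x
  obtain u v where x: "x = point u v" and uv: "u \<noteq> 0 \<or> v \<noteq> 0" by (rule point_cases)
  have "point (- a * u - b * v) (- c * u - d * v) = point (a * u + b * v) (c * u + d * v)" for a b c d
  proof -
    have "- a * u - b * v = - (a * u + b * v)" "- c * u - d * v = - (c * u + d * v)" by auto
    moreover have "point (- x) (- y) = point x y" for x y by (simp add: point_def)
    ultimately show ?thesis by metis
  qed
  from this[of "A$1$1" "A$1$2" "A$2$1" "A$2$2"] show "homography (- A) x = homography A x"
    using uv by (simp add: x homography_point)
qed

lemma act_eq_homography:
  assumes "g \<in> carrier PSU2" "A \<in> g"
  shows "act g = homography A"
proof -
  have "(SOME A. A \<in> g) \<in> g" using assms(2) by (rule someI)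
  then show ?thesis using assms unfolding act_def
    by (elim PSU2_carrierE) (auto simp: homography_uminus)
qed

lemma det_PSU2: "g \<in> carrier PSU2 \<Longrightarrow> A \<in> g \<Longrightarrow> det A = 1"
  using uminus_SU2 by (elim PSU2_carrierE) (auto simp: SU2_def)

lemma act_mult:
  assumes "g \<in> carrier PSU2" "h \<in> carrier PSU2"
  shows "act (g \<otimes>\<^bsub>PSU2\<^esub> h) x = act g (act h x)"
proof -
  interpret group PSU2 by (rule group_PSU2)
  obtain A B where AB: "A \<in> g" "B \<in> h" using assms by (metis PSU2_carrierE insertI1)
  have "act (g \<otimes>\<^bsub>PSU2\<^esub> h) x = homography (A ** B) x"
    using act_eq_homography[OF m_closed[OF assms] PSU2_mult[OF AB]] by simp
  then show ?thesis
    using det_PSU2[OF assms(2) AB(2)] act_eq_homography[OF assms(1) AB(1)]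
      act_eq_homography[OF assms(2) AB(2)] by (simp add: homography_mult)
qed

lemma act_one: "act \<one>\<^bsub>PSU2\<^esub> x = x"
proof -
  interpret group PSU2 by (rule group_PSU2)
  have "act \<one>\<^bsub>PSU2\<^esub> x = homography (mat 1) x"
    by (subst act_eq_homography[of _ "mat 1"]) (simp_all add: one_closed, simp add: PSU2_one)
  then show ?thesis by (cases x) (simp_all add: homography_def mat_def)
qed

lemma act_inv:
  assumes "g \<in> carrier PSU2"
  shows "act (inv\<^bsub>PSU2\<^esub> g) (act g x) = x" "act g (act (inv\<^bsub>PSU2\<^esub> g) x) = x"
proof -
  interpret group PSU2 by (rule group_PSU2)
  show "act (inv\<^bsub>PSU2\<^esub> g) (act g x) = x" "act g (act (inv\<^bsub>PSU2\<^esub> g) x) = x"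
    using assms by (simp_all flip: act_mult add: act_one)
qed

lemma finite_fixed_points:
  assumes g: "g \<in> carrier PSU2" "g \<noteq> \<one>\<^bsub>PSU2\<^esub>"
  shows "finite {x. act g x = x}"
proof -
  obtain A where A: "A \<in> carrier SU2" "g = {A, - A}" using g(1) by (rule PSU2_carrierE)
  \<comment> \<open>An affine fixed point z satisfies A11 z + A12 = z (A21 z + A22). If this
    polynomial in z is zero, then A is scalar of determinant 1, hence plus or minus the identity,
    and \<open>g\<close> is trivial.\<close>
  define P where "P = [:- A$1$2, A$2$2 - A$1$1, A$2$1:]"
  have "P \<noteq> 0"
  proof
    assume "P = 0"
    then have *: "A$1$2 = 0" "A$2$2 = A$1$1" "A$2$1 = 0" by (auto simp: P_def)
    have "det A = 1" using A by (simp add: SU2_def)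
    then have "A$1$1 * A$1$1 = 1" using * by (simp add: det_2)
    then have "A$1$1 = 1 \<or> A$1$1 = -1" by (simp add: square_eq_1_iff)
    then have "A = mat 1 \<or> A = - mat 1"
      using * by (auto simp: vec_eq_iff forall_2 mat_def)
    then show False using A g by (auto simp: PSU2_one)
  qed
  have "{x. act g x = x} \<subseteq> insert Infty (Aff ` {z. poly P z = 0})"
  proof
    fix x assume "x \<in> {x. act g x = x}"
    then have fixed: "homography A x = x" using act_eq_homography[OF g(1), of A] A by simp
    show "x \<in> insert Infty (Aff ` {z. poly P z = 0})"
    proof (cases x)
      case (Aff z)
      then have "poly P z = 0"
        using fixed by (auto simp: homography_def P_def field_simps split: if_splits)
      then show ?thesis using Aff by auto
    qed simp
  qed
  then show ?thesis
    by (rule finite_subset) (use poly_roots_finite[OF \<open>P \<noteq> 0\<close>] in auto)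
qed

text \<open>A nontrivial stabilizer contains a nontrivial element, which has finitely many fixed
  points. Finiteness gives the sums over exceptional points their meaning, in the relators as in the
  connection: over an infinite index set they would be zero by convention.\<close>

lemma finite_not_P1_star:
  assumes G: "subgroup G PSU2" "finite G"
  shows "finite (- P1_star G)"
proof (rule finite_subset)
  show "- P1_star G \<subseteq> (\<Union>g\<in>G - {\<one>\<^bsub>PSU2\<^esub>}. {x. act g x = x})"
    using subgroup.one_closed[OF G(1)] by (auto simp: P1_star_def stabilizer_def act_one)
  show "finite (\<Union>g\<in>G - {\<one>\<^bsub>PSU2\<^esub>}. {x. act g x = x})"
    using G finite_fixed_points subgroup.subset[OF G(1)] by auto
qed

text \<open>Stabilizers along an orbit are conjugate: if h fixes x, then g h g^-1 fixes the image of
  x under g.\<close>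

lemma act_P1_star_iff:
  assumes G: "subgroup G PSU2" and g: "g \<in> G"
  shows "act g x \<in> P1_star G \<longleftrightarrow> x \<in> P1_star G"
proof -
  interpret group PSU2 by (rule group_PSU2)
  have carr: "h \<in> carrier PSU2" if "h \<in> G" for h using G that subgroup.subset by blast
  have imp: "x \<in> P1_star G" if star: "act g x \<in> P1_star G" and g: "g \<in> G" for g x
  proof -
    have triv: "h = \<one>\<^bsub>PSU2\<^esub>" if h: "h \<in> G" "act h x = x" for h
    proof -
      let ?k = "g \<otimes>\<^bsub>PSU2\<^esub> h \<otimes>\<^bsub>PSU2\<^esub> inv\<^bsub>PSU2\<^esub> g"
      have "?k \<in> G" using G g h by (simp add: subgroup.m_closed subgroup.m_inv_closed)
      moreover have "act ?k (act g x) = act g x"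
        using g h carr by (simp add: act_mult act_inv)
      ultimately have "?k \<in> stab G (act g x)" by (simp add: stabilizer_def)
      then have "?k = \<one>\<^bsub>PSU2\<^esub>" using star by (simp add: P1_star_def)
      moreover have "?k \<otimes>\<^bsub>PSU2\<^esub> g = g \<otimes>\<^bsub>PSU2\<^esub> h"
        using carr[OF g] carr[OF h(1)] by (simp add: m_assoc)
      ultimately have "g \<otimes>\<^bsub>PSU2\<^esub> h = g \<otimes>\<^bsub>PSU2\<^esub> \<one>\<^bsub>PSU2\<^esub>" using carr[OF g] by simp
      then show ?thesis using carr[OF g] carr[OF h(1)] Units_l_cancel[of g h "\<one>\<^bsub>PSU2\<^esub>"] Units_eq by simp
    qed
    have "stab G x = {\<one>\<^bsub>PSU2\<^esub>}"
      unfolding stabilizer_def using subgroup.one_closed[OF G] act_one[of x] by (auto dest: triv)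
    then show ?thesis by (simp add: P1_star_def)
  qed
  show ?thesis
  proof
    assume "x \<in> P1_star G"
    then have "act (inv\<^bsub>PSU2\<^esub> g) (act g x) \<in> P1_star G" using g carr by (simp add: act_inv)
    then show "act g x \<in> P1_star G"
      by (rule imp) (use G g in \<open>simp add: subgroup.m_inv_closed\<close>)
  qed (use imp g in blast)
qed

text \<open>In homogeneous coordinates the pole term at [u : v] is v / (z v - u), which stays
  continuous at v = 0; the moving point is [1 : \<epsilon>]. This is what lets another point of the
  configuration tend to infinity.\<close>

lemma simple_pole_act_tendsto:
  assumes g: "g \<in> carrier PSU2" and z: "act g Infty \<noteq> Aff z"
  shows "((\<lambda>\<epsilon>. simple_pole z (act g (Aff (1 / \<epsilon>)))) \<longlongrightarrow> simple_pole z (act g Infty)) (at 0)"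
proof -
  obtain A where A: "A \<in> carrier SU2" "g = {A, - A}" using g by (rule PSU2_carrierE)
  have act: "act g = homography A" using act_eq_homography[OF g] A by simp
  have det: "A$1$1 * A$2$2 - A$1$2 * A$2$1 = 1" using A by (simp add: SU2_def det_2)
  define f where "f \<epsilon> = (A$2$1 + A$2$2 * \<epsilon>) / (z * (A$2$1 + A$2$2 * \<epsilon>) - (A$1$1 + A$1$2 * \<epsilon>))" for \<epsilon>
  have pole: "simple_pole z (point u v) = v / (z * v - u)" for u v
    by (auto simp: simple_pole_def point_def divide_simps)
  have "simple_pole z (act g (Aff (1 / \<epsilon>))) = f \<epsilon>" if "\<epsilon> \<noteq> 0" for \<epsilon>
  proof -
    have "Aff (1 / \<epsilon>) = point 1 \<epsilon>" using that by (simp add: point_def)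
    then show ?thesis by (simp add: act homography_point pole f_def)
  qed
  then have "((\<lambda>\<epsilon>. simple_pole z (act g (Aff (1 / \<epsilon>)))) \<longlongrightarrow> f 0) (at 0) \<longleftrightarrow> (f \<longlongrightarrow> f 0) (at 0)"
    by (intro filterlim_cong) (auto simp: eventually_at_filter)
  \<comment> \<open>If this vanished with A21 = 0, then A11 = 0 as well, against determinant 1;
    otherwise the image of infinity would be z.\<close>
  moreover have "z * A$2$1 - A$1$1 \<noteq> 0"
    using z det unfolding act by (auto simp: homography_def field_simps split: if_splits)
  then have "(f \<longlongrightarrow> f 0) (at 0)"
    unfolding f_def by (intro tendsto_intros) auto
  moreover have "simple_pole z (act g Infty) = f 0"
    using homography_point[of 1 0 A] by (simp add: act pole f_def) (simp add: point_def pole[unfolded point_def])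
  ultimately show ?thesis by simp
qed


section \<open>Winding numbers and coordinates on the projective line\<close>

text \<open>A residue theorem for continuous paths. Here \<open>e\<close> need not be a function of
  the point \<open>c t\<close>: it stands for a quantity carried along a lift to the covering, which
  only locally factors through a primitive \<open>P\<close>. Subtracting from \<open>e\<close> the
  continuous logarithms of c - p_s, weighted by the residues, leaves a locally constant
  function.\<close>

lemma primitive_along_path:
  fixes a p :: "'k \<Rightarrow> complex" and c e :: "real \<Rightarrow> complex"
  assumes c: "path c" and K: "finite K" and avoid: "\<And>s. s \<in> K \<Longrightarrow> p s \<notin> path_image c"
    and prim: "\<And>t0. t0 \<in> {0..1} \<Longrightarrow> \<exists>N P B. open N \<and> c t0 \<in> N \<and> finite B \<and> continuous_on N P \<and>
       (\<forall>w\<in>N - B. (P has_field_derivative (\<Sum>s\<in>K. a s / (w - p s))) (at w)) \<and>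
       e t0 = P (c t0) \<and> (\<forall>\<^sub>F t in at t0 within {0..1}. e t = P (c t))"
  shows "e 1 - e 0 = 2 * of_real pi * \<i> * (\<Sum>s\<in>K. a s * winding_number c (p s))"
proof -
  have "\<exists>l. path l \<and> pathfinish l - pathstart l = 2 * of_real pi * \<i> * winding_number c (p s) \<and>
      (\<forall>t\<in>{0..1}. c t = p s + exp (l t))" if "s \<in> K" for s
    using winding_number_as_continuous_log[OF c avoid[OF that]] by metis
  then obtain l where l: "\<And>s. s \<in> K \<Longrightarrow> path (l s)"
    "\<And>s. s \<in> K \<Longrightarrow> pathfinish (l s) - pathstart (l s) = 2 * of_real pi * \<i> * winding_number c (p s)"
    "\<And>s t. s \<in> K \<Longrightarrow> t \<in> {0..1} \<Longrightarrow> c t = p s + exp (l s t)"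
    by metis
  define E where "E t = e t - (\<Sum>s\<in>K. a s * l s t)" for t
  have "E 0 = E 1"
  proof (rule connected_local_const[of "{0..1}" 0 1 E])
    show "\<forall>t0\<in>{0..1}. \<forall>\<^sub>F t in at t0 within {0..1}. E t0 = E t"
    proof
      fix t0 :: real assume t0: "t0 \<in> {0..1}"
      obtain N P B where N: "open N" "c t0 \<in> N" "finite B" "continuous_on N P"
        "\<And>w. w \<in> N - B \<Longrightarrow> (P has_field_derivative (\<Sum>s\<in>K. a s / (w - p s))) (at w)"
        and e0: "e t0 = P (c t0)" and ev_e: "\<forall>\<^sub>F t in at t0 within {0..1}. e t = P (c t)"
        using prim[OF t0] by blast
      define w0 where "w0 = c t0"
      have "w0 \<in> path_image c" using t0 by (simp add: w0_def path_image_def)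
      then have w0s: "w0 - p s \<noteq> 0" if "s \<in> K" for s
        using avoid[OF that] by auto
      \<comment> \<open>On these balls the quotient (w - p_s) / (w0 - p_s) has distance less than 1
        from 1, so it stays in the right half-plane and the principal logarithm is holomorphic
        there.\<close>
      define V where "V = N \<inter> (\<Inter>s\<in>K. ball w0 (norm (w0 - p s)))"
      have "open V" "w0 \<in> V" using N K w0s by (auto simp: V_def w0_def)
      then obtain d where d: "d > 0" "ball w0 d \<subseteq> V" by (meson openE)
      define L where "L s w = Ln ((w - p s) / (w0 - p s))" for s w
      have nonpos: "(w - p s) / (w0 - p s) \<notin> \<real>\<^sub>\<le>\<^sub>0" if "w \<in> ball w0 d" "s \<in> K" for s w
      proof -
        have "w \<in> ball w0 (norm (w0 - p s))" using d that by (auto simp: V_def)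
        then have "norm ((w - p s) / (w0 - p s) - 1) < 1"
          using w0s[OF that(2)] by (simp add: divide_simps norm_divide dist_norm norm_minus_commute)
        then have "0 < Re ((w - p s) / (w0 - p s))"
          using abs_Re_le_cmod[of "(w - p s) / (w0 - p s) - 1"] by simp
        then show ?thesis by (auto simp: complex_nonpos_Reals_iff)
      qed
      have L': "(L s has_field_derivative 1 / (w - p s)) (at w)" if "w \<in> ball w0 d" "s \<in> K" for s w
      proof -
        have "((\<lambda>w. (w - p s) / (w0 - p s)) has_field_derivative 1 / (w0 - p s)) (at w)"
          using w0s[OF that(2)] by (auto intro!: derivative_eq_intros)
        from DERIV_chain2[OF has_field_derivative_Ln[OF nonpos[OF that]] this]
        have "((\<lambda>w. Ln ((w - p s) / (w0 - p s))) has_field_derivative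
               inverse ((w - p s) / (w0 - p s)) * (1 / (w0 - p s))) (at w)" .
        moreover have "w \<noteq> p s" using nonpos[OF that] by auto
        then have "inverse ((w - p s) / (w0 - p s)) * (1 / (w0 - p s)) = 1 / (w - p s)"
          using w0s[OF that(2)] by (simp add: field_simps)
        ultimately show ?thesis unfolding L_def by metis
      qed
      define H where "H w = P w - (\<Sum>s\<in>K. a s * L s w)" for w
      \<comment> \<open>The derivatives cancel off \<open>B\<close>; continuity suffices at the
        finitely many points of \<open>B\<close> for the function to be constant on the
        ball.\<close>
      obtain k where k: "\<And>w. w \<in> ball w0 d \<Longrightarrow> H w = k"
      proof (rule DERIV_zero_connected_constant)
        show "continuous_on (ball w0 d) H" unfolding H_def
        proof (intro continuous_intros)
          show "continuous_on (ball w0 d) P"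
            by (rule continuous_on_subset[OF N(4)]) (use d in \<open>auto simp: V_def\<close>)
          show "continuous_on (ball w0 d) (L s)" if "s \<in> K" for s
            using L' that by (intro continuous_at_imp_continuous_on ballI DERIV_isCont) blast
        qed
        show "\<forall>w\<in>ball w0 d - B. (H has_field_derivative 0) (at w)"
        proof
          fix w assume w: "w \<in> ball w0 d - B"
          then have "w \<in> N - B" using d by (auto simp: V_def)
          then have "(H has_field_derivative (\<Sum>s\<in>K. a s / (w - p s)) - (\<Sum>s\<in>K. a s * (1 / (w - p s)))) (at w)"
            unfolding H_def using w by (intro DERIV_diff DERIV_sum DERIV_cmult L' N(5)) auto
          then show "(H has_field_derivative 0) (at w)" by simp
        qed
      qed (use N in auto)
      have lim: "((\<lambda>t. l s t - l s t0) \<longlongrightarrow> 0) (at t0 within {0..1})" if "s \<in> K" for s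
        using l(1)[OF that] t0 unfolding path_def continuous_on_def by (auto intro!: tendsto_eq_intros)
      \<comment> \<open>The bound pi keeps the imaginary part of the difference inside the principal
        strip, so that \<open>Ln\<close> of its exponential gives the difference back without a
        multiple of 2 pi i.\<close>
      have "\<forall>\<^sub>F t in at t0 within {0..1}. \<forall>s\<in>K. norm (l s t - l s t0) < pi"
        using lim K by (auto intro!: eventually_ball_finite simp: tendsto_iff dist_norm)
      moreover have "(c \<longlongrightarrow> w0) (at t0 within {0..1})"
        using c t0 unfolding path_def continuous_on_def w0_def by blast
      then have "\<forall>\<^sub>F t in at t0 within {0..1}. c t \<in> ball w0 d"
        using d by (auto simp: tendsto_iff dist_commute)
      moreover have "\<forall>\<^sub>F t in at t0 within {0..1}. t \<in> {0..1}"
        by (simp add: eventually_at_filter)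
      ultimately show "\<forall>\<^sub>F t in at t0 within {0..1}. E t0 = E t"
        using ev_e
      proof eventually_elim
        case (elim t)
        have "l s t - l s t0 = L s (c t)" if "s \<in> K" for s
        proof -
          have "(c t - p s) / (w0 - p s) = exp (l s t - l s t0)"
            using l(3)[OF that] elim t0 by (simp add: w0_def exp_diff)
          moreover have "\<bar>Im (l s t - l s t0)\<bar> < pi"
            using elim that abs_Im_le_cmod[of "l s t - l s t0"] by fastforce
          ultimately show ?thesis unfolding L_def by (simp add: abs_less_iff)
        qed
        then have "(\<Sum>s\<in>K. a s * l s t) - (\<Sum>s\<in>K. a s * l s t0) = (\<Sum>s\<in>K. a s * L s (c t))"
          by (simp flip: sum_subtractf right_diff_distrib)
        moreover have "P (c t) - (\<Sum>s\<in>K. a s * L s (c t)) = P w0 - (\<Sum>s\<in>K. a s * L s w0)"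
          using k[of "c t"] k[of w0] elim d by (simp add: H_def)
        moreover have "(\<Sum>s\<in>K. a s * L s w0) = 0" using w0s by (simp add: L_def)
        ultimately show "E t0 = E t" using elim e0 by (simp add: E_def w0_def algebra_simps)
      qed
    qed
  qed auto
  then have "e 1 - e 0 = (\<Sum>s\<in>K. a s * (pathfinish (l s) - pathstart (l s)))"
    by (simp add: E_def pathfinish_def pathstart_def right_diff_distrib sum_subtractf algebra_simps)
  also have "\<dots> = 2 * of_real pi * \<i> * (\<Sum>s\<in>K. a s * winding_number c (p s))"
    by (simp add: l(2) sum_distrib_left mult_ac)
  finally show ?thesis .
qed

text \<open>Continuous logarithms of c - u and c - v are subtracted; the factor k adds a constant
  logarithm, which drops out of the increment. Applied to a Moebius change of coordinate, with v the
  point sent to infinity.\<close>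

lemma winding_number_quotient:
  assumes c: "path c" "u \<notin> path_image c" "v \<notin> path_image c" and k: "k \<noteq> 0"
    and f: "\<And>t. t \<in> {0..1} \<Longrightarrow> f t - z = k * (c t - u) / (c t - v)"
  shows "winding_number f z = winding_number c u - winding_number c v"
proof -
  obtain l where l: "path l" "pathfinish l - pathstart l = 2 * of_real pi * \<i> * winding_number c u"
    "\<And>t. t \<in> {0..1} \<Longrightarrow> c t = u + exp (l t)"
    using winding_number_as_continuous_log[OF c(1,2)] by metis
  obtain m where m: "path m" "pathfinish m - pathstart m = 2 * of_real pi * \<i> * winding_number c v"
    "\<And>t. t \<in> {0..1} \<Longrightarrow> c t = v + exp (m t)"
    using winding_number_as_continuous_log[OF c(1,3)] by metis
  define h where "h t = Ln k + l t - m t" for t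
  have "path h" unfolding h_def using l(1) m(1) by (auto simp: path_def intro!: continuous_intros)
  have "f t - z = (exp \<circ> h) t" if "t \<in> {0..1}" for t
  proof -
    have "c t - u = exp (l t)" "c t - v = exp (m t)"
      using l(3)[OF that] m(3)[OF that] by (auto simp: algebra_simps)
    then show ?thesis using f[OF that] k by (simp add: h_def exp_add exp_diff)
  qed
  then have "winding_number (\<lambda>t. f t - z) 0 = winding_number (exp \<circ> h) 0"
    by (intro winding_number_cong) auto
  then have "winding_number f z = winding_number (exp \<circ> h) 0"
    using winding_number_offset[of f z] by simp
  also have "\<dots> = (pathfinish h - pathstart h) / (2 * of_real pi * \<i>)"
    by (rule winding_number_compose_exp[OF \<open>path h\<close>])
  also have "pathfinish h - pathstart h = (pathfinish l - pathstart l) - (pathfinish m - pathstart m)"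
    by (simp add: h_def pathfinish_def pathstart_def)
  finally show ?thesis unfolding l(2) m(2) by (simp add: diff_divide_distrib)
qed

text \<open>Inverse of the coordinate w = 1/(z - b) on the sphere without b; thus w = 0 is the point
  at infinity, an ordinary interior point of the w-plane.\<close>

definition from_coord :: "complex \<Rightarrow> complex \<Rightarrow> P1" where
  "from_coord b w = (if w = 0 then Infty else Aff (b + 1 / w))"

lemma coord_away_from_coord [simp]: "coord_away (Aff b) (from_coord b w) = w"
  by (simp add: coord_away_def from_coord_def)

lemma from_coord_coord_away: "x \<noteq> Aff b \<Longrightarrow> from_coord b (coord_away (Aff b) x) = x"
  by (cases x) (auto simp: coord_away_def from_coord_def)

text \<open>From z = (1 + b w) / w one gets 1/z = w / (1 + b w), which is regular at w = 0. This is
  the passage to the chart at infinity.\<close>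

lemma from_coord_eq_chart_True:
  "1 + b * w \<noteq> 0 \<Longrightarrow> from_coord b w = chart True (w / (1 + b * w))"
  by (auto simp: from_coord_def chart_def field_simps)

lemma continuous_chart: "continuous_on UNIV (chart b)"
  by (simp add: continuous_on_open_vimage open_P1_def)

lemma continuous_from_coord: "continuous_on UNIV (from_coord b)"
proof -
  have cont: "continuous_on S (\<lambda>w. chart \<beta> (f w))" if "continuous_on S f" for S f \<beta>
    by (rule continuous_on_compose2[OF continuous_chart that]) auto
  have "continuous_on (- {0}) (from_coord b)"
  proof (subst continuous_on_cong[OF refl])
    show "from_coord b w = chart False (b + 1 / w)" if "w \<in> - {0}" for w
      using that by (simp add: from_coord_def chart_def)
    show "continuous_on (- {0}) (\<lambda>w. chart False (b + 1 / w))"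
      by (intro cont continuous_intros) auto
  qed
  moreover have "continuous_on {w. 1 + b * w \<noteq> 0} (from_coord b)"
    by (subst continuous_on_cong[OF refl, of _ _ "\<lambda>w. chart True (w / (1 + b * w))"])
      (auto simp: from_coord_eq_chart_True intro!: cont continuous_intros)
  moreover have "open {w. 1 + b * w \<noteq> 0}"
    by (intro open_Collect_neq continuous_intros)
  ultimately have "continuous_on (- {0} \<union> {w. 1 + b * w \<noteq> 0}) (from_coord b)"
    by (intro continuous_on_open_Un) auto
  moreover have "- {0} \<union> {w. 1 + b * w \<noteq> 0} = UNIV" by auto
  ultimately show ?thesis by simp
qed

text \<open>The topology of \<open>P1\<close> is the final one for the two charts.\<close>

lemma continuous_on_P1:
  fixes f :: "P1 \<Rightarrow> 'a::topological_space"
  assumes S: "open S" and f: "\<And>b. continuous_on (chart b -` S) (f \<circ> chart b)"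
  shows "continuous_on S f"
  unfolding continuous_on_open_vimage[OF S]
proof (intro allI impI)
  fix B :: "'a set" assume "open B"
  have open_v: "open (chart b -` S)" for b using S by (simp add: open_P1_def)
  have "open ((f \<circ> chart b) -` B \<inter> chart b -` S)" for b
    using f[of b] \<open>open B\<close> unfolding continuous_on_open_vimage[OF open_v] by blast
  then show "open (f -` B \<inter> S)"
    by (simp add: open_P1_def vimage_comp)
qed

lemma continuous_coord_away: "continuous_on (- {Aff b}) (coord_away (Aff b))"
proof (rule continuous_on_P1)
  have vim: "chart \<beta> -` (- {Aff b}) = {t. if \<beta> then b * t \<noteq> 1 else t \<noteq> b}" for \<beta>
    by (auto simp: chart_def divide_eq_eq eq_divide_eq mult.commute split: if_splits)
  have op: "open {t. if \<beta> then b * t \<noteq> 1 else t \<noteq> b}" for \<beta>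
    by (cases \<beta>) (auto intro!: open_Collect_neq continuous_intros)
  then show "open (- {Aff b})" by (simp add: open_P1_def vim)
  show "continuous_on (chart \<beta> -` (- {Aff b})) (coord_away (Aff b) \<circ> chart \<beta>)" for \<beta>
  proof (subst continuous_on_cong[OF refl])
    fix t assume "t \<in> chart \<beta> -` (- {Aff b})"
    then show "(coord_away (Aff b) \<circ> chart \<beta>) t = (if \<beta> then t / (1 - b * t) else 1 / (t - b))"
      unfolding vim by (auto simp: chart_def coord_away_def divide_simps split: if_splits)
  next
    show "continuous_on (chart \<beta> -` (- {Aff b})) (\<lambda>t. if \<beta> then t / (1 - b * t) else 1 / (t - b))"
      unfolding vim by (cases \<beta>) (auto intro!: continuous_intros)
  qed
qed

lemma inj_coord_away: "inj_on (coord_away (Aff b)) (- {Aff b})"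
  by (metis ComplD from_coord_coord_away inj_onI insertI1)

text \<open>Two affine coordinates of the sphere differ by a Moebius transformation. The left side
  vanishes at p and has its pole at s, so in the coordinate at b it must be a multiple of (w - w_p)
  / (w - w_s).\<close>

lemma coord_away_quotient:
  assumes s: "s \<noteq> Aff b" and p: "p \<noteq> Aff b" "p \<noteq> s"
  obtains k where "k \<noteq> 0"
    "\<And>x. x \<noteq> Aff b \<Longrightarrow> x \<noteq> s \<Longrightarrow> coord_away s x - coord_away s p =
       k * (coord_away (Aff b) x - coord_away (Aff b) p) / (coord_away (Aff b) x - coord_away (Aff b) s)"
proof (cases s)
  case Infty
  define w where "w = coord_away (Aff b) p"
  have pw: "p = from_coord b w" using p by (simp add: w_def from_coord_coord_away)
  have w: "w \<noteq> 0" using p Infty by (auto simp: pw from_coord_def)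
  show ?thesis
  proof (rule that[of "- 1 / w"])
    fix x assume x: "x \<noteq> Aff b" "x \<noteq> s"
    define v where "v = coord_away (Aff b) x"
    have xv: "x = from_coord b v" using x by (simp add: v_def from_coord_coord_away)
    have v: "v \<noteq> 0" using x Infty by (auto simp: xv from_coord_def)
    show "coord_away s x - coord_away s p = - 1 / w * (coord_away (Aff b) x - coord_away (Aff b) p) / (coord_away (Aff b) x - coord_away (Aff b) s)"
      unfolding xv pw coord_away_from_coord unfolding Infty from_coord_def using v w
      by (simp add: coord_away_def field_simps)
  qed (use w in simp)
next
  case (Aff y)
  define r where "r = coord_away (Aff b) s"
  have yb: "y \<noteq> b" using s Aff by auto
  have r: "r = 1 / (y - b)" "r \<noteq> 0" "y = b + 1 / r"
    using yb by (auto simp: r_def Aff coord_away_def)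
  have formula: "coord_away s x = coord_away (Aff b) x * r / (r - coord_away (Aff b) x)"
    and neq: "coord_away (Aff b) x \<noteq> r" if "x \<noteq> Aff b" "x \<noteq> s" for x
  proof -
    show "coord_away (Aff b) x \<noteq> r"
      using that s inj_onD[OF inj_coord_away[of b], of x s] by (auto simp: r_def)
    define v where "v = coord_away (Aff b) x"
    have xv: "x = from_coord b v" using that by (simp add: v_def from_coord_coord_away)
    have vr: "v \<noteq> r" using \<open>coord_away (Aff b) x \<noteq> r\<close> by (simp add: v_def)
    show "coord_away s x = coord_away (Aff b) x * r / (r - coord_away (Aff b) x)"
      unfolding xv coord_away_from_coord unfolding Aff from_coord_def r(3) using vr r(2)
      by (simp add: coord_away_def field_simps)
  qed
  define w where "w = coord_away (Aff b) p"
  have w: "w \<noteq> r" using neq p by (simp add: w_def)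
  show ?thesis
  proof (rule that[of "- r\<^sup>2 / (r - w)"])
    show "- r\<^sup>2 / (r - w) \<noteq> 0" using w r(2) by simp
    fix x assume x: "x \<noteq> Aff b" "x \<noteq> s"
    define v where "v = coord_away (Aff b) x"
    have v: "v \<noteq> r" using neq x by (simp add: v_def)
    show "coord_away s x - coord_away s p = - r\<^sup>2 / (r - w) * (coord_away (Aff b) x - coord_away (Aff b) p) / (coord_away (Aff b) x - coord_away (Aff b) s)"
      unfolding formula[OF x] formula[OF p] v_def[symmetric] w_def[symmetric] r_def[symmetric]
      using v w by (simp add: divide_simps) (simp add: algebra_simps power2_eq_square)
  qed
qed

text \<open>Pullback of dz/(z - s) under z = b + 1/w, the factor -1/w^2 being dz/dw. The extra term
  -1/w is the residue -1 of dz/(z - s) at infinity; for s = infinity both sides are zero.\<close>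

lemma simple_pole_coord:
  assumes "s \<noteq> Aff b" "w \<noteq> 0" "from_coord b w \<noteq> s"
  shows "simple_pole (b + 1 / w) s * (- 1 / w\<^sup>2) = 1 / (w - coord_away (Aff b) s) - 1 / w"
proof (cases s)
  case Infty
  then show ?thesis by (simp add: simple_pole_def coord_away_def)
next
  case (Aff y)
  have y: "y - b \<noteq> 0" and nz: "b + 1 / w - y \<noteq> 0" using assms Aff by (auto simp: from_coord_def)
  define u where "u = y - b"
  have eq: "b + 1 / w - y = (1 - u * w) / w" using assms by (simp add: u_def field_simps)
  then have "1 - u * w \<noteq> 0" using nz by auto
  then have "1 / ((1 - u * w) / w) * (- 1 / w\<^sup>2) = 1 / (w - 1 / u) - 1 / w"
    using y assms(2) unfolding u_def[symmetric] by (simp add: divide_simps power2_eq_square) (auto simp: algebra_simps)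
  then show ?thesis using eq by (simp add: Aff simple_pole_def coord_away_def u_def)
qed


section \<open>Presented Lie algebras and their completed enveloping algebras\<close>

lemma lookup_na_scale: "Poly_Mapping.lookup (na_scale c a) t = c * Poly_Mapping.lookup a t"
  by (simp add: na_scale_def Poly_Mapping.map.rep_eq when_def)

text \<open>Bilinearity becomes a termwise identity once all factors are expanded over common index
  sets larger than their supports.\<close>

lemma na_times_superset:
  assumes "finite A" "Poly_Mapping.keys a \<subseteq> A" "finite B" "Poly_Mapping.keys b \<subseteq> B"
  shows "a \<star> b = (\<Sum>s\<in>A. \<Sum>t\<in>B.
     Poly_Mapping.single (Node s t) (Poly_Mapping.lookup a s * Poly_Mapping.lookup b t))"
proof -
  have "a \<star> b = (\<Sum>s\<in>Poly_Mapping.keys a. \<Sum>t\<in>B.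
     Poly_Mapping.single (Node s t) (Poly_Mapping.lookup a s * Poly_Mapping.lookup b t))"
    unfolding na_times_def using assms
    by (intro sum.cong refl sum.mono_neutral_left) (auto simp: in_keys_iff)
  also have "\<dots> = (\<Sum>s\<in>A. \<Sum>t\<in>B.
     Poly_Mapping.single (Node s t) (Poly_Mapping.lookup a s * Poly_Mapping.lookup b t))"
    using assms by (intro sum.mono_neutral_left) (auto simp: in_keys_iff)
  finally show ?thesis .
qed

lemma na_times_add_left: "(a + b) \<star> c = a \<star> c + b \<star> c"
proof -
  let ?A = "Poly_Mapping.keys a \<union> Poly_Mapping.keys b"
  note sup = na_times_superset[of ?A _ "Poly_Mapping.keys c" c]
  have "Poly_Mapping.keys (a + b) \<subseteq> ?A" by (rule Poly_Mapping.keys_add)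
  then show ?thesis
    by (simp add: sup lookup_add distrib_right single_add sum.distrib)
qed

lemma na_times_add_right: "c \<star> (a + b) = c \<star> a + c \<star> b"
proof -
  let ?A = "Poly_Mapping.keys a \<union> Poly_Mapping.keys b"
  note sup = na_times_superset[of "Poly_Mapping.keys c" c ?A]
  have "Poly_Mapping.keys (a + b) \<subseteq> ?A" by (rule Poly_Mapping.keys_add)
  then show ?thesis
    by (simp add: sup lookup_add distrib_left single_add sum.distrib)
qed

lemma na_times_diff_left: "(a - b) \<star> c = a \<star> c - b \<star> c"
  using na_times_add_left[of "a - b" b c] by simp

lemma na_times_diff_right: "c \<star> (a - b) = c \<star> a - c \<star> b"
  using na_times_add_right[of c "a - b" b] by simp

lemma free_na_zero: "0 \<in> free_na X"
  by (simp add: free_na_def)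

lemma free_na_add: "a \<in> free_na X \<Longrightarrow> b \<in> free_na X \<Longrightarrow> a + b \<in> free_na X"
  using Poly_Mapping.keys_add[of a b] by (fastforce simp: free_na_def)

lemma free_na_scale: "a \<in> free_na X \<Longrightarrow> na_scale c a \<in> free_na X"
  by (auto simp: free_na_def in_keys_iff lookup_na_scale)

lemma na_scale_minus_one: "na_scale (- 1) a = - a"
  by (rule poly_mapping_eqI) (simp add: lookup_na_scale)

lemma na_scale_diff: "na_scale c (a - b) = na_scale c a - na_scale c b"
  by (rule poly_mapping_eqI) (simp add: lookup_na_scale lookup_minus right_diff_distrib)

lemma free_na_diff: "a \<in> free_na X \<Longrightarrow> b \<in> free_na X \<Longrightarrow> a - b \<in> free_na X"
  using free_na_add[of a X "- b"] free_na_scale[of b X "- 1"] by (simp add: na_scale_minus_one)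

lemma free_na_sum: "(\<And>x. x \<in> S \<Longrightarrow> f x \<in> free_na X) \<Longrightarrow> sum f S \<in> free_na X"
  by (induction S rule: infinite_finite_induct) (auto intro: free_na_add free_na_zero)

lemma free_na_gen: "x \<in> X \<Longrightarrow> na_gen x \<in> free_na X"
  by (simp add: free_na_def na_gen_def)

lemma free_na_times: "a \<in> free_na X \<Longrightarrow> b \<in> free_na X \<Longrightarrow> a \<star> b \<in> free_na X"
  unfolding na_times_def by (intro free_na_sum) (auto simp: free_na_def)

lemma na_ideal_free_na: "na_ideal X (free_na X)"
  by (auto simp: na_ideal_def free_na_zero free_na_add free_na_scale free_na_times)

text \<open>The hypothesis makes \<open>free_na X\<close> one of the ideals intersected; an empty
  intersection would be the whole type.\<close>

lemma na_ideal_lie_ideal: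
  assumes "R \<subseteq> free_na X"
  shows "na_ideal X (lie_ideal X R)"
proof -
  have "lie_axioms X \<union> R \<subseteq> free_na X"
    using assms by (auto simp: lie_axioms_def intro!: free_na_add free_na_times)
  then have "lie_ideal X R \<subseteq> free_na X"
    unfolding lie_ideal_def using na_ideal_free_na by blast
  then show ?thesis
    unfolding na_ideal_def lie_ideal_def by (auto simp: na_ideal_def)
qed

lemma relators_subset_lie_ideal: "R \<subseteq> lie_ideal X R"
  by (auto simp: lie_ideal_def)

context
  fixes X :: "'x set" and I :: "'x na set"
  assumes ideal: "na_ideal X I"
begin

lemma na_ideal_diff: "a \<in> I \<Longrightarrow> b \<in> I \<Longrightarrow> a - b \<in> I"
  using ideal na_scale_minus_one[of b] unfolding na_ideal_def by (metis add_uminus_conv_diff)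

lemma na_coset_eq_iff: "na_coset I a = na_coset I b \<longleftrightarrow> a - b \<in> I"
proof
  assume "na_coset I a = na_coset I b"
  moreover have "a \<in> na_coset I a" using ideal by (simp add: na_coset_def na_ideal_def)
  ultimately show "a - b \<in> I" by (simp add: na_coset_def)
next
  assume ab: "a - b \<in> I"
  have "c - a \<in> I \<longleftrightarrow> c - b \<in> I" for c
  proof
    assume "c - a \<in> I"
    then have "(c - a) + (a - b) \<in> I" using ab ideal by (simp only: na_ideal_def)
    then show "c - b \<in> I" by simp
  next
    assume "c - b \<in> I"
    then have "(c - b) - (a - b) \<in> I" using ab by (rule na_ideal_diff)
    then show "c - a \<in> I" by simp
  qed
  then show "na_coset I a = na_coset I b" by (simp add: na_coset_def)
qed

lemma na_coset_free_na: "a \<in> free_na X \<Longrightarrow> b \<in> na_coset I a \<Longrightarrow> b \<in> free_na X"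
  using free_na_add[of "b - a" X a] ideal by (auto simp: na_coset_def na_ideal_def)

lemma na_coset_self: "a \<in> na_coset I a"
  using ideal by (simp add: na_coset_def na_ideal_def)

text \<open>The operations of \<open>presented_lie\<close> are unions over all representatives. Such
  a union collapses to a single coset exactly because the operation is compatible with the
  ideal.\<close>

lemma na_coset_lift2:
  assumes "\<And>a' b'. a' \<in> na_coset I a \<Longrightarrow> b' \<in> na_coset I b \<Longrightarrow> f a' b' - f a b \<in> I"
  shows "(\<Union>a'\<in>na_coset I a. \<Union>b'\<in>na_coset I b. na_coset I (f a' b')) = na_coset I (f a b)"
proof -
  have "na_coset I (f a' b') = na_coset I (f a b)"
    if "a' \<in> na_coset I a" "b' \<in> na_coset I b" for a' b'
    using assms[OF that] by (simp add: na_coset_eq_iff)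
  then have "(\<Union>a'\<in>na_coset I a. \<Union>b'\<in>na_coset I b. na_coset I (f a' b')) =
     (\<Union>a'\<in>na_coset I a. \<Union>b'\<in>na_coset I b. na_coset I (f a b))"
    by (intro SUP_cong refl) auto
  then show ?thesis using na_coset_self by auto
qed

lemma na_coset_add:
  "(\<Union>a'\<in>na_coset I a. \<Union>b'\<in>na_coset I b. na_coset I (a' + b')) = na_coset I (a + b)"
proof (rule na_coset_lift2)
  fix a' b' assume "a' \<in> na_coset I a" "b' \<in> na_coset I b"
  then have "(a' - a) + (b' - b) \<in> I" using ideal by (simp add: na_coset_def na_ideal_def)
  then show "a' + b' - (a + b) \<in> I" by (simp add: algebra_simps)
qed

lemma na_coset_scale: "(\<Union>a'\<in>na_coset I a. na_coset I (na_scale c a')) = na_coset I (na_scale c a)"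
proof -
  have "na_coset I (na_scale c a') = na_coset I (na_scale c a)" if "a' \<in> na_coset I a" for a'
    using that ideal unfolding na_coset_eq_iff na_scale_diff[symmetric]
    by (simp add: na_coset_def na_ideal_def)
  then have "(\<Union>a'\<in>na_coset I a. na_coset I (na_scale c a')) = (\<Union>a'\<in>na_coset I a. na_coset I (na_scale c a))"
    by (intro SUP_cong refl) auto
  then show ?thesis using na_coset_self by auto
qed

lemma na_coset_times:
  assumes "a \<in> free_na X" "b \<in> free_na X"
  shows "(\<Union>a'\<in>na_coset I a. \<Union>b'\<in>na_coset I b. na_coset I (a' \<star> b')) = na_coset I (a \<star> b)"
proof (rule na_coset_lift2)
  fix a' b' assume a'b': "a' \<in> na_coset I a" "b' \<in> na_coset I b"
  then have "b' \<in> free_na X" using na_coset_free_na assms by blast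
  then have "(a' - a) \<star> b' \<in> I" "a \<star> (b' - b) \<in> I"
    using a'b' assms ideal by (auto simp: na_coset_def na_ideal_def)
  then have "(a' - a) \<star> b' + a \<star> (b' - b) \<in> I" using ideal by (simp add: na_ideal_def)
  then show "a' \<star> b' - a \<star> b \<in> I" by (simp add: na_times_diff_left na_times_diff_right)
qed

end

text \<open>Closure of the operations places \<open>env_relators L\<close> inside the free
  associative algebra, so that the ideal generated there has its usual properties.\<close>

locale closed_graded_lie =
  fixes L :: "'a graded_lie"
  assumes add_closed: "a \<in> carrier L \<Longrightarrow> b \<in> carrier L \<Longrightarrow> lie_add L a b \<in> carrier L"
    and scale_closed: "a \<in> carrier L \<Longrightarrow> lie_scale L c a \<in> carrier L"
    and bracket_closed: "a \<in> carrier L \<Longrightarrow> b \<in> carrier L \<Longrightarrow> lie_bracket L a b \<in> carrier L"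

lemma closed_presented_lie:
  assumes "R \<subseteq> free_na X"
  shows "closed_graded_lie (presented_lie X R)"
proof
  have ideal: "na_ideal X (lie_ideal X R)" using assms by (rule na_ideal_lie_ideal)
  fix a b c
  assume "a \<in> carrier (presented_lie X R)"
  then obtain a' where a: "a' \<in> free_na X" "a = na_coset (lie_ideal X R) a'"
    by (auto simp: presented_lie_def Let_def)
  then show "lie_scale (presented_lie X R) c a \<in> carrier (presented_lie X R)"
    by (auto simp: presented_lie_def Let_def na_coset_scale[OF ideal] intro: free_na_scale)
  assume "b \<in> carrier (presented_lie X R)"
  then obtain b' where b: "b' \<in> free_na X" "b = na_coset (lie_ideal X R) b'"
    by (auto simp: presented_lie_def Let_def)
  show "lie_add (presented_lie X R) a b \<in> carrier (presented_lie X R)"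
    using a b by (auto simp: presented_lie_def Let_def na_coset_add[OF ideal] intro: free_na_add)
  show "lie_bracket (presented_lie X R) a b \<in> carrier (presented_lie X R)"
    using a b by (auto simp: presented_lie_def Let_def na_coset_times[OF ideal] intro: free_na_times)
qed

section \<open>The free associative algebra and the enveloping algebra\<close>

lemma scalar_add: "scalar (a + b) = scalar a + scalar b"
  by (simp add: scalar_def single_add)

lemma scalar_mult: "scalar (a * b) = scalar a * scalar b"
  by (simp add: scalar_def mult_single)

lemma scalar_1: "scalar 1 = 1"
  by (simp add: scalar_def)

lemma lookup_scalar_mult: "Poly_Mapping.lookup (scalar c * f) w = c * Poly_Mapping.lookup f w"
  by (simp add: scalar_def lookup_mult lookup_single when_mult)

lemma keys_scalar_mult: "Poly_Mapping.keys (scalar c * f) \<subseteq> Poly_Mapping.keys f"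
  by (auto simp: in_keys_iff lookup_scalar_mult)


lemma single_letter_closed: "a \<in> carrier L \<Longrightarrow> letter a \<in> carrier (free_assoc (carrier L))"
  by (simp add: letter_def free_assoc_def)

lemma scalar_closed: "scalar c \<in> carrier (free_assoc X)"
  by (simp add: scalar_def free_assoc_def zero_free_monoid_def)

lemma ring_free_assoc: "ring (free_assoc X)"
proof -
  have ops: "mult (free_assoc X) = (*)" "one (free_assoc X) = 1" "zero (free_assoc X) = 0"
    "add (free_assoc X) = (+)"
    by (simp_all add: free_assoc_def)
  have closed: "0 \<in> carrier (free_assoc X)" "1 \<in> carrier (free_assoc X)"
    by (simp_all add: free_assoc_def zero_free_monoid_def)
  have mult: "f * g \<in> carrier (free_assoc X)"
    if fg: "f \<in> carrier (free_assoc X)" "g \<in> carrier (free_assoc X)" for f g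
  proof -
    have "set (letters w) \<subseteq> X" if w: "w \<in> Poly_Mapping.keys (f * g)" for w
    proof -
      obtain a b where "w = a + b" "a \<in> Poly_Mapping.keys f" "b \<in> Poly_Mapping.keys g"
        using Poly_Mapping.keys_mult[of f g] w by blast
      then show ?thesis using fg by (auto simp: free_assoc_def plus_free_monoid_def)
    qed
    then show ?thesis by (simp add: free_assoc_def)
  qed
  have add: "f + g \<in> carrier (free_assoc X)"
    if fg: "f \<in> carrier (free_assoc X)" "g \<in> carrier (free_assoc X)" for f g
  proof -
    have "set (letters w) \<subseteq> X" if w: "w \<in> Poly_Mapping.keys (f + g)" for w
      using fg w Poly_Mapping.keys_add[of f g] by (auto simp: free_assoc_def dest!: subsetD)
    then show ?thesis by (simp add: free_assoc_def)
  qed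
  have minus: "\<exists>g\<in>carrier (free_assoc X). g + f = 0" if "f \<in> carrier (free_assoc X)" for f
    using that by (intro bexI[of _ "- f"]) (auto simp: free_assoc_def)
  show ?thesis
  proof (rule ringI)
    show "abelian_group (free_assoc X)"
    proof (rule abelian_groupI)
      show "\<exists>g\<in>carrier (free_assoc X). g \<oplus>\<^bsub>free_assoc X\<^esub> f = \<zero>\<^bsub>free_assoc X\<^esub>"
        if "f \<in> carrier (free_assoc X)" for f
        using minus[OF that] unfolding ops .
      show "f \<oplus>\<^bsub>free_assoc X\<^esub> g \<in> carrier (free_assoc X)"
        if "f \<in> carrier (free_assoc X)" "g \<in> carrier (free_assoc X)" for f g
        using add[OF that] unfolding ops .
    qed (simp_all add: ops closed add_ac)
    show "Group.monoid (free_assoc X)"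
    proof (rule monoidI)
      show "f \<otimes>\<^bsub>free_assoc X\<^esub> g \<in> carrier (free_assoc X)"
        if "f \<in> carrier (free_assoc X)" "g \<in> carrier (free_assoc X)" for f g
        using mult[OF that] unfolding ops .
    qed (simp_all add: ops closed mult.assoc)
  qed (simp_all add: ops distrib_left distrib_right)
qed

context closed_graded_lie
begin

abbreviation "R \<equiv> free_assoc (carrier L)"

lemma R_simps: "mult R = (*)" "one R = 1" "zero R = 0" "add R = (+)"
  by (simp_all add: free_assoc_def)

lemma R_closed:
  assumes "f \<in> carrier R" "g \<in> carrier R"
  shows "f + g \<in> carrier R" "f * g \<in> carrier R" "scalar c * f \<in> carrier R" "- f \<in> carrier R" "f - g \<in> carrier R"
proof -
  interpret ring R by (rule ring_free_assoc)
  show add: "f + g \<in> carrier R" and "f * g \<in> carrier R" "scalar c * f \<in> carrier R"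
    using assms a_closed[of f g] m_closed[of f g] m_closed[OF scalar_closed, of f] by (simp_all add: R_simps)
  show "- f \<in> carrier R" using assms by (simp add: free_assoc_def)
  have "- g \<in> carrier R" using assms by (simp add: free_assoc_def)
  then show "f - g \<in> carrier R" using assms a_closed[of f "- g"] by (simp add: R_simps)
qed

lemma env_relators_closed: "env_relators L \<subseteq> carrier R"
  unfolding env_relators_def
  by (auto intro!: R_closed single_letter_closed add_closed scale_closed bracket_closed)

lemma ideal_env: "ideal (env_ideal L) R"
  unfolding env_ideal_def by (rule ring.genideal_ideal[OF ring_free_assoc env_relators_closed])

lemma ring_U: "ring (U L)"
  unfolding U_def by (rule ideal.quotient_is_ring[OF ideal_env])

lemma U_class_hom: "U_class L \<in> ring_hom R (U L)"
  unfolding U_class_def[abs_def] U_def by (rule ideal.rcos_ring_hom[OF ideal_env])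

lemma U_class_closed: "f \<in> carrier R \<Longrightarrow> U_class L f \<in> carrier (U L)"
  using U_class_hom by (rule ring_hom_closed)

lemma U_class_add:
  "f \<in> carrier R \<Longrightarrow> g \<in> carrier R \<Longrightarrow> U_class L (f + g) = U_class L f \<oplus>\<^bsub>U L\<^esub> U_class L g"
  using ring_hom_add[OF U_class_hom] by (simp add: R_simps)

lemma U_class_mult:
  "f \<in> carrier R \<Longrightarrow> g \<in> carrier R \<Longrightarrow> U_class L (f * g) = U_class L f \<otimes>\<^bsub>U L\<^esub> U_class L g"
  using ring_hom_mult[OF U_class_hom] by (simp add: R_simps)

lemma U_class_zero: "U_class L 0 = \<zero>\<^bsub>U L\<^esub>"
  using ring_hom_zero[OF U_class_hom ring_free_assoc ring_U] by (simp add: R_simps)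

text \<open>Scalars are multiples of the empty word and belong to the free algebra, so a two-sided
  ideal of this ring is automatically a complex subspace.\<close>

lemma env_ideal_closed:
  assumes "f \<in> env_ideal L"
  shows "f \<in> carrier R" "g \<in> env_ideal L \<Longrightarrow> f + g \<in> env_ideal L"
    "scalar c * f \<in> env_ideal L" "- f \<in> env_ideal L"
proof -
  interpret ideal "env_ideal L" R by (rule ideal_env)
  show "f \<in> carrier R" using assms by (rule a_Hcarr)
  show "f + g \<in> env_ideal L" if "g \<in> env_ideal L"
    using additive_subgroup.a_closed[OF ideal.axioms(1)[OF ideal_env] assms that] by (simp add: R_simps)
  show sc: "scalar c * f \<in> env_ideal L" for c
    using I_l_closed[OF assms scalar_closed] by (simp add: R_simps)
  have "scalar (- 1) * f = - f"
    by (rule poly_mapping_eqI) (simp add: lookup_scalar_mult)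
  then show "- f \<in> env_ideal L" using sc[of "- 1"] by simp
qed

lemma U_class_eq_image: "U_class L f = (\<lambda>i. i + f) ` env_ideal L"
  by (auto simp: U_class_def a_r_coset_def r_coset_def free_assoc_def)

lemma zero_env_ideal: "0 \<in> env_ideal L"
  using additive_subgroup.zero_closed[OF ideal.axioms(1)[OF ideal_env]] by (simp add: R_simps)

lemma U_class_eq_iff: "U_class L f = U_class L g \<longleftrightarrow> f - g \<in> env_ideal L"
proof
  assume "U_class L f = U_class L g"
  moreover have "f \<in> U_class L f" using zero_env_ideal by (force simp: U_class_eq_image)
  ultimately show "f - g \<in> env_ideal L" by (auto simp: U_class_eq_image)
next
  assume fg: "f - g \<in> env_ideal L"
  show "U_class L f = U_class L g"
  proof (rule Set.set_eqI)
    fix h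
    have "h - f \<in> env_ideal L \<longleftrightarrow> h - g \<in> env_ideal L"
      using env_ideal_closed(2)[OF fg, of "h - f"] env_ideal_closed(2)[OF env_ideal_closed(4)[OF fg], of "h - g"]
      by auto
    moreover have "h \<in> U_class L k \<longleftrightarrow> h - k \<in> env_ideal L" for k
      by (auto simp: U_class_eq_image image_iff intro: bexI[of _ "h - k"])
    ultimately show "h \<in> U_class L f \<longleftrightarrow> h \<in> U_class L g" by simp
  qed
qed

lemma U_scale_class: "f \<in> carrier R \<Longrightarrow> U_scale L c (U_class L f) = U_class L (scalar c * f)"
  by (simp add: U_scale_def U_class_mult scalar_closed)

section \<open>Graded pieces and their linear forms\<close>

definition homogeneous :: "nat \<Rightarrow> 'a assoc set" where
  "homogeneous d = {f \<in> carrier R. \<forall>w\<in>Poly_Mapping.keys f.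
     \<exists>ds. list_all2 (\<lambda>a e. a \<in> lie_grade L e) (letters w) ds \<and> sum_list ds = d}"

lemma U_grade_eq: "U_grade L d = U_class L ` homogeneous d"
  by (simp add: U_grade_def homogeneous_def)

lemma homogeneous_closed:
  assumes "f \<in> homogeneous d"
  shows "f \<in> carrier R" "g \<in> homogeneous d \<Longrightarrow> f + g \<in> homogeneous d" "scalar c * f \<in> homogeneous d"
proof -
  show f: "f \<in> carrier R" using assms by (simp add: homogeneous_def)
  show "f + g \<in> homogeneous d" if "g \<in> homogeneous d"
    using assms that Poly_Mapping.keys_add[of f g] R_closed(1)[of f g]
    unfolding homogeneous_def by blast
  show "scalar c * f \<in> homogeneous d"
    using assms keys_scalar_mult[of c f] R_closed(3)[OF f f] unfolding homogeneous_def by blast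
qed

lemma zero_homogeneous: "0 \<in> homogeneous d"
  by (simp add: homogeneous_def free_assoc_def)

lemma letter_homogeneous: "a \<in> carrier L \<Longrightarrow> a \<in> lie_grade L d \<Longrightarrow> letter a \<in> homogeneous d"
  by (simp add: homogeneous_def single_letter_closed) (auto simp: letter_def list_all2_Cons1 intro!: exI[of _ "[d]"])

lemma U_grade_subset: "U_grade L d \<subseteq> carrier (U L)"
  using homogeneous_closed(1) U_class_closed by (auto simp: U_grade_eq)

lemma U_grade_add: "u \<in> U_grade L d \<Longrightarrow> v \<in> U_grade L d \<Longrightarrow> u \<oplus>\<^bsub>U L\<^esub> v \<in> U_grade L d"
  unfolding U_grade_eq by (auto simp: homogeneous_closed(1,2) simp flip: U_class_add)

lemma U_grade_scale: "u \<in> U_grade L d \<Longrightarrow> U_scale L c u \<in> U_grade L d"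
  unfolding U_grade_eq by (auto simp: homogeneous_closed(1,3) U_scale_class)

lemma U_grade_zero: "\<zero>\<^bsub>U L\<^esub> \<in> U_grade L d"
  unfolding U_grade_eq using zero_homogeneous U_class_zero by (metis imageI)

lemma U_scale_zero: "U_scale L c \<zero>\<^bsub>U L\<^esub> = \<zero>\<^bsub>U L\<^esub>"
proof -
  interpret ring "U L" by (rule ring_U)
  show ?thesis using U_class_closed[OF scalar_closed] by (simp add: U_scale_def)
qed

lemma U_dual_add:
  "\<phi> \<in> U_dual L d \<Longrightarrow> u \<in> U_grade L d \<Longrightarrow> v \<in> U_grade L d \<Longrightarrow> \<phi> (u \<oplus>\<^bsub>U L\<^esub> v) = \<phi> u + \<phi> v"
  by (simp add: U_dual_def)

lemma U_dual_scale: "\<phi> \<in> U_dual L d \<Longrightarrow> u \<in> U_grade L d \<Longrightarrow> \<phi> (U_scale L c u) = c * \<phi> u"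
  by (simp add: U_dual_def)

lemma U_dual_zero: "\<phi> \<in> U_dual L d \<Longrightarrow> \<phi> \<zero>\<^bsub>U L\<^esub> = 0"
  using U_dual_scale[of \<phi> d "\<zero>\<^bsub>U L\<^esub>" 0] U_grade_zero by (simp add: U_scale_zero)

text \<open>A linear functional on the free algebra that vanishes on the defining ideal but not at a
  given element exists because the ideal is a complex subspace.\<close>

lemma U_dual_separates:
  assumes u: "u \<in> U_grade L d" and v: "v \<in> U_grade L d"
    and eq: "\<And>\<phi>. \<phi> \<in> U_dual L d \<Longrightarrow> \<phi> u = \<phi> v"
  shows "u = v"
proof (rule ccontr)
  assume "u \<noteq> v"
  obtain f g where f: "f \<in> homogeneous d" "u = U_class L f" and g: "g \<in> homogeneous d" "v = U_class L g"
    using u v by (auto simp: U_grade_eq)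
  have fg: "f - g \<notin> env_ideal L" using \<open>u \<noteq> v\<close> f g by (simp add: U_class_eq_iff)
  interpret vector_space_pair "\<lambda>c f. scalar c * (f :: 'a assoc)" "(*) :: complex \<Rightarrow> complex \<Rightarrow> complex"
    by unfold_locales (simp_all add: algebra_simps scalar_add scalar_mult scalar_1)
  have sub: "vs1.subspace (env_ideal L)"
    by (simp add: vs1.subspace_def env_ideal_closed zero_env_ideal)
  \<comment> \<open>A basis of the ideal remains independent after f - g, which lies outside the
    ideal, is added. A linear form can therefore be 1 at f - g and 0 on the whole ideal.\<close>
  obtain B where B: "B \<subseteq> env_ideal L" "vs1.independent B" "env_ideal L \<subseteq> vs1.span B"
    using vs1.basis_exists[of "env_ideal L"] by metis
  have span: "vs1.span B = env_ideal L"
    using B vs1.span_minimal[OF B(1) sub] by blast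
  then have "vs1.independent (insert (f - g) B)"
    using B(2) fg by (simp add: vs1.independent_insert)
  then obtain \<psi> where \<psi>: "Vector_Spaces.linear (\<lambda>c f. scalar c * f) (*) \<psi>"
     "\<And>x. x \<in> insert (f - g) B \<Longrightarrow> \<psi> x = (if x = f - g then 1 else 0)"
    using linear_independent_extend[of "insert (f - g) B" "\<lambda>x. if x = f - g then 1 else 0"] by blast
  interpret \<psi>: Vector_Spaces.linear "\<lambda>c f. scalar c * f" "(*)" \<psi> by (rule \<psi>(1))
  have "\<psi> x = 0" if "x \<in> vs1.span B" for x
    using that
  proof (induction rule: vs1.span_induct_alt)
    case (step c x y)
    have "\<psi> x = 0" using \<psi>(2)[of x] step B(1) fg by auto
    then show ?case using step by (simp add: \<psi>.add \<psi>.scale)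
  qed (rule \<psi>.zero)
  then have kernel: "\<psi> x = 0" if "x \<in> env_ideal L" for x using that span by simp
  \<comment> \<open>Since \<open>\<psi>\<close> kills the ideal, it descends to cosets and an
    arbitrary representative may be taken.\<close>
  define \<phi> where "\<phi> u = \<psi> (SOME f. f \<in> u)" for u
  have \<phi>: "\<phi> (U_class L h) = \<psi> h" for h
  proof -
    have "h \<in> U_class L h" using zero_env_ideal by (force simp: U_class_eq_image)
    then have "(SOME f. f \<in> U_class L h) \<in> U_class L h" by (rule someI)
    then show ?thesis using kernel by (auto simp: \<phi>_def U_class_eq_image \<psi>.add)
  qed
  have "\<phi> \<in> U_dual L d"
    unfolding U_dual_def U_grade_eq
    by (auto simp: \<phi> U_scale_class homogeneous_closed(1) \<psi>.add \<psi>.scale simp flip: U_class_add)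
  then have "\<psi> f = \<psi> g" using eq f g \<phi> by metis
  moreover have "\<psi> (f - g) = 1" using \<psi>(2) by simp
  ultimately show False by (simp add: \<psi>.diff)
qed

text \<open>This structure is what allows the finite sums in the definition of the connection to be
  unfolded.\<close>

lemma abelian_monoid_Uhat: "abelian_monoid (Uhat L)"
proof -
  interpret ring "U L" by (rule ring_U)
  have carr: "u d \<in> carrier (U L)" if "u \<in> carrier (Uhat L)" for u d
    using that U_grade_subset by (auto simp: Uhat_def)
  show ?thesis
  proof (rule abelian_monoidI)
    fix u v w assume u: "u \<in> carrier (Uhat L)" and v: "v \<in> carrier (Uhat L)" and w: "w \<in> carrier (Uhat L)"
    show "u \<oplus>\<^bsub>Uhat L\<^esub> v \<in> carrier (Uhat L)"
      using u v by (simp add: Uhat_def U_grade_add)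
    show "u \<oplus>\<^bsub>Uhat L\<^esub> v \<oplus>\<^bsub>Uhat L\<^esub> w = u \<oplus>\<^bsub>Uhat L\<^esub> (v \<oplus>\<^bsub>Uhat L\<^esub> w)"
      using carr[OF u] carr[OF v] carr[OF w] by (simp add: Uhat_def a_assoc)
    show "\<zero>\<^bsub>Uhat L\<^esub> \<oplus>\<^bsub>Uhat L\<^esub> u = u" using carr[OF u] by (simp add: Uhat_def)
    show "u \<oplus>\<^bsub>Uhat L\<^esub> v = v \<oplus>\<^bsub>Uhat L\<^esub> u"
      using carr[OF u] carr[OF v] by (simp add: Uhat_def a_comm)
  qed (simp add: Uhat_def U_grade_zero)
qed

lemma Uhat_closedD: "u \<in> carrier (Uhat L) \<Longrightarrow> u d \<in> U_grade L d"
  by (simp add: Uhat_def)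

lemma Uhat_scale_closed: "u \<in> carrier (Uhat L) \<Longrightarrow> Uhat_scale L c u \<in> carrier (Uhat L)"
  by (simp add: Uhat_def Uhat_scale_def U_grade_scale)

lemma Uhat_add: "(u \<oplus>\<^bsub>Uhat L\<^esub> v) d = u d \<oplus>\<^bsub>U L\<^esub> v d"
  by (simp add: Uhat_def)

lemma Uhat_finsum_closed:
  "(\<And>s. s \<in> S \<Longrightarrow> f s \<in> carrier (Uhat L)) \<Longrightarrow> finsum (Uhat L) f S \<in> carrier (Uhat L)"
  by (rule abelian_monoid.finsum_closed[OF abelian_monoid_Uhat]) auto

lemma U_dual_finsum:
  assumes \<phi>: "\<phi> \<in> U_dual L d" and S: "finite S" "\<And>s. s \<in> S \<Longrightarrow> f s \<in> carrier (Uhat L)"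
  shows "\<phi> (finsum (Uhat L) f S d) = (\<Sum>s\<in>S. \<phi> (f s d))"
  using S
proof (induction S)
  case empty
  interpret abelian_monoid "Uhat L" by (rule abelian_monoid_Uhat)
  have "\<zero>\<^bsub>Uhat L\<^esub> d = \<zero>\<^bsub>U L\<^esub>" by (simp add: Uhat_def)
  then show ?case by (simp add: U_dual_zero[OF \<phi>])
next
  case (insert s S)
  interpret abelian_monoid "Uhat L" by (rule abelian_monoid_Uhat)
  have "finsum (Uhat L) f (insert s S) = f s \<oplus>\<^bsub>Uhat L\<^esub> finsum (Uhat L) f S"
    using insert by (intro finsum_insert) auto
  then show ?case
    using insert Uhat_closedD[OF Uhat_finsum_closed, of S f d] Uhat_closedD[of "f s" d]
    by (simp add: Uhat_add U_dual_add[OF \<phi>])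
qed

lemma Uhat_mult_0:
  assumes "u \<in> carrier (Uhat L)" "v \<in> carrier (Uhat L)" "u 0 = \<zero>\<^bsub>U L\<^esub>"
  shows "(u \<otimes>\<^bsub>Uhat L\<^esub> v) 0 = \<zero>\<^bsub>U L\<^esub>"
proof -
  interpret ring "U L" by (rule ring_U)
  have "v 0 \<in> carrier (U L)" using Uhat_closedD[OF assms(2)] U_grade_subset by auto
  then show ?thesis using assms by (simp add: Uhat_def)
qed

text \<open>With u a value of the connection and v a value of \<open>F\<close>, the two terms of
  degree 1 are u_0 v_1 = 0 and u_1 v_0 = u_1: the differential equation loses its right
  factor.\<close>

lemma Uhat_mult_1:
  assumes "u \<in> carrier (Uhat L)" "v \<in> carrier (Uhat L)" "u 0 = \<zero>\<^bsub>U L\<^esub>" "v 0 = \<one>\<^bsub>U L\<^esub>"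
  shows "(u \<otimes>\<^bsub>Uhat L\<^esub> v) 1 = u 1"
proof -
  interpret ring "U L" by (rule ring_U)
  have carr: "u 1 \<in> carrier (U L)" "v 1 \<in> carrier (U L)"
    using Uhat_closedD[OF assms(1)] Uhat_closedD[OF assms(2)] U_grade_subset by auto
  have Pi: "(\<lambda>k. u k \<otimes>\<^bsub>U L\<^esub> v (1 - k)) \<in> {..Suc 0} \<rightarrow> carrier (U L)"
    using carr assms by (auto simp: le_Suc_eq)
  have "(u \<otimes>\<^bsub>Uhat L\<^esub> v) 1 = (\<Oplus>\<^bsub>U L\<^esub>k\<in>{..Suc 0}. u k \<otimes>\<^bsub>U L\<^esub> v (1 - k))"
    by (simp add: Uhat_def)
  also have "\<dots> = u 1"
    unfolding finsum_Suc[OF Pi] using assms(3,4) carr by simp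
  finally show ?thesis .
qed

end


text \<open>The point of substance is that the translate \<open>act g p\<close> of an exceptional
  point is again exceptional, so that the last two families of relators involve actual generators
  only.\<close>

lemma pn_relators_subset:
  fixes G :: "(complex^2^2) set set"
  assumes G: "subgroup G PSU2"
  shows "pn_relators G \<subseteq> free_na (pn_gens G :: 'n::finite gen set)"
proof
  have X2: "X2 i j g \<in> free_na (pn_gens G)" if "i \<noteq> j" "g \<in> G" for i j :: 'n and g
    using that by (intro free_na_gen) (auto simp: pn_gens_def)
  have X1: "X1 i p \<in> free_na (pn_gens G)" if "p \<notin> P1_star G" for i :: 'n and p
    using that by (intro free_na_gen) (auto simp: pn_gens_def)
  note act = act_P1_star_iff[OF G]
  note mult = subgroup.m_closed[OF G]
  have stab: "h \<in> G" if "h \<in> stab G p" for h p using that by (simp add: stabilizer_def)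
  note closed = free_na_add free_na_diff free_na_times free_na_sum X1 X2
  fix a :: "'n gen na" assume "a \<in> pn_relators G"
  then show "a \<in> free_na (pn_gens G)"
  proof cases
    case (symmetry i j g)
    then show ?thesis using subgroup.m_inv_closed[OF G] by (auto intro!: closed)
  next
    case (two_indices i j g p)
    then show ?thesis by (auto intro!: closed mult simp: act dest: stab)
  next
    case (two_indices_point i j g p)
    then show ?thesis by (auto intro!: closed mult simp: act dest: stab)
  qed (auto intro!: closed mult)
qed

text \<open>These generators are the residues of the i-th component of the connection; they also
  index its poles, through \<open>site\<close>.\<close>

definition gens_at :: "(complex^2^2) set set \<Rightarrow> 'n \<Rightarrow> 'n gen set" where
  "gens_at G i = XP i ` (- P1_star G) \<union> (\<lambda>(j, g). XX i j g) ` ((- {i}) \<times> G)"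

text \<open>Where the generator has its pole in the i-th variable. The first index of
  \<open>XX\<close> is that of the moving point and does not affect the position.\<close>

primrec site :: "P1^'n \<Rightarrow> 'n gen \<Rightarrow> P1" where
  "site q (XX i j g) = act g (q $ j)"
| "site q (XP i p) = p"

lemma gens_at_subset: "gens_at G i \<subseteq> pn_gens G"
  by (auto simp: gens_at_def pn_gens_def)

lemma sum_gens_at:
  fixes f :: "'n::finite gen \<Rightarrow> 'b::comm_monoid_add"
  assumes "finite G" "finite (- P1_star G)"
  shows "sum f (gens_at G i) = (\<Sum>p\<in>- P1_star G. f (XP i p)) + (\<Sum>j\<in>- {i}. \<Sum>g\<in>G. f (XX i j g))"
proof -
  have "sum f (gens_at G i) = sum f (XP i ` (- P1_star G)) + sum f ((\<lambda>(j, g). XX i j g) ` ((- {i}) \<times> G))"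
    unfolding gens_at_def using assms by (intro sum.union_disjoint) auto
  also have "sum f (XP i ` (- P1_star G)) = (\<Sum>p\<in>- P1_star G. f (XP i p))"
    by (subst sum.reindex) (auto simp: inj_on_def)
  also have "sum f ((\<lambda>(j, g). XX i j g) ` ((- {i}) \<times> G)) = (\<Sum>j\<in>- {i}. \<Sum>g\<in>G. f (XX i j g))"
    by (subst sum.reindex) (auto simp: inj_on_def sum.cartesian_product case_prod_unfold)
  finally show ?thesis .
qed

text \<open>The degree-1 component of \<open>X_hat\<close>, extended from generators to arbitrary
  elements so that additivity can be stated.\<close>

definition pn_class :: "(complex^2^2) set set \<Rightarrow> 'n::finite gen na \<Rightarrow> 'n gen na set assoc set" where
  "pn_class G a = U_class (pn G) (letter (na_coset (lie_ideal (pn_gens G) (pn_relators G)) a))"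

context
  fixes G :: "(complex^2^2) set set"
  assumes G: "subgroup G PSU2" "finite G"
begin

lemma closed_graded_lie_pn: "closed_graded_lie (pn G :: 'n::finite gen na set graded_lie)"
  unfolding pn_def by (rule closed_presented_lie[OF pn_relators_subset[OF G(1)]])

lemma finite_gens_at: "finite (gens_at G (i :: 'n::finite))"
  using G finite_not_P1_star[OF G] by (simp add: gens_at_def)

lemma pn_ideal: "na_ideal (pn_gens G :: 'n::finite gen set) (lie_ideal (pn_gens G) (pn_relators G))"
  by (rule na_ideal_lie_ideal[OF pn_relators_subset[OF G(1)]])

lemma pn_class_add:
  fixes a b :: "'n::finite gen na"
  assumes "a \<in> free_na (pn_gens G)" "b \<in> free_na (pn_gens G)"
  shows "pn_class G (a + b) = pn_class G a \<oplus>\<^bsub>U (pn G)\<^esub> pn_class G b"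
proof -
  let ?L = "pn G :: 'n gen na set graded_lie"
  interpret closed_graded_lie ?L by (rule closed_graded_lie_pn)
  let ?I = "lie_ideal (pn_gens G) (pn_relators G) :: 'n gen na set"
  have ab: "na_coset ?I a \<in> carrier ?L" "na_coset ?I b \<in> carrier ?L"
    using assms by (auto simp: pn_def presented_lie_def Let_def)
  have sum: "lie_add ?L (na_coset ?I a) (na_coset ?I b) = na_coset ?I (a + b)"
    by (simp add: pn_def presented_lie_def Let_def na_coset_add[OF pn_ideal])
  have "letter (lie_add ?L (na_coset ?I a) (na_coset ?I b)) - letter (na_coset ?I a) - letter (na_coset ?I b)
      \<in> env_relators ?L"
    using ab unfolding env_relators_def by blast
  moreover have "env_relators ?L \<subseteq> env_ideal ?L"
    unfolding env_ideal_def by (rule ring.genideal_self[OF ring_free_assoc env_relators_closed])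
  ultimately have "letter (na_coset ?I (a + b)) - (letter (na_coset ?I a) + letter (na_coset ?I b)) \<in> env_ideal ?L"
    unfolding sum diff_diff_eq by blast
  then have "pn_class G (a + b) = U_class ?L (letter (na_coset ?I a) + letter (na_coset ?I b))"
    unfolding pn_class_def U_class_eq_iff .
  also have "\<dots> = pn_class G a \<oplus>\<^bsub>U ?L\<^esub> pn_class G b"
    unfolding pn_class_def using ab by (intro U_class_add single_letter_closed)
  finally show ?thesis .
qed

lemma pn_class_grade:
  fixes a :: "'n::finite gen na"
  assumes "a \<in> free_na (pn_gens G)" "\<And>t. t \<in> Poly_Mapping.keys a \<Longrightarrow> leaf_count t = 1"
  shows "pn_class G a \<in> U_grade (pn G) 1"
proof -
  let ?L = "pn G :: 'n gen na set graded_lie"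
  interpret closed_graded_lie ?L by (rule closed_graded_lie_pn)
  let ?I = "lie_ideal (pn_gens G) (pn_relators G) :: 'n gen na set"
  have "na_coset ?I a \<in> carrier ?L" "na_coset ?I a \<in> lie_grade ?L 1"
    using assms by (auto simp: pn_def presented_lie_def Let_def)
  then show ?thesis unfolding pn_class_def U_grade_eq by (intro imageI letter_homogeneous)
qed

lemma leaf_count_sum_gens:
  "t \<in> Poly_Mapping.keys (\<Sum>x\<in>S. na_gen x) \<Longrightarrow> leaf_count t = 1"
proof (induction S rule: infinite_finite_induct)
  case (insert x S)
  then show ?case using Poly_Mapping.keys_add[of "na_gen x" "sum na_gen S"] by (auto simp: na_gen_def split: if_splits)
qed auto

lemma U_dual_pn_class_sum:
  fixes S :: "'n::finite gen set"
  assumes \<phi>: "\<phi> \<in> U_dual (pn G) 1" and S: "finite S" "S \<subseteq> pn_gens G"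
  shows "\<phi> (pn_class G (\<Sum>x\<in>S. na_gen x)) = (\<Sum>x\<in>S. \<phi> (pn_class G (na_gen x)))"
  using S
proof (induction S)
  case empty
  interpret closed_graded_lie "pn G :: 'n gen na set graded_lie" by (rule closed_graded_lie_pn)
  have "pn_class G (0 :: 'n gen na) \<in> U_grade (pn G) 1"
    by (rule pn_class_grade) (auto simp: free_na_zero)
  \<comment> \<open>Additivity alone gives the value 0 at the class of 0.\<close>
  then have "\<phi> (pn_class G (0 + 0)) = \<phi> (pn_class G 0) + \<phi> (pn_class G 0)"
    using U_dual_add[OF \<phi>] pn_class_add[OF free_na_zero free_na_zero] by metis
  then show ?case by simp
next
  case (insert x S)
  interpret closed_graded_lie "pn G :: 'n gen na set graded_lie" by (rule closed_graded_lie_pn)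
  have free: "na_gen x \<in> free_na (pn_gens G)" "(\<Sum>x\<in>S. na_gen x) \<in> free_na (pn_gens G)"
    using insert by (auto intro!: free_na_gen free_na_sum)
  have grade: "pn_class G (na_gen x) \<in> U_grade (pn G) 1" "pn_class G (\<Sum>x\<in>S. na_gen x) \<in> U_grade (pn G) 1"
    by (rule pn_class_grade[OF free(1)], simp add: na_gen_def)
      (rule pn_class_grade[OF free(2)], erule leaf_count_sum_gens)
  have "\<phi> (pn_class G (na_gen x + (\<Sum>x\<in>S. na_gen x))) = \<phi> (pn_class G (na_gen x)) + \<phi> (pn_class G (\<Sum>x\<in>S. na_gen x))"
    by (simp only: pn_class_add[OF free] U_dual_add[OF \<phi> grade])
  then show ?case using insert by simp
qed

lemma X_hat_eq: "X_hat G x d = (if d = 1 then pn_class G (na_gen x) else \<zero>\<^bsub>U (pn G)\<^esub>)"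
  by (simp add: X_hat_def pn_class_def)

lemma X_hat_closed:
  fixes x :: "'n::finite gen"
  assumes "x \<in> pn_gens G"
  shows "X_hat G x \<in> carrier (Uhat (pn G))"
proof -
  interpret closed_graded_lie "pn G :: 'n gen na set graded_lie" by (rule closed_graded_lie_pn)
  have "pn_class G (na_gen x) \<in> U_grade (pn G) 1"
    by (rule pn_class_grade[OF free_na_gen[OF assms]]) (simp add: na_gen_def)
  then show ?thesis by (simp add: Uhat_def X_hat_eq U_grade_zero)
qed

text \<open>The relator \<open>sphere\<close> for i is the sum of all generators in
  \<open>gens_at G i\<close>, so it says that the residues in the i-th variable cancel.\<close>

lemma U_dual_sphere:
  fixes i :: "'n::finite"
  assumes \<phi>: "\<phi> \<in> U_dual (pn G) 1"
  shows "(\<Sum>x\<in>gens_at G i. \<phi> (X_hat G x 1)) = 0"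
proof -
  interpret closed_graded_lie "pn G :: 'n gen na set graded_lie" by (rule closed_graded_lie_pn)
  have "(\<Sum>x\<in>gens_at G i. na_gen x) \<in> pn_relators G"
    using pn_relators.sphere[where G = G and i = i] by (simp add: sum_gens_at[OF G(2) finite_not_P1_star[OF G]])
  then have "(\<Sum>x\<in>gens_at G i. na_gen x) \<in> lie_ideal (pn_gens G) (pn_relators G)"
    using relators_subset_lie_ideal by blast
  then have "pn_class G (\<Sum>x\<in>gens_at G i. na_gen x) = pn_class G 0"
    unfolding pn_class_def using na_coset_eq_iff[OF pn_ideal, of "\<Sum>x\<in>gens_at G i. na_gen x" 0] by simp
  then have "(\<Sum>x\<in>gens_at G i. \<phi> (pn_class G (na_gen x))) = \<phi> (pn_class G 0)"
    using U_dual_pn_class_sum[OF \<phi> finite_gens_at gens_at_subset] by metis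
  also have "\<dots> = 0" using U_dual_pn_class_sum[OF \<phi>, of "{}"] by simp
  finally show ?thesis by (simp add: X_hat_eq)
qed

end


section \<open>The connection form\<close>

definition upd :: "'a^'n \<Rightarrow> 'n \<Rightarrow> 'a \<Rightarrow> 'a^'n" where
  "upd q i y = (\<chi> k. if k = i then y else q $ k)"

lemma upd_nth [simp]: "upd q i y $ k = (if k = i then y else q $ k)"
  by (simp add: upd_def)

lemma sites_eq: "site q ` gens_at G i = (- P1_star G) \<union> {act g (q $ j) | j g. j \<noteq> i \<and> g \<in> G}"
  by (force simp: gens_at_def image_Un image_iff)

lemma gens_at_iff:
  "XP j p \<in> gens_at G i \<longleftrightarrow> j = i \<and> p \<notin> P1_star G"
  "XX k j g \<in> gens_at G i \<longleftrightarrow> k = i \<and> j \<noteq> i \<and> g \<in> G"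
  by (auto simp: gens_at_def)

lemma site_upd: "x \<in> gens_at G i \<Longrightarrow> site (upd q i y) x = site q x"
  by (auto simp: gens_at_def split: if_splits)

lemma Cf_star: "q \<in> Cf G \<Longrightarrow> q $ k \<in> P1_star G"
  by (simp add: Cf_def)

lemma Cf_neq: "q \<in> Cf G \<Longrightarrow> k \<noteq> j \<Longrightarrow> g \<in> G \<Longrightarrow> q $ k \<noteq> act g (q $ j)"
  by (simp add: Cf_def)

text \<open>The fibre of the configuration space in the i-th direction is the sphere minus the
  poles. The conditions in which the moving point is the translated one reduce to the others by
  inverting g.\<close>

lemma Cf_upd_iff:
  assumes G: "subgroup G PSU2" and q: "q \<in> Cf G"
  shows "upd q i y \<in> Cf G \<longleftrightarrow> y \<notin> site q ` gens_at G i"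
proof
  assume upd: "upd q i y \<in> Cf G"
  show "y \<notin> site q ` gens_at G i"
  proof
    assume "y \<in> site q ` gens_at G i"
    then consider "y \<notin> P1_star G" | j g where "j \<noteq> i" "g \<in> G" "y = act g (q $ j)"
      unfolding sites_eq by blast
    then show False
    proof cases
      case 1
      then show ?thesis using Cf_star[OF upd, of i] by simp
    next
      case (2 j g)
      then show ?thesis using Cf_neq[OF upd, of i j g] by simp
    qed
  qed
next
  assume y: "y \<notin> site q ` gens_at G i"
  have *: "q $ k \<noteq> act g y" if "g \<in> G" "k \<noteq> i" for g k
  proof
    assume eq: "q $ k = act g y"
    have "g \<in> carrier PSU2" using that G subgroup.subset by blast
    then have "y = act (inv\<^bsub>PSU2\<^esub> g) (q $ k)" by (simp add: eq act_inv)
    moreover have "inv\<^bsub>PSU2\<^esub> g \<in> G" using subgroup.m_inv_closed[OF G] that by blast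
    ultimately show False using y that unfolding sites_eq by blast
  qed
  have "y \<in> P1_star G" "\<And>g j. g \<in> G \<Longrightarrow> j \<noteq> i \<Longrightarrow> y \<noteq> act g (q $ j)"
    using y unfolding sites_eq by blast+
  then show "upd q i y \<in> Cf G" using q * by (auto simp: Cf_def)
qed

lemma Cf_finite_singular:
  fixes q :: "P1^'n::finite"
  assumes G: "subgroup G PSU2" "finite G" and f: "inj f"
  shows "finite {w. f w \<in> site q ` gens_at G i}"
  using finite_vimageI[OF finite_imageI[OF finite_gens_at[OF G]] f, of "site q" i]
  by (simp add: vimage_def)

text \<open>The identity of G already forbids equal coordinates. As a consequence a single
  coordinate at most has to be moved away from infinity.\<close>

lemma Cf_at_most_one_Infty:
  assumes G: "subgroup G PSU2" and q: "q \<in> Cf G" and "q $ j = Infty" "q $ k = Infty"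
  shows "j = k"
proof (rule ccontr)
  assume "j \<noteq> k"
  then have "q $ j \<noteq> act \<one>\<^bsub>PSU2\<^esub> (q $ k)" using Cf_neq[OF q] subgroup.one_closed[OF G] by blast
  then show False using assms by (simp add: act_one)
qed

lemma inj_chart: "inj (chart b)"
  by (auto simp: inj_def chart_def split: if_splits)

lemma inj_from_coord: "inj (from_coord b)"
  by (metis coord_away_from_coord injI)

lemma is_connection_form_dual_affine:
  fixes \<omega> :: "('n::finite \<Rightarrow> bool) \<Rightarrow> complex^'n \<Rightarrow> 'n \<Rightarrow> 'n Upn_hat"
  assumes G: "subgroup G PSU2" "finite G" and \<omega>: "is_connection_form G \<omega>"
    and z: "vchart (\<lambda>_. False) z \<in> Cf G" and \<phi>: "\<phi> \<in> U_dual (pn G) d"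
  shows "\<phi> (\<omega> (\<lambda>_. False) z i d) =
    (\<Sum>x\<in>gens_at G i. simple_pole (z $ i) (site (vchart (\<lambda>_. False) z) x) * \<phi> (X_hat G x d))"
proof -
  interpret closed_graded_lie "pn G :: 'n gen na set graded_lie" by (rule closed_graded_lie_pn[OF G])
  have fin: "finite (- P1_star G)" by (rule finite_not_P1_star[OF G])
  have closed: "Uhat_scale (pn G) c (X_hat G x) \<in> carrier (Uhat (pn G))" if "x \<in> gens_at G i" for c x
    by (intro Uhat_scale_closed X_hat_closed[OF G] subsetD[OF gens_at_subset that])
  have closed1: "Uhat_scale (pn G) c (X_hat G (XP i p)) \<in> carrier (Uhat (pn G))" if "p \<in> - P1_star G" for c p
    using that by (intro closed) (simp add: gens_at_def)
  have closed2: "Uhat_scale (pn G) c (X_hat G (XX i j g)) \<in> carrier (Uhat (pn G))" if "j \<in> - {i}" "g \<in> G" for c j g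
    using that by (intro closed) (auto simp: gens_at_def)
  have scale: "\<phi> (Uhat_scale (pn G) c (X_hat G x) d) = c * \<phi> (X_hat G x d)" if "x \<in> gens_at G i" for c x
    unfolding Uhat_scale_def
    by (intro U_dual_scale[OF \<phi>] Uhat_closedD X_hat_closed[OF G] subsetD[OF gens_at_subset that])
  let ?A = "\<lambda>p. Uhat_scale (pn G) (simple_pole (z $ i) p) (X_hat G (XP i p))"
  let ?B = "\<lambda>j g. Uhat_scale (pn G) (simple_pole (z $ i) (act g (Aff (z $ j)))) (X_hat G (XX i j g))"
  let ?H = "Uhat (pn G :: 'n gen na set graded_lie)"
  have A: "finsum ?H ?A (- P1_star G) \<in> carrier ?H"
    using closed1 by (intro Uhat_finsum_closed)
  have B: "finsum ?H (?B j) G \<in> carrier ?H" if "j \<in> - {i}" for j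
    using closed2[OF that] by (intro Uhat_finsum_closed)
  have BB: "finsum ?H (\<lambda>j. finsum ?H (?B j) G) (- {i}) \<in> carrier ?H"
    by (rule Uhat_finsum_closed[OF B])
  have "\<omega> (\<lambda>_. False) z i = finsum ?H ?A (- P1_star G) \<oplus>\<^bsub>?H\<^esub> finsum ?H (\<lambda>j. finsum ?H (?B j) G) (- {i})"
    using \<omega> z unfolding is_connection_form_def by blast
  then have "\<phi> (\<omega> (\<lambda>_. False) z i d) = \<phi> (finsum ?H ?A (- P1_star G) d) + \<phi> (finsum ?H (\<lambda>j. finsum ?H (?B j) G) (- {i}) d)"
    using A BB by (simp add: Uhat_add U_dual_add[OF \<phi>] Uhat_closedD)
  also have "\<phi> (finsum ?H ?A (- P1_star G) d) = (\<Sum>p\<in>- P1_star G. \<phi> (?A p d))"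
    using fin closed1 by (intro U_dual_finsum[OF \<phi>])
  also have "\<phi> (finsum ?H (\<lambda>j. finsum ?H (?B j) G) (- {i}) d) = (\<Sum>j\<in>- {i}. \<phi> (finsum ?H (?B j) G d))"
    using B by (intro U_dual_finsum[OF \<phi>]) auto
  also have "\<dots> = (\<Sum>j\<in>- {i}. \<Sum>g\<in>G. \<phi> (?B j g d))"
    using G(2) by (intro sum.cong refl U_dual_finsum[OF \<phi>] closed2)
  also have "(\<Sum>p\<in>- P1_star G. \<phi> (?A p d)) + (\<Sum>j\<in>- {i}. \<Sum>g\<in>G. \<phi> (?B j g d)) =
     (\<Sum>x\<in>gens_at G i. simple_pole (z $ i) (site (vchart (\<lambda>_. False) z) x) * \<phi> (X_hat G x d))"
    unfolding sum_gens_at[OF G(2) fin]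
    by (intro arg_cong2[of _ _ _ _ "(+)"] sum.cong refl)
      (auto simp: scale gens_at_iff vchart_def chart_def)
  finally show ?thesis .
qed

text \<open>Where another point is at infinity, the coefficient of \<open>dz\<^sub>i\<close> is the limit of its values
  at affine configurations.\<close>

lemma is_connection_form_dual:
  fixes \<omega> :: "('n::finite \<Rightarrow> bool) \<Rightarrow> complex^'n \<Rightarrow> 'n \<Rightarrow> 'n Upn_hat"
  assumes G: "subgroup G PSU2" "finite G" and \<omega>: "is_connection_form G \<omega>"
    and t: "vchart \<sigma> t \<in> Cf G" and \<phi>: "\<phi> \<in> U_dual (pn G) d"
    and \<sigma>: "\<not> \<sigma> i" "\<And>k. \<sigma> k \<Longrightarrow> t $ k = 0"
  shows "\<phi> (\<omega> \<sigma> t i d) =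
    (\<Sum>x\<in>gens_at G i. simple_pole (t $ i) (site (vchart \<sigma> t) x) * \<phi> (X_hat G x d))"
proof (cases "\<exists>j. \<sigma> j")
  case False
  then have "\<sigma> = (\<lambda>_. False)" by auto
  then show ?thesis using is_connection_form_dual_affine[OF G \<omega> _ \<phi>] t by simp
next
  case True
  interpret closed_graded_lie "pn G :: 'n gen na set graded_lie" by (rule closed_graded_lie_pn[OF G])
  obtain j where j: "\<sigma> j" using True by blast
  have ij: "i \<noteq> j" using j \<sigma> by auto
  have Infty: "vchart \<sigma> t $ k = Infty" if "\<sigma> k" for k
    using that \<sigma> by (simp add: vchart_def chart_def)
  have \<sigma>_iff: "\<sigma> k \<longleftrightarrow> k = j" for k
    using Cf_at_most_one_Infty[OF G(1) t] Infty j by blast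
  \<comment> \<open>The j-th point is moved off infinity: \<open>u\<close> describes the perturbed
    configuration in the given chart, \<open>z\<close> the same configuration in affine
    coordinates.\<close>
  define u where "u \<epsilon> = upd t j \<epsilon>" for \<epsilon>
  define z where "z \<epsilon> = upd t j (1 / \<epsilon>)" for \<epsilon>
  have chart_u: "vchart \<sigma> (u \<epsilon>) = upd (vchart \<sigma> t) j (chart True \<epsilon>)" for \<epsilon>
    using j by (auto simp: vec_eq_iff vchart_def u_def)
  have u0: "u 0 = t" using \<sigma>(2)[OF j] by (auto simp: vec_eq_iff u_def)
  have chart_z: "vchart (\<lambda>_. False) (z \<epsilon>) = vchart \<sigma> (u \<epsilon>)" if "\<epsilon> \<noteq> 0" for \<epsilon>
    using that \<sigma>_iff by (auto simp: vec_eq_iff vchart_def u_def z_def chart_def)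
  \<comment> \<open>Parameters for which the moved point collides with a forbidden position; small
    nonzero \<epsilon> avoid this finite set.\<close>
  define S where "S = {\<epsilon>. chart True \<epsilon> \<in> site (vchart \<sigma> t) ` gens_at G j}"
  have "finite S" unfolding S_def by (rule Cf_finite_singular[OF G inj_chart])
  then have "open (- (S - {0}))" by (intro open_Compl finite_imp_closed) auto
  then have ev: "eventually (\<lambda>\<epsilon>. \<epsilon> \<noteq> 0 \<and> \<epsilon> \<notin> S) (at 0)"
    using eventually_at_in_open[of "- (S - {0})" 0] by (auto elim!: eventually_mono)
  have hol: "holomorphic_form G \<omega>" using \<omega> by (simp add: is_connection_form_def)
  then have hol_closed: "vchart \<sigma> t \<in> Cf G \<Longrightarrow> \<omega> \<sigma> t i \<in> carrier (Uhat (pn G))"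
    and hol_change: "vchart \<sigma> s \<in> Cf G \<and> vchart \<sigma> s = vchart \<tau> t \<Longrightarrow>
        \<omega> \<sigma> s i = Uhat_scale (pn G) (if \<sigma> i = \<tau> i then 1 else - 1 / (s $ i)\<^sup>2) (\<omega> \<tau> t i)"
    for \<sigma> \<tau> s t i
    unfolding holomorphic_form_def by blast+
  have "\<exists>c::complex^'n. ((\<lambda>u. \<phi> (\<omega> \<sigma> u i d)) has_derivative (\<lambda>v. \<Sum>k\<in>UNIV. c $ k * v $ k)) (at t)"
    using hol t \<phi> unfolding holomorphic_form_def by blast
  then have "isCont (\<lambda>u. \<phi> (\<omega> \<sigma> u i d)) (u 0)"
    unfolding u0 using has_derivative_continuous by blast
  moreover have "continuous_on UNIV u"
    unfolding u_def upd_def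
  proof (rule continuous_on_vec_lambda)
    show "continuous_on UNIV (\<lambda>\<epsilon>. if k = j then \<epsilon> else t $ k)" for k
      by (cases "k = j") (auto intro: continuous_intros)
  qed
  then have "isCont u 0" by (simp add: continuous_on_eq_continuous_at)
  ultimately have "isCont (\<lambda>\<epsilon>. \<phi> (\<omega> \<sigma> (u \<epsilon>) i d)) 0"
    by (rule isCont_o2[rotated])
  then have lim1: "((\<lambda>\<epsilon>. \<phi> (\<omega> \<sigma> (u \<epsilon>) i d)) \<longlongrightarrow> \<phi> (\<omega> \<sigma> t i d)) (at 0)"
    by (simp add: isCont_def u0)
  have val: "\<phi> (\<omega> \<sigma> (u \<epsilon>) i d) = (\<Sum>x\<in>gens_at G i. simple_pole (t $ i)
      (site (upd (vchart \<sigma> t) j (Aff (1 / \<epsilon>))) x) * \<phi> (X_hat G x d))" if "\<epsilon> \<noteq> 0" "\<epsilon> \<notin> S" for \<epsilon>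
  proof -
    have Cf: "vchart \<sigma> (u \<epsilon>) \<in> Cf G"
      unfolding chart_u Cf_upd_iff[OF G(1) t] using that by (simp add: S_def)
    \<comment> \<open>The two charts differ only in the j-th coordinate, so the coefficient of dt_i
      is multiplied by 1.\<close>
    have "\<omega> \<sigma> (u \<epsilon>) i = Uhat_scale (pn G) 1 (\<omega> (\<lambda>_. False) (z \<epsilon>) i)"
      using hol_change[of \<sigma> "u \<epsilon>" "\<lambda>_. False" "z \<epsilon>" i] Cf chart_z[OF that(1)] \<sigma>(1) by simp
    moreover have "\<omega> (\<lambda>_. False) (z \<epsilon>) i \<in> carrier (Uhat (pn G))"
      using hol_closed[of "\<lambda>_. False" "z \<epsilon>" i] Cf chart_z[OF that(1)] by simp
    ultimately have "\<phi> (\<omega> \<sigma> (u \<epsilon>) i d) = \<phi> (\<omega> (\<lambda>_. False) (z \<epsilon>) i d)"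
      by (simp add: Uhat_scale_def U_dual_scale[OF \<phi>] Uhat_closedD)
    also have "\<dots> = (\<Sum>x\<in>gens_at G i. simple_pole (z \<epsilon> $ i) (site (vchart (\<lambda>_. False) (z \<epsilon>)) x) * \<phi> (X_hat G x d))"
      using Cf chart_z[OF that(1)] by (intro is_connection_form_dual_affine[OF G \<omega> _ \<phi>]) simp
    finally have "\<phi> (\<omega> \<sigma> (u \<epsilon>) i d) = (\<Sum>x\<in>gens_at G i. simple_pole (t $ i)
      (site (upd (vchart \<sigma> t) j (chart True \<epsilon>)) x) * \<phi> (X_hat G x d))"
      using that ij by (simp add: chart_z chart_u) (simp add: z_def)
    then show ?thesis using that(1) by (simp add: chart_def)
  qed
  have lim2: "((\<lambda>\<epsilon>. \<Sum>x\<in>gens_at G i. simple_pole (t $ i) (site (upd (vchart \<sigma> t) j (Aff (1 / \<epsilon>))) x) * \<phi> (X_hat G x d)) \<longlongrightarrow>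
     (\<Sum>x\<in>gens_at G i. simple_pole (t $ i) (site (vchart \<sigma> t) x) * \<phi> (X_hat G x d))) (at 0)"
  proof (intro tendsto_sum tendsto_mult_right)
    fix x assume x: "x \<in> gens_at G i"
    show "((\<lambda>\<epsilon>. simple_pole (t $ i) (site (upd (vchart \<sigma> t) j (Aff (1 / \<epsilon>))) x)) \<longlongrightarrow>
       simple_pole (t $ i) (site (vchart \<sigma> t) x)) (at 0)"
    \<comment> \<open>Only these generators have a pole that moves with the j-th point; membership
      in \<open>Cf G\<close> keeps the limit position away from z_i.\<close>
    proof (cases "\<exists>g\<in>G. x = XX i j g")
      case True
      then obtain g where g: "g \<in> G" "x = XX i j g" by blast
      have "vchart \<sigma> t $ i \<noteq> act g (vchart \<sigma> t $ j)"
        by (rule Cf_neq[OF t ij g(1)])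
      then have "act g Infty \<noteq> Aff (t $ i)"
        unfolding Infty[OF j] using \<sigma>(1) by (auto simp: vchart_def chart_def)
      moreover have "g \<in> carrier PSU2" using g subgroup.subset[OF G(1)] by blast
      ultimately show ?thesis
        using simple_pole_act_tendsto[of g "t $ i"] by (simp add: g Infty[OF j])
    next
      case False
      then have "site (upd (vchart \<sigma> t) j y) x = site (vchart \<sigma> t) x" for y
        using x by (auto simp: gens_at_def)
      then show ?thesis by simp
    qed
  qed
  have "((\<lambda>\<epsilon>. \<phi> (\<omega> \<sigma> (u \<epsilon>) i d)) \<longlongrightarrow>
     (\<Sum>x\<in>gens_at G i. simple_pole (t $ i) (site (vchart \<sigma> t) x) * \<phi> (X_hat G x d))) (at 0)"
    using lim2 by (rule Lim_transform_eventually) (use ev in eventually_elim, simp add: val)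
  then show ?thesis using lim1 by (rule LIM_unique[rotated])
qed


section \<open>Horizontal sections\<close>

lemma has_derivative_upd:
  fixes a :: "complex^'n::finite"
  assumes "(f has_field_derivative f') (at w)"
  shows "((\<lambda>w. upd a i (f w)) has_derivative (\<lambda>x. axis i (f' * x))) (at w)"
proof -
  have "linear (axis i :: complex \<Rightarrow> complex^'n)"
    by (rule linearI) (auto simp: vec_eq_iff axis_def)
  then have lin: "bounded_linear (axis i :: complex \<Rightarrow> complex^'n)"
    by (simp add: linear_conv_bounded_linear)
  have "((\<lambda>w. upd a i 0 + axis i (f w)) has_derivative (\<lambda>x. axis i (f' * x))) (at w)"
    using assms unfolding has_field_derivative_def
    by (intro has_derivative_add_const has_derivative_eq_rhs[OF has_derivative_add[OF has_derivative_const
          bounded_linear.has_derivative[OF lin]]]) auto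
  moreover have "(\<lambda>w. upd a i 0 + axis i (f w)) = (\<lambda>w. upd a i (f w))"
    by (auto simp: vec_eq_iff axis_def fun_eq_iff)
  ultimately show ?thesis by simp
qed

primrec affine_coord :: "P1 \<Rightarrow> complex" where
  "affine_coord (Aff z) = z"
| "affine_coord Infty = 0"

lemma chart_affine_coord: "chart (x = Infty) (affine_coord x) = x"
  by (cases x) (auto simp: chart_def)

lemma infinite_open_P1:
  fixes D :: "P1 set"
  assumes "open D" "D \<noteq> {}"
  shows "infinite D"
proof
  assume "finite D"
  obtain x where x: "x \<in> D" using assms by blast
  define V where "V = chart (x = Infty) -` D"
  have "affine_coord x \<in> V" using x by (simp add: V_def chart_affine_coord)
  moreover have "open V" using assms(1) by (simp add: open_P1_def V_def)
  moreover have "finite V" unfolding V_def using \<open>finite D\<close> inj_chart by (rule finite_vimageI)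
  ultimately show False using finite_imp_not_open by blast
qed

locale flat_section =
  fixes G :: "(complex^2^2) set set"
    and q :: "P1^'n::finite"
    and C :: "'c::topological_space set"
    and r :: "'c \<Rightarrow> P1^'n"
    and y0 :: 'c
    and \<omega> :: "('n \<Rightarrow> bool) \<Rightarrow> complex^'n \<Rightarrow> 'n \<Rightarrow> 'n Upn_hat"
    and F :: "'c \<Rightarrow> 'n Upn_hat"
  assumes G: "subgroup G PSU2" "finite G"
    and q: "q \<in> Cf G"
    and cov: "covering_space C r (Cf G)"
    and y0: "y0 \<in> C" "r y0 = q"
    and \<omega>: "is_connection_form G \<omega>"
    and F: "horizontal G \<omega> C r F" and F0: "F y0 = \<one>\<^bsub>Uhat (pn G)\<^esub>"
begin

abbreviation L :: "'n gen na set graded_lie" where "L \<equiv> pn G"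

sublocale closed_graded_lie L by (rule closed_graded_lie_pn[OF G])

lemma F_closed: "y \<in> C \<Longrightarrow> F y \<in> carrier (Uhat L)"
  using F unfolding horizontal_def by blast

lemma \<omega>_closed: "vchart \<sigma> t \<in> Cf G \<Longrightarrow> \<omega> \<sigma> t i \<in> carrier (Uhat L)"
  using \<omega> unfolding is_connection_form_def holomorphic_form_def by blast

lemma horizontalD:
  assumes "openin (top_of_set C) W" "openin (top_of_set (Cf G)) (r ` W)" "homeomorphism W (r ` W) r s"
    "y \<in> W" "vchart \<sigma> t = r y" "\<phi> \<in> U_dual L d"
  shows "((\<lambda>u. \<phi> (F (s (vchart \<sigma> u)) d)) has_derivative
     (\<lambda>v. \<Sum>i\<in>UNIV. v $ i * \<phi> ((\<omega> \<sigma> t i \<otimes>\<^bsub>Uhat L\<^esub> F y) d))) (at t)"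
  using F assms unfolding horizontal_def by blast

text \<open>All generators have degree 1, so every linear form on degree 0 vanishes on the explicit
  formula.\<close>

lemma \<omega>_0:
  assumes "vchart \<sigma> t \<in> Cf G" "\<not> \<sigma> i" "\<And>k. \<sigma> k \<Longrightarrow> t $ k = 0"
  shows "\<omega> \<sigma> t i 0 = \<zero>\<^bsub>U L\<^esub>"
proof (rule U_dual_separates)
  show "\<omega> \<sigma> t i 0 \<in> U_grade L 0" using \<omega>_closed[OF assms(1)] by (rule Uhat_closedD)
  fix \<phi> assume \<phi>: "\<phi> \<in> U_dual L 0"
  then show "\<phi> (\<omega> \<sigma> t i 0) = \<phi> \<zero>\<^bsub>U L\<^esub>"
    by (simp add: is_connection_form_dual[OF G \<omega> assms(1) \<phi> assms(2,3)] X_hat_eq[OF G] U_dual_zero[OF \<phi>])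
qed (rule U_grade_zero)

section \<open>One sheet of the covering over the line described by the i-th point\<close>

context
  fixes i :: 'n and b :: complex and W s
  assumes W: "openin (top_of_set C) W" "openin (top_of_set (Cf G)) (r ` W)" "homeomorphism W (r ` W) r s"
    and b: "Aff b \<notin> site q ` gens_at G i"
begin

text \<open>Together with \<open>sheet_point\<close> this turns \<open>F\<close> on the sheet into a
  function of the single complex variable w.\<close>

definition sheet_coords :: "complex set" where
  "sheet_coords = {w. upd q i (from_coord b w) \<in> r ` W}"

definition sheet_point :: "complex \<Rightarrow> 'c" where
  "sheet_point w = s (upd q i (from_coord b w))"

lemma sheet_point: 
  assumes "w \<in> sheet_coords"
  shows "sheet_point w \<in> W" "r (sheet_point w) = upd q i (from_coord b w)"
    "upd q i (from_coord b w) \<in> Cf G" "sheet_point w \<in> C"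
proof -
  show 1: "sheet_point w \<in> W" "r (sheet_point w) = upd q i (from_coord b w)"
    using assms homeomorphism_image2[OF W(3)] homeomorphism_apply2[OF W(3)]
    by (auto simp: sheet_coords_def sheet_point_def)
  show "upd q i (from_coord b w) \<in> Cf G"
    using assms openin_imp_subset[OF W(2)] by (auto simp: sheet_coords_def)
  show "sheet_point w \<in> C" using 1 openin_imp_subset[OF W(1)] by auto
qed

text \<open>The image of the sheet is open only relative to \<open>Cf G\<close>; the slice of
  \<open>Cf G\<close> is itself open because it omits finitely many w.\<close>

lemma open_sheet_coords: "open sheet_coords"
proof -
  obtain O' where O: "open O'" "r ` W = Cf G \<inter> O'" using W(2) unfolding openin_open by blast
  have "continuous_on UNIV (\<lambda>w. upd q i (from_coord b w))"
    unfolding upd_def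
  proof (rule continuous_on_vec_lambda)
    show "continuous_on UNIV (\<lambda>w. if k = i then from_coord b w else q $ k)" for k
      by (cases "k = i") (auto intro: continuous_from_coord)
  qed
  then have "open ((\<lambda>w. upd q i (from_coord b w)) -` O')"
    using O(1) by (rule open_vimage[rotated])
  moreover have "open (- {w. from_coord b w \<in> site q ` gens_at G i})"
    by (intro open_Compl finite_imp_closed Cf_finite_singular[OF G inj_from_coord])
  moreover have "sheet_coords = (\<lambda>w. upd q i (from_coord b w)) -` O' \<inter> - {w. from_coord b w \<in> site q ` gens_at G i}"
    unfolding sheet_coords_def O(2) using Cf_upd_iff[OF G(1) q] by auto
  ultimately show ?thesis by auto
qed

text \<open>A chart around the configurations that differ from \<open>q\<close> in the \<open>i\<close>-th coordinate only.\<close>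

definition \<sigma>0 :: "'n \<Rightarrow> bool" where
  "\<sigma>0 k \<longleftrightarrow> k \<noteq> i \<and> q $ k = Infty"

definition t0 :: "complex \<Rightarrow> complex^'n" where
  "t0 z = upd (\<chi> k. affine_coord (q $ k)) i z"

lemma vchart_t0: "vchart \<sigma>0 (t0 z) = upd q i (Aff z)"
proof -
  have "chart (q $ k = Infty) (affine_coord (q $ k)) = q $ k" for k by (rule chart_affine_coord)
  then show ?thesis
    by (auto simp: vec_eq_iff vchart_def \<sigma>0_def t0_def) (simp add: chart_def)
qed

lemma vchart_t0_Infty: "vchart (\<sigma>0(i := True)) (t0 z) = upd q i (chart True z)"
proof -
  have "chart (q $ k = Infty) (affine_coord (q $ k)) = q $ k" for k by (rule chart_affine_coord)
  then show ?thesis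
    by (auto simp: vec_eq_iff vchart_def \<sigma>0_def t0_def)
qed

text \<open>Chain rule along the slice: only the i-th coordinate varies, so one partial derivative
  survives, multiplied by dz/dw for z = b + 1/w.\<close>

lemma sheet_DERIV:
  assumes w: "w \<in> sheet_coords" "w \<noteq> 0" and \<phi>: "\<phi> \<in> U_dual L d"
  shows "((\<lambda>w. \<phi> (F (sheet_point w) d)) has_field_derivative
     \<phi> ((\<omega> \<sigma>0 (t0 (b + 1 / w)) i \<otimes>\<^bsub>Uhat L\<^esub> F (sheet_point w)) d) * (- 1 / w\<^sup>2)) (at w)"
proof -
  let ?c = "\<lambda>k. \<phi> ((\<omega> \<sigma>0 (t0 (b + 1 / w)) k \<otimes>\<^bsub>Uhat L\<^esub> F (sheet_point w)) d)"
  have eq: "vchart \<sigma>0 (t0 (b + 1 / w)) = r (sheet_point w)"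
    using w sheet_point(2)[OF w(1)] by (simp add: vchart_t0 from_coord_def)
  have "((\<lambda>w. b + 1 / w) has_field_derivative - 1 / w\<^sup>2) (at w)"
    using w(2) by (auto intro!: derivative_eq_intros simp: power2_eq_square)
  then have "((\<lambda>w. t0 (b + 1 / w)) has_derivative (\<lambda>x. axis i (- 1 / w\<^sup>2 * x))) (at w)"
    unfolding t0_def by (rule has_derivative_upd)
  from has_derivative_compose[OF this horizontalD[OF W sheet_point(1)[OF w(1)] eq \<phi>]]
  have "((\<lambda>w. \<phi> (F (s (vchart \<sigma>0 (t0 (b + 1 / w)))) d)) has_derivative
     (\<lambda>x. \<Sum>k\<in>UNIV. axis i (- 1 / w\<^sup>2 * x) $ k * ?c k)) (at w)" .
  moreover have "(\<Sum>k\<in>UNIV. axis i (- 1 / w\<^sup>2 * x) $ k * ?c k) = ?c i * (- 1 / w\<^sup>2) * x" for x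
  proof -
    have "(\<Sum>k\<in>UNIV. axis i (- 1 / w\<^sup>2 * x) $ k * ?c k) = (\<Sum>k\<in>UNIV. if k = i then (- 1 / w\<^sup>2 * x) * ?c i else 0)"
      by (intro sum.cong refl) (auto simp: axis_def)
    then show ?thesis by simp
  qed
  ultimately have "((\<lambda>w. \<phi> (F (s (vchart \<sigma>0 (t0 (b + 1 / w)))) d)) has_field_derivative ?c i * (- 1 / w\<^sup>2)) (at w)"
    by (simp only: has_field_derivative_def)
  then show ?thesis
  proof (rule has_field_derivative_transform_within_open)
    show "open (- {0 :: complex})" "w \<in> - {0}" using w by auto
    show "\<phi> (F (s (vchart \<sigma>0 (t0 (b + 1 / v)))) d) = \<phi> (F (sheet_point v) d)" if "v \<in> - {0}" for v
      using that by (simp add: sheet_point_def vchart_t0 from_coord_def)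
  qed
qed

text \<open>At w = 0 the i-th point is at infinity and the chart 1/z takes over. Continuity is
  enough there, since the later arguments allow finitely many points without a derivative.\<close>

lemma sheet_isCont:
  assumes w: "w \<in> sheet_coords" and \<phi>: "\<phi> \<in> U_dual L d"
  shows "isCont (\<lambda>w. \<phi> (F (sheet_point w) d)) w"
proof (cases "w = 0")
  case False
  then show ?thesis using sheet_DERIV[OF w False \<phi>] DERIV_isCont by blast
next
  case True
  have eq: "vchart (\<sigma>0(i := True)) (t0 0) = r (sheet_point w)"
    using True sheet_point(2)[OF w] by (simp add: vchart_t0_Infty from_coord_def chart_def)
  have "isCont (\<lambda>u. \<phi> (F (s (vchart (\<sigma>0(i := True)) u)) d)) (t0 (0 / (1 + b * 0)))"
    using has_derivative_continuous[OF horizontalD[OF W sheet_point(1)[OF w] eq \<phi>]] by simp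
  moreover have "((\<lambda>w. w / (1 + b * w)) has_field_derivative 1) (at 0)"
    by (auto intro!: derivative_eq_intros)
  then have "isCont (\<lambda>w. t0 (w / (1 + b * w))) 0"
    unfolding t0_def using has_derivative_upd has_derivative_continuous by blast
  ultimately have "isCont (\<lambda>w. \<phi> (F (s (vchart (\<sigma>0(i := True)) (t0 (w / (1 + b * w))))) d)) 0"
    by (rule isCont_o2[rotated])
  moreover have "eventually (\<lambda>w. 1 + b * w \<noteq> 0) (nhds 0)"
    by (rule eventually_nhds_in_open[of "{w. 1 + b * w \<noteq> 0}" 0, simplified])
      (intro open_Collect_neq continuous_intros)
  then have "eventually (\<lambda>w. \<phi> (F (s (vchart (\<sigma>0(i := True)) (t0 (w / (1 + b * w))))) d) = \<phi> (F (sheet_point w) d)) (nhds 0)"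
    by eventually_elim (simp add: sheet_point_def vchart_t0_Infty from_coord_eq_chart_True)
  ultimately show ?thesis unfolding True using isCont_cong by fast
qed

lemma sheet_config:
  assumes w: "w \<in> sheet_coords" "w \<noteq> 0"
  shows "vchart \<sigma>0 (t0 (b + 1 / w)) \<in> Cf G" "\<not> \<sigma>0 i" "\<sigma>0 k \<Longrightarrow> t0 (b + 1 / w) $ k = 0"
proof -
  show "vchart \<sigma>0 (t0 (b + 1 / w)) \<in> Cf G"
    using sheet_point(3)[OF w(1)] w(2) by (simp add: vchart_t0 from_coord_def)
qed (auto simp: \<sigma>0_def t0_def)

lemma sheet_DERIV_0:
  assumes w: "w \<in> sheet_coords" "w \<noteq> 0" and \<phi>: "\<phi> \<in> U_dual L 0"
  shows "((\<lambda>w. \<phi> (F (sheet_point w) 0)) has_field_derivative 0) (at w)"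
proof -
  have "(\<omega> \<sigma>0 (t0 (b + 1 / w)) i \<otimes>\<^bsub>Uhat L\<^esub> F (sheet_point w)) 0 = \<zero>\<^bsub>U L\<^esub>"
    using \<omega>_0[OF sheet_config[OF w]] \<omega>_closed[OF sheet_config(1)[OF w]] F_closed[OF sheet_point(4)[OF w(1)]]
    by (intro Uhat_mult_0)
  then show ?thesis using sheet_DERIV[OF w \<phi>] by (simp add: U_dual_zero[OF \<phi>])
qed

lemma sheet_DERIV_1:
  assumes w: "w \<in> sheet_coords" "w \<noteq> 0" and \<phi>: "\<phi> \<in> U_dual L 1"
    and one: "F (sheet_point w) 0 = \<one>\<^bsub>U L\<^esub>"
  shows "((\<lambda>w. \<phi> (F (sheet_point w) 1)) has_field_derivative
     (\<Sum>x\<in>gens_at G i. \<phi> (X_hat G x 1) / (w - coord_away (Aff b) (site q x)))) (at w)"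
proof -
  have "(\<omega> \<sigma>0 (t0 (b + 1 / w)) i \<otimes>\<^bsub>Uhat L\<^esub> F (sheet_point w)) 1 = \<omega> \<sigma>0 (t0 (b + 1 / w)) i 1"
    using \<omega>_0[OF sheet_config[OF w]] \<omega>_closed[OF sheet_config(1)[OF w]] F_closed[OF sheet_point(4)[OF w(1)]] one
    by (intro Uhat_mult_1)
  then have "\<phi> ((\<omega> \<sigma>0 (t0 (b + 1 / w)) i \<otimes>\<^bsub>Uhat L\<^esub> F (sheet_point w)) 1) * (- 1 / w\<^sup>2) =
     (\<Sum>x\<in>gens_at G i. simple_pole (t0 (b + 1 / w) $ i) (site (vchart \<sigma>0 (t0 (b + 1 / w))) x) * \<phi> (X_hat G x 1)) * (- 1 / w\<^sup>2)"
    using is_connection_form_dual[OF G \<omega> sheet_config(1)[OF w] \<phi> sheet_config(2,3)[OF w]] by simp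
  also have "\<dots> = (\<Sum>x\<in>gens_at G i. \<phi> (X_hat G x 1) * (simple_pole (b + 1 / w) (site q x) * (- 1 / w\<^sup>2)))"
    unfolding sum_distrib_right vchart_t0
    by (intro sum.cong refl) (simp add: site_upd t0_def)
  also have "\<dots> = (\<Sum>x\<in>gens_at G i. \<phi> (X_hat G x 1) * (1 / (w - coord_away (Aff b) (site q x)) - 1 / w))"
  proof (intro sum.cong refl arg_cong2[of _ _ _ _ "(*)"] simple_pole_coord)
    fix x assume x: "x \<in> gens_at G i"
    show "site q x \<noteq> Aff b" using x b by (metis imageI)
    show "w \<noteq> 0" by (rule w(2))
    show "from_coord b w \<noteq> site q x"
      using sheet_point(3)[OF w(1)] x unfolding Cf_upd_iff[OF G(1) q] by auto
  qed
  also have "\<dots> = (\<Sum>x\<in>gens_at G i. \<phi> (X_hat G x 1) / (w - coord_away (Aff b) (site q x))) -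
      (\<Sum>x\<in>gens_at G i. \<phi> (X_hat G x 1)) / w"
    by (simp add: right_diff_distrib sum_subtractf sum_divide_distrib)
  \<comment> \<open>Each residue contributed a term at w = 0; relation \<open>sphere\<close> cancels
    them all together.\<close>
  also have "\<dots> = (\<Sum>x\<in>gens_at G i. \<phi> (X_hat G x 1) / (w - coord_away (Aff b) (site q x)))"
    using U_dual_sphere[OF G \<phi>] by simp
  finally show ?thesis using sheet_DERIV[OF w \<phi>] by simp
qed

text \<open>Each linear form of the component has derivative zero off w = 0 and is continuous there.
  Separation by linear forms turns this into equality of the components themselves, not just of
  numbers.\<close>

lemma F_0_constant_on_sheet:
  assumes B: "ball w0 e \<subseteq> sheet_coords" "w \<in> ball w0 e"
  shows "F (sheet_point w) 0 = F (sheet_point w0) 0"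
proof (rule U_dual_separates)
  have mem: "w0 \<in> ball w0 e" using B(2) le_less_trans[OF zero_le_dist[of w0 w]] by simp
  show "F (sheet_point w) 0 \<in> U_grade L 0" "F (sheet_point w0) 0 \<in> U_grade L 0"
    using B mem by (auto intro!: Uhat_closedD F_closed sheet_point(4))
  fix \<phi> assume \<phi>: "\<phi> \<in> U_dual L 0"
  obtain c where "\<And>w. w \<in> ball w0 e \<Longrightarrow> \<phi> (F (sheet_point w) 0) = c"
  proof (rule DERIV_zero_connected_constant)
    show "continuous_on (ball w0 e) (\<lambda>w. \<phi> (F (sheet_point w) 0))"
      using B(1) sheet_isCont[OF _ \<phi>] by (intro continuous_at_imp_continuous_on) auto
    show "\<forall>w\<in>ball w0 e - {0}. ((\<lambda>w. \<phi> (F (sheet_point w) 0)) has_field_derivative 0) (at w)"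
      using B(1) sheet_DERIV_0[OF _ _ \<phi>] by auto
  qed auto
  then show "\<phi> (F (sheet_point w) 0) = \<phi> (F (sheet_point w0) 0)" using B(2) mem by metis
qed

end

end


section \<open>Monodromy\<close>

text \<open>The action is free on the orbits of the q_j, these orbits are disjoint, and they avoid
  the exceptional points. Hence a loop around one pole picks up one generator and not a sum of
  several.\<close>

lemma site_inj:
  assumes G: "subgroup G PSU2" and q: "q \<in> Cf G"
  shows "inj_on (site q) (gens_at G i)"
proof (rule inj_onI)
  interpret group PSU2 by (rule group_PSU2)
  have carr: "g \<in> carrier PSU2" if "g \<in> G" for g using that subgroup.subset[OF G] by blast
  have ne: "act g (q $ j) \<noteq> p" if "g \<in> G" "p \<notin> P1_star G" for g j p
    using that act_P1_star_iff[OF G] Cf_star[OF q] by metis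
  have XX: "j = k \<and> g = h" if gh: "g \<in> G" "h \<in> G" and eq: "act g (q $ j) = act h (q $ k)" for j k g h
  proof -
    let ?l = "inv\<^bsub>PSU2\<^esub> g \<otimes>\<^bsub>PSU2\<^esub> h"
    have l: "?l \<in> G" using gh by (simp add: subgroup.m_closed[OF G] subgroup.m_inv_closed[OF G])
    have "act (inv\<^bsub>PSU2\<^esub> g) (act g (q $ j)) = act ?l (q $ k)"
      unfolding eq using carr[OF gh(1)] carr[OF gh(2)] by (simp add: act_mult)
    then have act_l: "q $ j = act ?l (q $ k)" using carr[OF gh(1)] by (simp add: act_inv)
    then have jk: "j = k" using Cf_neq[OF q _ l] by blast
    then have "?l \<in> stab G (q $ k)" using act_l l by (simp add: stabilizer_def)
    then have "?l = \<one>\<^bsub>PSU2\<^esub>" using Cf_star[OF q, of k] by (simp add: P1_star_def)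
    then have "g \<otimes>\<^bsub>PSU2\<^esub> ?l = g" using carr[OF gh(1)] by simp
    moreover have "g \<otimes>\<^bsub>PSU2\<^esub> ?l = h"
      using carr[OF gh(1)] carr[OF gh(2)] by (simp add: m_assoc[symmetric])
    ultimately show ?thesis using jk by simp
  qed
  fix x y assume "x \<in> gens_at G i" "y \<in> gens_at G i" "site q x = site q y"
  then show "x = y"
    using XX ne by (cases x; cases y) (auto simp: gens_at_iff dest: ne[symmetric])
qed

text \<open>Consequently every pole other than the encircled one falls into the second disc of the
  loop.\<close>

lemma site_marked:
  assumes q: "q \<in> Cf G" and x: "x \<in> gens_at G i"
  shows "site q x \<in> marked_points G q" "site q x \<noteq> q $ i"
proof -
  show "site q x \<in> marked_points G q"
    using x by (cases x) (auto simp: gens_at_iff marked_points_def orbit_def)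
  show "site q x \<noteq> q $ i"
    using x Cf_star[OF q, of i] Cf_neq[OF q, of i] by (cases x) (auto simp: gens_at_iff dest: not_sym)
qed

context flat_section
begin

text \<open>Lifting the loop and reading it in the coordinate w makes the degree-1 part of
  \<open>F\<close> along the lift an instance of \<open>primitive_along_path\<close>.\<close>

lemma monodromy_low_degrees:
  fixes i :: 'n
  assumes \<gamma>: "path \<gamma>" "\<gamma> 0 = q $ i"
    and avoid_sites: "\<forall>t\<in>{0..1}. \<gamma> t \<notin> site q ` gens_at G i" and avoid_b: "\<forall>t\<in>{0..1}. \<gamma> t \<noteq> Aff b"
    and b: "Aff b \<notin> site q ` gens_at G i"
  shows "monodromy C r F y0 (move_point q i \<gamma>) \<in> carrier (Uhat L)"
    "monodromy C r F y0 (move_point q i \<gamma>) 0 = \<one>\<^bsub>U L\<^esub>"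
    "\<phi> \<in> U_dual L 1 \<Longrightarrow> \<phi> (monodromy C r F y0 (move_point q i \<gamma>) 1) = 2 * of_real pi * \<i> *
       (\<Sum>x\<in>gens_at G i. \<phi> (X_hat G x 1) *
          winding_number (coord_away (Aff b) \<circ> \<gamma>) (coord_away (Aff b) (site q x)))"
proof -
  note avoid = avoid_sites[THEN bspec] avoid_b[THEN bspec]
  define g where "g = move_point q i \<gamma>"
  have g_upd: "g t = upd q i (\<gamma> t)" for t by (simp add: g_def move_point_def upd_def)
  have path_g: "path g"
    unfolding path_def g_upd[abs_def] upd_def
  proof (rule continuous_on_vec_lambda)
    show "continuous_on {0..1} (\<lambda>t. if k = i then \<gamma> t else q $ k)" for k
      using \<gamma>(1) by (cases "k = i") (auto simp: path_def)
  qed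
  have im_g: "path_image g \<subseteq> Cf G"
    using avoid(1) by (auto simp: path_image_def g_upd Cf_upd_iff[OF G(1) q])
  have "r y0 = g 0" using y0 by (simp add: g_upd \<gamma>(2) vec_eq_iff)
  then obtain h where h: "path h" "path_image h \<subseteq> C" "h 0 = y0" "\<And>t. t \<in> {0..1} \<Longrightarrow> r (h t) = g t"
    using covering_space_path_lift_exists[OF cov path_g im_g y0(1)] by metis
  have mono: "monodromy C r F y0 (move_point q i \<gamma>) = F (h 1)"
    using lift_endpoint_eqI[OF cov h(1,2,3), of g] h(4) by (simp add: monodromy_def g_def)
  have hC: "h t \<in> C" if "t \<in> {0..1}" for t using h(2) that by (auto simp: path_image_def)
  define c where "c = coord_away (Aff b) \<circ> \<gamma>"
  have from_c: "from_coord b (c t) = \<gamma> t" if "t \<in> {0..1}" for t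
    using avoid(2)[OF that] by (simp add: c_def from_coord_coord_away)
  have path_c: "path c"
    unfolding c_def path_def
  proof (rule continuous_on_compose)
    show "continuous_on {0..1} \<gamma>" using \<gamma>(1) by (simp add: path_def)
    show "continuous_on (\<gamma> ` {0..1}) (coord_away (Aff b))"
      by (rule continuous_on_subset[OF continuous_coord_away]) (use avoid_b in auto)
  qed
  \<comment> \<open>Near each time the lifted path is \<open>sheet_point\<close> applied to the loop
    in the coordinate w, so \<open>F\<close> along the lift factors locally through the
    w-plane.\<close>
  have local: "\<exists>W s e. openin (top_of_set C) W \<and> openin (top_of_set (Cf G)) (r ` W) \<and> homeomorphism W (r ` W) r s \<and>
      0 < e \<and> ball (c a) e \<subseteq> sheet_coords i b W \<and> sheet_point i b s (c a) = h a \<and>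
      (\<forall>\<^sub>F t in at a within {0..1}. c t \<in> ball (c a) e \<and> sheet_point i b s (c t) = h t)"
    if a: "a \<in> {0..1}" for a
  proof -
    obtain W s where W: "h a \<in> W" "openin (top_of_set C) W" "openin (top_of_set (Cf G)) (r ` W)"
      "homeomorphism W (r ` W) r s"
      by (rule covering_space_sheet[OF cov hC[OF a]])
    have sheet: "c t \<in> sheet_coords i b W" "sheet_point i b s (c t) = h t" if t: "t \<in> {0..1}" "h t \<in> W" for t
    proof -
      have eq: "upd q i (from_coord b (c t)) = r (h t)" using t h(4) from_c g_upd by simp
      show "c t \<in> sheet_coords i b W"
        unfolding sheet_coords_def[OF W(2,3,4) b] using t eq by simp
      show "sheet_point i b s (c t) = h t"
        unfolding sheet_point_def[OF W(2,3,4) b] eq using homeomorphism_apply1[OF W(4) t(2)] .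
    qed
    obtain e where e: "e > 0" "ball (c a) e \<subseteq> sheet_coords i b W"
      using open_sheet_coords[OF W(2,3,4) b] sheet(1)[OF a W(1)] by (meson openE)
    obtain O' where O: "open O'" "W = C \<inter> O'" using W(2) unfolding openin_open by blast
    have "(h \<longlongrightarrow> h a) (at a within {0..1})" using h(1) a by (simp add: path_def continuous_on_def)
    then have "\<forall>\<^sub>F t in at a within {0..1}. h t \<in> O'" using O W(1) by (auto simp: tendsto_def)
    moreover have "(c \<longlongrightarrow> c a) (at a within {0..1})" using path_c a by (simp add: path_def continuous_on_def)
    then have "\<forall>\<^sub>F t in at a within {0..1}. c t \<in> ball (c a) e"
      using e(1) by (auto simp: tendsto_iff dist_commute)
    moreover have "\<forall>\<^sub>F t in at a within {0..1}. t \<in> {0..1}" by (simp add: eventually_at_filter)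
    ultimately have "\<forall>\<^sub>F t in at a within {0..1}. c t \<in> ball (c a) e \<and> sheet_point i b s (c t) = h t"
    proof eventually_elim
      case (elim t)
      then have "h t \<in> W" using O hC by simp
      then show ?case using elim sheet(2) by simp
    qed
    then show ?thesis using W e sheet(2)[OF a W(1)] by blast
  qed
  have one: "F (h t) 0 = \<one>\<^bsub>U L\<^esub>" if t: "t \<in> {0..1}" for t
  proof -
    have "F (h 0) 0 = F (h t) 0"
    proof (rule connected_local_const[of "{0..1}" 0 t "\<lambda>t. F (h t) 0"])
      show "\<forall>a\<in>{0..1}. \<forall>\<^sub>F t in at a within {0..1}. F (h a) 0 = F (h t) 0"
      proof
        fix a :: real assume a: "a \<in> {0..1}"
        obtain W s e where W: "openin (top_of_set C) W" "openin (top_of_set (Cf G)) (r ` W)" "homeomorphism W (r ` W) r s"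
          and e: "ball (c a) e \<subseteq> sheet_coords i b W" "sheet_point i b s (c a) = h a"
          and ev: "\<forall>\<^sub>F t in at a within {0..1}. c t \<in> ball (c a) e \<and> sheet_point i b s (c t) = h t"
          using local[OF a] by blast
        from ev show "\<forall>\<^sub>F t in at a within {0..1}. F (h a) 0 = F (h t) 0"
        proof eventually_elim
          case (elim t)
          then show ?case using F_0_constant_on_sheet[OF W b e(1)] e(2) by metis
        qed
      qed
    qed (use t in auto)
    then show ?thesis using h(3) F0 by (simp add: Uhat_def)
  qed
  show "monodromy C r F y0 (move_point q i \<gamma>) \<in> carrier (Uhat L)"
    unfolding mono by (intro F_closed hC) simp
  show "monodromy C r F y0 (move_point q i \<gamma>) 0 = \<one>\<^bsub>U L\<^esub>"
    unfolding mono by (intro one) simp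
  assume \<phi>: "\<phi> \<in> U_dual L 1"
  have "\<phi> (F (h 1) 1) - \<phi> (F (h 0) 1) = 2 * of_real pi * \<i> *
      (\<Sum>x\<in>gens_at G i. \<phi> (X_hat G x 1) * winding_number c (coord_away (Aff b) (site q x)))"
  proof (rule primitive_along_path[OF path_c finite_gens_at[OF G]])
    fix x assume x: "x \<in> gens_at G i"
    show "coord_away (Aff b) (site q x) \<notin> path_image c"
    proof
      assume "coord_away (Aff b) (site q x) \<in> path_image c"
      then obtain t where t: "t \<in> {0..1}" "coord_away (Aff b) (site q x) = c t" by (auto simp: path_image_def)
      have "site q x \<noteq> Aff b" using b x by (metis imageI)
      then have "site q x = \<gamma> t" using from_coord_coord_away[of "site q x" b] from_c[OF t(1)] t(2) by simp
      then show False using avoid(1)[OF t(1)] x by (metis imageI)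
    qed
  next
    fix a :: real assume a: "a \<in> {0..1}"
    obtain W s e where W: "openin (top_of_set C) W" "openin (top_of_set (Cf G)) (r ` W)" "homeomorphism W (r ` W) r s"
      and e: "0 < e" "ball (c a) e \<subseteq> sheet_coords i b W" "sheet_point i b s (c a) = h a"
      and ev: "\<forall>\<^sub>F t in at a within {0..1}. c t \<in> ball (c a) e \<and> sheet_point i b s (c t) = h t"
      using local[OF a] by blast
    \<comment> \<open>The derivative formula is required on a whole disc, whereas \<open>one\<close>
      speaks only of points on the lifted path.\<close>
    have one': "F (sheet_point i b s w) 0 = \<one>\<^bsub>U L\<^esub>" if "w \<in> ball (c a) e" for w
      using F_0_constant_on_sheet[OF W b e(2) that] one[OF a] e(3) by simp
    show "\<exists>N P B. open N \<and> c a \<in> N \<and> finite B \<and> continuous_on N P \<and>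
       (\<forall>w\<in>N - B. (P has_field_derivative (\<Sum>x\<in>gens_at G i. \<phi> (X_hat G x 1) / (w - coord_away (Aff b) (site q x)))) (at w)) \<and>
       \<phi> (F (h a) 1) = P (c a) \<and> (\<forall>\<^sub>F t in at a within {0..1}. \<phi> (F (h t) 1) = P (c t))"
    proof (intro exI conjI)
      show "open (ball (c a) e)" "c a \<in> ball (c a) e" "finite {0 :: complex}" using e(1) by auto
      show "continuous_on (ball (c a) e) (\<lambda>w. \<phi> (F (sheet_point i b s w) 1))"
        using e(2) sheet_isCont[OF W b _ \<phi>] by (intro continuous_at_imp_continuous_on) blast
      show "\<forall>w\<in>ball (c a) e - {0}. ((\<lambda>w. \<phi> (F (sheet_point i b s w) 1)) has_field_derivative
          (\<Sum>x\<in>gens_at G i. \<phi> (X_hat G x 1) / (w - coord_away (Aff b) (site q x)))) (at w)"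
        using e(2) sheet_DERIV_1[OF W b _ _ \<phi> one'] by blast
      show "\<phi> (F (h a) 1) = \<phi> (F (sheet_point i b s (c a)) 1)" by (simp add: e(3))
      show "\<forall>\<^sub>F t in at a within {0..1}. \<phi> (F (h t) 1) = \<phi> (F (sheet_point i b s (c t)) 1)"
        using ev by eventually_elim simp
    qed
  qed
  moreover have "\<phi> (F (h 0) 1) = 0"
    unfolding h(3) F0 by (simp add: Uhat_def U_dual_zero[OF \<phi>])
  ultimately show "\<phi> (monodromy C r F y0 (move_point q i \<gamma>) 1) = 2 * of_real pi * \<i> *
       (\<Sum>x\<in>gens_at G i. \<phi> (X_hat G x 1) *
          winding_number (coord_away (Aff b) \<circ> \<gamma>) (coord_away (Aff b) (site q x)))"
    by (simp add: mono c_def)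
qed

text \<open>Both families of loops at once: \<open>x0\<close> is any generator attached to the
  moving point i.\<close>

lemma monodromy_clockwise_loop:
  assumes x0: "x0 \<in> gens_at G i"
    and loop: "clockwise_loop (q $ i) (site q x0) (marked_points G q - {q $ i, site q x0}) \<gamma>"
  shows "\<exists>R\<in>carrier (Uhat L). (\<forall>d<2. R d = \<zero>\<^bsub>U L\<^esub>) \<and>
     monodromy C r F y0 (move_point q i \<gamma>) =
       \<one>\<^bsub>Uhat L\<^esub> \<oplus>\<^bsub>Uhat L\<^esub> Uhat_scale L (- 2 * \<i> * of_real pi) (X_hat G x0) \<oplus>\<^bsub>Uhat L\<^esub> R"
proof -
  let ?p = "site q x0"
  obtain D1 D2 where D: "open D2" "D1 \<inter> D2 = {}" "D1 \<union> D2 = - path_image \<gamma>"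
    "D2 homeomorphic ball (0::complex) 1" "?p \<in> D1" "marked_points G q - {q $ i, ?p} \<subseteq> D2"
    and wind: "\<And>b. b \<in> D2 \<Longrightarrow> winding_number (coord_away b \<circ> \<gamma>) (coord_away b ?p) = - 1"
    and \<gamma>: "simple_path \<gamma>" "pathstart \<gamma> = q $ i"
    using loop unfolding clockwise_loop_def by blast
  have path: "path \<gamma>" "\<gamma> 0 = q $ i" using \<gamma> by (simp_all add: simple_path_imp_path pathstart_def)
  have other: "site q x \<in> D2" "?p \<noteq> site q x" if "x \<in> gens_at G i" "x \<noteq> x0" for x
  proof -
    show "?p \<noteq> site q x" using inj_onD[OF site_inj[OF G(1) q], of x0 x i] that x0 by metis
    then show "site q x \<in> D2" using site_marked[OF q that(1)] D(6) by auto
  qed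
  have notin: "\<gamma> t \<notin> D1 \<union> D2" if "t \<in> {0..1}" for t
    unfolding D(3) using that by (auto simp: path_image_def)
  have avoid: "\<gamma> t \<noteq> site q x" if "t \<in> {0..1}" "x \<in> gens_at G i" for t x
    using notin[OF that(1)] other(1)[OF that(2)] D(5) by (cases "x = x0") auto
  \<comment> \<open>The centre b must be affine and distinct from all poles; an infinite disc leaves
    room for it.\<close>
  have "D2 \<noteq> {}" using D(4) by (auto simp: homeomorphic_empty)
  then have "infinite D2" using infinite_open_P1[OF D(1)] by blast
  moreover have "finite (insert Infty (site q ` gens_at G i))" using finite_gens_at[OF G] by blast
  ultimately have "D2 - insert Infty (site q ` gens_at G i) \<noteq> {}"
    by (metis Diff_infinite_finite finite.emptyI)
  then obtain y where y: "y \<in> D2" "y \<notin> insert Infty (site q ` gens_at G i)" by blast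
  then obtain b where b: "y = Aff b" by (cases y) auto
  let ?c = "coord_away (Aff b) \<circ> \<gamma>" and ?w = "\<lambda>x. coord_away (Aff b) (site q x)"
  have \<gamma>b: "\<gamma> t \<noteq> Aff b" if "t \<in> {0..1}" for t using notin[OF that] y b by auto
  then have \<gamma>b': "\<forall>t\<in>{0..1}. \<gamma> t \<noteq> Aff b" by blast
  have bsite: "Aff b \<notin> site q ` gens_at G i" using y b by simp
  have bsite': "site q x \<noteq> Aff b" if "x \<in> gens_at G i" for x using bsite that by (metis imageI)
  have path_c: "path ?c"
    unfolding path_def
  proof (rule continuous_on_compose)
    show "continuous_on {0..1} \<gamma>" using path by (simp add: path_def)
    show "continuous_on (\<gamma> ` {0..1}) (coord_away (Aff b))"
      by (rule continuous_on_subset[OF continuous_coord_away]) (use \<gamma>b' in auto)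
  qed
  have w_notin: "?w x \<notin> path_image ?c" if "x \<in> gens_at G i" for x
  proof
    assume "?w x \<in> path_image ?c"
    then obtain t where "t \<in> {0..1}" "?w x = coord_away (Aff b) (\<gamma> t)" by (auto simp: path_image_def)
    then show False
      using inj_onD[OF inj_coord_away, of b "site q x" "\<gamma> t"] bsite'[OF that] \<gamma>b avoid[OF _ that] by auto
  qed
  have wind0: "winding_number ?c (?w x0) = - 1" using wind y b by simp
  \<comment> \<open>The winding condition is used twice, at b and at the pole s itself, both in the
    second disc. Each coordinate gives -1, and by the quotient formula the winding number around s
    is their difference.\<close>
  have wind_other: "winding_number ?c (?w x) = 0" if x: "x \<in> gens_at G i" "x \<noteq> x0" for x
  proof -
    obtain k where k: "k \<noteq> 0" and quot: "\<And>z. z \<noteq> Aff b \<Longrightarrow> z \<noteq> site q x \<Longrightarrow>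
       coord_away (site q x) z - coord_away (site q x) ?p =
       k * (coord_away (Aff b) z - ?w x0) / (coord_away (Aff b) z - ?w x)"
      using coord_away_quotient[OF bsite'[OF x(1)] bsite'[OF x0] other(2)[OF x]] by metis
    have "winding_number (coord_away (site q x) \<circ> \<gamma>) (coord_away (site q x) ?p) =
       winding_number ?c (?w x0) - winding_number ?c (?w x)"
    proof (rule winding_number_quotient[OF path_c w_notin[OF x0] w_notin[OF x(1)] k])
      fix t :: real assume "t \<in> {0..1}"
      then show "(coord_away (site q x) \<circ> \<gamma>) t - coord_away (site q x) ?p =
        k * (?c t - ?w x0) / (?c t - ?w x)"
        using quot[of "\<gamma> t"] \<gamma>b avoid[OF _ x(1)] by simp
    qed
    then show ?thesis using wind[OF other(1)[OF x]] wind0 by simp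
  qed
  let ?M = "monodromy C r F y0 (move_point q i \<gamma>)"
  have "\<forall>t\<in>{0..1}. \<gamma> t \<notin> site q ` gens_at G i" using avoid by blast
  note M = monodromy_low_degrees[OF path this \<gamma>b' bsite]
  have x0_closed: "X_hat G x0 \<in> carrier (Uhat L)"
    by (rule X_hat_closed[OF G subsetD[OF gens_at_subset x0]])
  have M1: "?M 1 = U_scale L (- 2 * \<i> * of_real pi) (X_hat G x0 1)"
  \<comment> \<open>A single summand survives, with winding number -1; the factor 2 pi i from the
    logarithm gives the constant.\<close>
  proof (rule U_dual_separates)
    show "?M 1 \<in> U_grade L 1" "U_scale L (- 2 * \<i> * of_real pi) (X_hat G x0 1) \<in> U_grade L 1"
      using M(1) x0_closed by (auto intro: U_grade_scale Uhat_closedD)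
    fix \<phi> assume \<phi>: "\<phi> \<in> U_dual L 1"
    have "(\<Sum>x\<in>gens_at G i. \<phi> (X_hat G x 1) * winding_number ?c (?w x)) = \<phi> (X_hat G x0 1) * winding_number ?c (?w x0)"
      using x0 wind_other by (subst sum.remove[OF finite_gens_at[OF G] x0]) auto
    then show "\<phi> (?M 1) = \<phi> (U_scale L (- 2 * \<i> * of_real pi) (X_hat G x0 1))"
      using M(3)[OF \<phi>] Uhat_closedD[OF x0_closed, of 1] by (simp add: wind0 U_dual_scale[OF \<phi>] mult_ac)
  qed
  interpret U: ring "U L" by (rule ring_U)
  have carr: "?M d \<in> carrier (U L)" for d using Uhat_closedD[OF M(1)] U_grade_subset by blast
  \<comment> \<open>The remainder is the monodromy itself with its components of degree 0 and 1 cut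
    off.\<close>
  define R where "R d = (if d < 2 then \<zero>\<^bsub>U L\<^esub> else ?M d)" for d
  have "R \<in> carrier (Uhat L)" using M(1) by (simp add: R_def Uhat_def U_grade_zero)
  moreover have "\<forall>d<2. R d = \<zero>\<^bsub>U L\<^esub>" by (simp add: R_def)
  moreover have "?M = \<one>\<^bsub>Uhat L\<^esub> \<oplus>\<^bsub>Uhat L\<^esub> Uhat_scale L (- 2 * \<i> * of_real pi) (X_hat G x0) \<oplus>\<^bsub>Uhat L\<^esub> R"
  proof (rule ext)
    fix d :: nat
    consider "d = 0" | "d = 1" | "d \<ge> 2" by linarith
    then show "?M d = (\<one>\<^bsub>Uhat L\<^esub> \<oplus>\<^bsub>Uhat L\<^esub> Uhat_scale L (- 2 * \<i> * of_real pi) (X_hat G x0) \<oplus>\<^bsub>Uhat L\<^esub> R) d"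
    proof cases
      case 1
      then show ?thesis using M(2)
        by (simp add: Uhat_add R_def Uhat_scale_def X_hat_eq[OF G] U_scale_zero) (simp add: Uhat_def)
    next
      case 2
      then show ?thesis using M1 carr[of 1]
        by (simp add: Uhat_add R_def Uhat_scale_def) (simp add: Uhat_def)
    next
      case 3
      then show ?thesis using carr[of d]
        by (simp add: Uhat_add R_def Uhat_scale_def X_hat_eq[OF G] U_scale_zero) (simp add: Uhat_def)
    qed
  qed
  ultimately show ?thesis by blast
qed

end

theorem proposition1p11:
  fixes G :: "(complex^2^2) set set"
    and q :: "P1^('n::{finite,linorder})"
    and C :: "'c::topological_space set"
    and r :: "'c \<Rightarrow> P1^('n::{finite,linorder})"
    and y0 :: 'c
    and \<omega> :: "('n \<Rightarrow> bool) \<Rightarrow> complex^('n::{finite,linorder}) \<Rightarrow> 'n \<Rightarrow> 'n Upn_hat"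
    and F :: "'c \<Rightarrow> 'n Upn_hat"
  assumes "subgroup G PSU2" and "finite G"
    and "q \<in> Cf G"
    and "covering_space C r (Cf G)" and "simply_connected C"
    and "y0 \<in> C" and "r y0 = q"
    and "is_connection_form G \<omega>"
    and "horizontal G \<omega> C r F" and "F y0 = \<one>\<^bsub>Uhat (pn G)\<^esub>"
  shows
    "(\<forall>i j g \<gamma>. i < j \<and> g \<in> G \<and>
        clockwise_loop (q $ i) (act g (q $ j)) (marked_points G q - {q $ i, act g (q $ j)}) \<gamma> \<longrightarrow>
        (\<exists>R\<in>carrier (Uhat (pn G)). (\<forall>d<2. R d = \<zero>\<^bsub>U (pn G)\<^esub>) \<and>
           monodromy C r F y0 (move_point q i \<gamma>) =
             \<one>\<^bsub>Uhat (pn G)\<^esub> \<oplus>\<^bsub>Uhat (pn G)\<^esub>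
             Uhat_scale (pn G) (- 2 * \<i> * of_real pi) (X_hat G (XX i j g)) \<oplus>\<^bsub>Uhat (pn G)\<^esub> R)) \<and>
     (\<forall>k p \<gamma>. p \<notin> P1_star G \<and>
        clockwise_loop (q $ k) p (marked_points G q - {q $ k, p}) \<gamma> \<longrightarrow>
        (\<exists>R\<in>carrier (Uhat (pn G)). (\<forall>d<2. R d = \<zero>\<^bsub>U (pn G)\<^esub>) \<and>
           monodromy C r F y0 (move_point q k \<gamma>) =
             \<one>\<^bsub>Uhat (pn G)\<^esub> \<oplus>\<^bsub>Uhat (pn G)\<^esub>
             Uhat_scale (pn G) (- 2 * \<i> * of_real pi) (X_hat G (XP k p)) \<oplus>\<^bsub>Uhat (pn G)\<^esub> R))"
proof -
  interpret flat_section G q C r y0 \<omega> F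
    using assms by (intro flat_section.intro)
  show ?thesis
  proof (intro conjI allI impI; elim conjE)
    fix i j :: 'n and g \<gamma>
    assume "i < j" "g \<in> G"
      "clockwise_loop (q $ i) (act g (q $ j)) (marked_points G q - {q $ i, act g (q $ j)}) \<gamma>"
    then have "XX i j g \<in> gens_at G i"
      and "clockwise_loop (q $ i) (site q (XX i j g)) (marked_points G q - {q $ i, site q (XX i j g)}) \<gamma>"
      by (simp_all add: gens_at_iff)
    then show "\<exists>R\<in>carrier (Uhat (pn G)). (\<forall>d<2. R d = \<zero>\<^bsub>U (pn G)\<^esub>) \<and>
      monodromy C r F y0 (move_point q i \<gamma>) = \<one>\<^bsub>Uhat (pn G)\<^esub> \<oplus>\<^bsub>Uhat (pn G)\<^esub>
        Uhat_scale (pn G) (- 2 * \<i> * of_real pi) (X_hat G (XX i j g)) \<oplus>\<^bsub>Uhat (pn G)\<^esub> R"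
      by (rule monodromy_clockwise_loop)
  next
    fix k :: 'n and p \<gamma>
    assume "p \<notin> P1_star G" "clockwise_loop (q $ k) p (marked_points G q - {q $ k, p}) \<gamma>"
    then have "XP k p \<in> gens_at G k"
      and "clockwise_loop (q $ k) (site q (XP k p)) (marked_points G q - {q $ k, site q (XP k p)}) \<gamma>"
      by (simp_all add: gens_at_iff)
    then show "\<exists>R\<in>carrier (Uhat (pn G)). (\<forall>d<2. R d = \<zero>\<^bsub>U (pn G)\<^esub>) \<and>
      monodromy C r F y0 (move_point q k \<gamma>) = \<one>\<^bsub>Uhat (pn G)\<^esub> \<oplus>\<^bsub>Uhat (pn G)\<^esub>
        Uhat_scale (pn G) (- 2 * \<i> * of_real pi) (X_hat G (XP k p)) \<oplus>\<^bsub>Uhat (pn G)\<^esub> R"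
      by (rule monodromy_clockwise_loop)
  qed
qed

end
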